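(* Let $n$ and $r$ be integers with $0\leq r\leq n-2$, let $\mathcal P_n$ be the partition monoid of degree $n$, and let $P=\mathsf P(\mathcal P_n)$ be its projection algebra. Let $e\in\mathcal P_n$ be any idempotent of rank $r$. Then the maximal subgroup of the free projection-generated regular $*$-semigroup $\mathsf{PG}(P)$ corresponding to $e$ (that is, the $\mathscr H$-class in $\mathsf{PG}(P)$ of the idempotent $x_{ee^*}x_{e^*e}$) is isomorphic to the symmetric group $\mathcal S_r$.
   Context: **Partition monoid.** $\mathcal P_n$ consists of all set partitions of $[n]\cup[n]'$, where $[n]=\{1,\dots,n\}$ and $[n]'=\{1',\dots,n'\}$. A partition is identified with any graph on $[n]\cup[n]'$ whose connected components are its blocks. To multiply $a,b\in\mathcal P_n$: let $[n]''$ be a third copy of $[n]$, rename the vertices $x'$ of $a$ to $x''$, rename the vertices $x$ of $b$ to $x''$, and take the union of the edges to obtain the product graph $\Gamma(a,b)$ on $[n]\cup[n]''\cup[n]'$; then $x,y\in[n]\cup[n]'$ are in the same block of $ab$ iff they are in the same connected component of $\Gamma(a,b)$. A block meeting both $[n]$ and $[n]'$ is a transversal; the rank of $a$ is its number of transversals. The involution $a\mapsto a^*$ swaps $x\leftrightarrow x'$ for all $x\in[n]$; it makes $\mathcal P_n$ a regular $*$-semigroup, i.e. $(a^* )^*=a=aa^*a$ and $(ab)^*=b^*a^*$. **Projections and $\mathsf{PG}(P)$.** For a regular $*$-semigroup $S$, a projection is an element $p$ with $p^2=p=p^*$, and $P=\mathsf P(S)$ is the set of projections (for $p,q\in P$ one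 has $pqp\in P$; $P$ with the unary operations $q\mapsto pqp$, $p\in P$, is the projection algebra of $S$). $\mathsf{PG}(P)$ is the semigroup defined by the semigroup presentation with generators $x_p$ ($p\in P$) and relations $x_p^2=x_p$, $(x_px_q)^2=x_px_q$, $x_px_qx_p=x_{pqp}$ (for all $p,q\in P$), where $pqp$ is computed in $S$. For each idempotent $e$ of $S$, $ee^*$ and $e^*e$ are projections, and $e\mapsto x_{ee^*}x_{e^*e}$ is a bijection from the idempotents of $S$ to those of $\mathsf{PG}(P)$. The maximal subgroup of a semigroup containing an idempotent is its $\mathscr H$-class. $\mathcal S_r$ is the symmetric group on $r$ points ($\mathcal S_0$ is trivial). *)

theory Defs
  imports "HOL-Algebra.Sym_Groups" "HOL-Library.Disjoint_Sets"
begin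

section \<open>Semigroups and maximal subgroups\<close>

text \<open>HOL-Algebra's record \<open>monoid\<close> carries an identity, which a semigroup need not have.\<close>

record 'a semigrp = "'a partial_object" +
  sg_mult :: "'a \<Rightarrow> 'a \<Rightarrow> 'a" (infixl "\<cdot>\<index>" 70)

record 'a star_semigrp = "'a semigrp" +
  star :: "'a \<Rightarrow> 'a"

text \<open>\<open>S\<^sup>1a\<close> and \<open>aS\<^sup>1\<close>.\<close>

definition left_ideal :: "('a, 'm) semigrp_scheme \<Rightarrow> 'a \<Rightarrow> 'a set" where
  "left_ideal S a = insert a {s \<cdot>\<^bsub>S\<^esub> a |s. s \<in> carrier S}"

definition right_ideal :: "('a, 'm) semigrp_scheme \<Rightarrow> 'a \<Rightarrow> 'a set" where
  "right_ideal S a = insert a {a \<cdot>\<^bsub>S\<^esub> s |s. s \<in> carrier S}"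

definition H_class :: "('a, 'm) semigrp_scheme \<Rightarrow> 'a \<Rightarrow> 'a set" where
  "H_class S a =
     {b \<in> carrier S. left_ideal S b = left_ideal S a \<and> right_ideal S b = right_ideal S a}"

definition is_idempotent :: "('a, 'm) semigrp_scheme \<Rightarrow> 'a \<Rightarrow> bool" where
  "is_idempotent S e \<longleftrightarrow> e \<in> carrier S \<and> e \<cdot>\<^bsub>S\<^esub> e = e"

text \<open>Intended for an idempotent \<open>e\<close>.\<close>

definition maximal_subgroup :: "('a, 'm) semigrp_scheme \<Rightarrow> 'a \<Rightarrow> 'a monoid" where
  "maximal_subgroup S e = \<lparr>carrier = H_class S e, mult = sg_mult S, one = e\<rparr>"


section \<open>Semigroup presentations\<close>

text \<open>The free semigroup on \<open>A\<close> is the set of nonempty lists over \<open>A\<close>, under concatenation.\<close>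

definition free_words :: "'a set \<Rightarrow> 'a list set" where
  "free_words A = lists A - {[]}"

inductive_set generated_congruence :: "'a set \<Rightarrow> ('a list \<times> 'a list) set \<Rightarrow> ('a list \<times> 'a list) set"
  for A :: "'a set" and R :: "('a list \<times> 'a list) set"
where
  rel: "(u, v) \<in> R \<Longrightarrow> u \<in> free_words A \<Longrightarrow> v \<in> free_words A
          \<Longrightarrow> (u, v) \<in> generated_congruence A R"
| refl: "u \<in> free_words A \<Longrightarrow> (u, u) \<in> generated_congruence A R"
| sym: "(u, v) \<in> generated_congruence A R \<Longrightarrow> (v, u) \<in> generated_congruence A R"
| trans: "(u, v) \<in> generated_congruence A R \<Longrightarrow> (v, w) \<in> generated_congruence A R
          \<Longrightarrow> (u, w) \<in> generated_congruence A R"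
| append: "(u, v) \<in> generated_congruence A R \<Longrightarrow> (u', v') \<in> generated_congruence A R
          \<Longrightarrow> (u @ u', v @ v') \<in> generated_congruence A R"

definition presented_semigrp :: "'a set \<Rightarrow> ('a list \<times> 'a list) set \<Rightarrow> 'a list set semigrp" where
  "presented_semigrp A R =
     \<lparr>carrier = free_words A // generated_congruence A R,
      sg_mult = (\<lambda>X Y. \<Union>u\<in>X. \<Union>v\<in>Y. generated_congruence A R `` {u @ v})\<rparr>"


section \<open>Projection algebras and \<open>PG(P)\<close>\<close>

definition projections :: "('a, 'm) star_semigrp_scheme \<Rightarrow> 'a set" where
  "projections S = {p \<in> carrier S. p \<cdot>\<^bsub>S\<^esub> p = p \<and> star S p = p}"

record 'a proj_alg = "'a partial_object" +
  conj_op :: "'a \<Rightarrow> 'a \<Rightarrow> 'a"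

definition projection_algebra :: "('a, 'm) star_semigrp_scheme \<Rightarrow> 'a proj_alg" where
  "projection_algebra S =
     \<lparr>carrier = projections S, conj_op = (\<lambda>p q. p \<cdot>\<^bsub>S\<^esub> q \<cdot>\<^bsub>S\<^esub> p)\<rparr>"

definition PG_relations :: "('a, 'm) proj_alg_scheme \<Rightarrow> ('a list \<times> 'a list) set" where
  "PG_relations P =
     {([p, p], [p]) |p. p \<in> carrier P}
     \<union> {([p, q, p, q], [p, q]) |p q. p \<in> carrier P \<and> q \<in> carrier P}
     \<union> {([p, q, p], [conj_op P p q]) |p q. p \<in> carrier P \<and> q \<in> carrier P}"

definition PG :: "('a, 'm) proj_alg_scheme \<Rightarrow> 'a list set semigrp" where
  "PG P = presented_semigrp (carrier P) (PG_relations P)"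

definition PG_gen :: "('a, 'm) proj_alg_scheme \<Rightarrow> 'a \<Rightarrow> 'a list set" where
  "PG_gen P p = generated_congruence (carrier P) (PG_relations P) `` {[p]}"

definition PG_idem :: "('a, 'm) star_semigrp_scheme \<Rightarrow> 'a \<Rightarrow> 'a list set" where
  "PG_idem S e =
     (let P = projection_algebra S
      in PG_gen P (e \<cdot>\<^bsub>S\<^esub> star S e) \<cdot>\<^bsub>PG P\<^esub> PG_gen P (star S e \<cdot>\<^bsub>S\<^esub> e))"


section \<open>The partition monoid\<close>

text \<open>\<open>Up i\<close>, \<open>Lo i\<close> and \<open>Mid i\<close> stand for \<open>i\<close>, \<open>i'\<close> and \<open>i''\<close>. Vertices \<open>Mid i\<close> occur only in
  product graphs.\<close>

datatype vertex = Up nat | Lo nat | Mid nat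

definition upper :: "nat \<Rightarrow> vertex set" where "upper n = Up ` {1..n}"
definition lower :: "nat \<Rightarrow> vertex set" where "lower n = Lo ` {1..n}"

type_synonym set_partition = "vertex set set"

definition partitions :: "nat \<Rightarrow> set_partition set" where
  "partitions n = {a. partition_on (upper n \<union> lower n) a}"

fun lo_to_mid :: "vertex \<Rightarrow> vertex" where
  "lo_to_mid (Lo i) = Mid i"
| "lo_to_mid v = v"

fun up_to_mid :: "vertex \<Rightarrow> vertex" where
  "up_to_mid (Up i) = Mid i"
| "up_to_mid v = v"

fun swap_levels :: "vertex \<Rightarrow> vertex" where
  "swap_levels (Up i) = Lo i"
| "swap_levels (Lo i) = Up i"
| "swap_levels (Mid i) = Mid i"

text \<open>The graph chosen to represent a partition joins any two vertices of a common block; the edge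
  relations below are therefore symmetric, so that connectedness is the reflexive-transitive
  closure.\<close>

definition block_edges :: "set_partition \<Rightarrow> (vertex \<times> vertex) set" where
  "block_edges a = (\<Union>B\<in>a. B \<times> B)"

definition product_graph :: "set_partition \<Rightarrow> set_partition \<Rightarrow> (vertex \<times> vertex) set" where
  "product_graph a b =
     map_prod lo_to_mid lo_to_mid ` block_edges a \<union> map_prod up_to_mid up_to_mid ` block_edges b"

definition partition_mult :: "nat \<Rightarrow> set_partition \<Rightarrow> set_partition \<Rightarrow> set_partition" where
  "partition_mult n a b =
     (upper n \<union> lower n) // {(x, y). x \<in> upper n \<union> lower n \<and> y \<in> upper n \<union> lower n
                                    \<and> (x, y) \<in> (product_graph a b)\<^sup>*}"

definition partition_star :: "set_partition \<Rightarrow> set_partition" where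
  "partition_star a = (\<lambda>B. swap_levels ` B) ` a"

definition partition_monoid :: "nat \<Rightarrow> set_partition star_semigrp" where
  "partition_monoid n =
     \<lparr>carrier = partitions n, sg_mult = partition_mult n, star = partition_star\<rparr>"

definition partition_rank :: "nat \<Rightarrow> set_partition \<Rightarrow> nat" where
  "partition_rank n a = card {B \<in> a. B \<inter> upper n \<noteq> {} \<and> B \<inter> lower n \<noteq> {}}"

end

(* The semigroup PG(P) is generated by two families of projections of the partition monoid:
   fuse l, with kernel l and all blocks transversal, and isolate B, the identity with the points of B
   cut off; every projection p equals fuse l . isolate B . fuse l, hence is a product of these in PG(P).

   Let q = e e* and fix an element of PG(P) over q whose r transversals end at separate lower
   points. Multiplying by fuse {i, j} and then by isolate {i} slides the end i to an unoccupied point j.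
   These moves satisfy the relations of token sliding on the complete graph with n vertices, where for
   n >= r + 2 every closed walk is a product of triangles and commuting squares. Therefore each
   configuration c of the r ends determines one element sigma(c) of PG(P), whatever the order of the moves.

   Every element of x_q PG(P) whose image still has r separated transversals is sigma(c) . fuse l, where c
   and l (the lower kernel) can be read off from its image in the partition monoid. Hence the
   H-class of x_q maps injectively to the permutations of the r transversals, and
   the elements sigma(c) . fuse (ker q), with c a rearrangement of the original ends, realise all of them. *)

theory Submission
  imports Defs
begin

section \<open>Sliding tokens on a complete graph\<close>

text \<open>The bound \<open>r + 2 \<le> n\<close> leaves at least two unoccupied points in every
  configuration. Both kinds of local relation consume them: the triangle i, j, k requires j and k to
  be free, and two commuting moves have two different free targets. Tokens are labelled, so a
  configuration is a list, and the permutations in the subgroup are rearrangements of that list.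

  The transversals of \<open>x_q\<close> may have large lower parts, so sliding does not start at
  \<open>x_q\<close> but at its product with a projection \<open>P0\<close> that keeps one lower
  point of each transversal; \<open>q P0 q = q\<close> and \<open>P0 q P0 = P0\<close> make this
  step reversible.

  Distinct permutations are told apart by evaluating in the partition monoid. That evaluation needs
  associativity and \<open>a a* a = a\<close> for a product defined by graphs, hence the long study
  of this product.

  The theorem concerns \<open>x_q x_p\<close> with \<open>p = e* e\<close>. Because
  \<open>q p q = q\<close>, right multiplication by \<open>x_q x_p\<close> carries the subgroup at
  \<open>x_q\<close> onto the one at \<open>x_q x_p\<close>, so the main work takes place at a
  projection.\<close>

definition configs :: "'v set \<Rightarrow> nat \<Rightarrow> 'v list set" where
  "configs V r = {c. distinct c \<and> set c \<subseteq> V \<and> length c = r}"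

lemma configs_0 [simp]: "configs V 0 = {[]}"
  by (auto simp: configs_def)

lemma Cons_in_configs [simp]:
  "a # d \<in> configs V (Suc r) \<longleftrightarrow> a \<in> V \<and> d \<in> configs (V - {a}) r"
  by (auto simp: configs_def)

lemma configs_SucE:
  assumes "c \<in> configs V (Suc r)"
  obtains a d where "c = a # d" "a \<in> V" "d \<in> configs (V - {a}) r"
  using assms by (cases c) (auto simp: configs_def)

lemma configs_nonempty:
  assumes "finite V" "r \<le> card V"
  obtains c where "c \<in> configs V r"
proof -
  obtain W where W: "W \<subseteq> V" "card W = r"
    using assms obtain_subset_with_card_n by metis
  then obtain c where "set c = W" "distinct c"
    using assms(1) finite_distinct_list finite_subset by metis
  then show thesis
    using W distinct_card by (intro that[of c]) (fastforce simp: configs_def)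
qed

lemma configs_update:
  assumes "c \<in> configs V r" "k < r" "j \<in> V - set c"
  shows "c[k := j] \<in> configs V r"
  using assms set_update_subset_insert[of c k j]
  by (auto simp: configs_def distinct_list_update)

text \<open>Induction on the number of tokens. With the first token frozen, the others are connected
  by the induction hypothesis. Before the first token moves from \<open>a\<close> to
  \<open>b\<close>, the others are parked in a configuration \<open>c''\<close> avoiding both
  points, which exists because \<open>Suc r < card V\<close>. The form is that of an induction
  principle: a property preserved by moves spreads from one configuration to all.\<close>

lemma configs_connected:
  assumes "finite V" "r < card V" "c \<in> configs V r" "d \<in> configs V r" "Q c"
    and "\<And>c k j. c \<in> configs V r \<Longrightarrow> k < r \<Longrightarrow> j \<in> V - set c \<Longrightarrow> Q c \<Longrightarrow> Q (c[k := j])"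
  shows "Q d"
  using assms
proof (induction r arbitrary: V c d Q)
  case 0
  then show ?case by simp
next
  case (Suc r)
  have fixed_head: "Q (a # d')"
    if "a \<in> V" "c' \<in> configs (V - {a}) r" "d' \<in> configs (V - {a}) r" "Q (a # c')" for a c' d'
  proof (rule Suc.IH[of "V - {a}" c' d' "\<lambda>c. Q (a # c)"])
    show "r < card (V - {a})"
      using Suc.prems(1,2) \<open>a \<in> V\<close> by simp
    show "Q (a # c''[k := j])"
      if "c'' \<in> configs (V - {a}) r" "k < r" "j \<in> V - {a} - set c''" "Q (a # c'')" for c'' k j
      using Suc.prems(6)[of "a # c''" "Suc k" j] that \<open>a \<in> V\<close> by simp
  qed (use that Suc.prems(1) in auto)
  obtain a c' where c: "c = a # c'" "a \<in> V" "c' \<in> configs (V - {a}) r"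
    using Suc.prems(3) by (rule configs_SucE)
  obtain b d' where d: "d = b # d'" "b \<in> V" "d' \<in> configs (V - {b}) r"
    using Suc.prems(4) by (rule configs_SucE)
  show ?case
  proof (cases "a = b")
    case True
    then show ?thesis
      using fixed_head[of a c' d'] c d Suc.prems(5) by simp
  next
    case False
    have "r \<le> card (V - {a} - {b})"
      using Suc.prems(1,2) c(2) d(2) False by (simp add: card_Diff_subset)
    then obtain c'' where c'': "c'' \<in> configs (V - {a} - {b}) r"
      using configs_nonempty Suc.prems(1) by (metis finite_Diff)
    then have c''_a: "c'' \<in> configs (V - {a}) r" and c''_b: "c'' \<in> configs (V - {b}) r"
      and "b \<notin> set c''"
      by (auto simp: configs_def)
    have "Q (a # c'')"
      using fixed_head[of a c' c''] c c''_a Suc.prems(5) by simp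
    then have "Q (b # c'')"
      using Suc.prems(6)[of "a # c''" 0 b] c''_a \<open>b \<notin> set c''\<close> c(2) d(2) False by simp
    then show ?thesis
      using fixed_head[of b c'' d'] c''_b d by simp
  qed
qed

text \<open>The states in \<open>'x\<close> are abstract; tokens are seen only through the points
  they leave free. \<open>V0\<close> is fixed once, while \<open>section_exists\<close> passes to
  ever smaller subsets \<open>V\<close> of it under the same laws.\<close>

locale sliding =
  fixes hole :: "'v \<Rightarrow> 'x \<Rightarrow> bool"
    and slide :: "'v \<Rightarrow> 'v \<Rightarrow> 'x \<Rightarrow> 'x"
    and V0 :: "'v set"
  assumes hole_slide_self: "i \<in> V0 \<Longrightarrow> j \<in> V0 \<Longrightarrow> i \<noteq> j \<Longrightarrow> hole j y \<Longrightarrow> hole i (slide i j y)"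
    and hole_slide_other: "i \<in> V0 \<Longrightarrow> j \<in> V0 \<Longrightarrow> h \<in> V0 \<Longrightarrow> distinct [i, j, h] \<Longrightarrow> hole h y
      \<Longrightarrow> hole h (slide i j y)"
    and slide_back: "i \<in> V0 \<Longrightarrow> j \<in> V0 \<Longrightarrow> i \<noteq> j \<Longrightarrow> hole j y \<Longrightarrow> slide j i (slide i j y) = y"
    and slide_slide: "i \<in> V0 \<Longrightarrow> j \<in> V0 \<Longrightarrow> k \<in> V0 \<Longrightarrow> distinct [i, j, k] \<Longrightarrow> hole j y \<Longrightarrow> hole k y
      \<Longrightarrow> slide j k (slide i j y) = slide i k y"
    and slide_commute: "i \<in> V0 \<Longrightarrow> j \<in> V0 \<Longrightarrow> k \<in> V0 \<Longrightarrow> l \<in> V0 \<Longrightarrow> distinct [i, j, k, l]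
      \<Longrightarrow> slide k l (slide i j y) = slide i j (slide k l y)"
begin

text \<open>Think of the states as lying over the graph of configurations: a section lifts the whole
  graph at once, so its existence says that closed walks lift to closed walks.\<close>

definition is_section :: "'v set \<Rightarrow> nat \<Rightarrow> ('v list \<Rightarrow> 'x) \<Rightarrow> bool" where
  "is_section V r s \<longleftrightarrow>
     (\<forall>c \<in> configs V r. \<forall>h \<in> V - set c. hole h (s c)) \<and>
     (\<forall>c \<in> configs V r. \<forall>k < r. \<forall>j \<in> V - set c. slide (c ! k) j (s c) = s (c[k := j]))"

lemma section_hole: "is_section V r s \<Longrightarrow> c \<in> configs V r \<Longrightarrow> h \<in> V \<Longrightarrow> h \<notin> set c \<Longrightarrow> hole h (s c)"
  by (auto simp: is_section_def)

lemma section_slide: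
  "is_section V r s \<Longrightarrow> c \<in> configs V r \<Longrightarrow> k < r \<Longrightarrow> j \<in> V \<Longrightarrow> j \<notin> set c
    \<Longrightarrow> slide (c ! k) j (s c) = s (c[k := j])"
  by (auto simp: is_section_def)

text \<open>Path independence of sliding. The section over \<open>a # d\<close> is built separately for each position
  \<open>a\<close> of the first token; two such sections are compared by moving the first token, and since that
  move commutes with the others, it is enough to compare them at one configuration of the remaining
  tokens.\<close>

lemma section_exists:
  assumes "finite V" "V \<subseteq> V0" "r + 2 \<le> card V" "c \<in> configs V r"
    and "\<And>h. h \<in> V - set c \<Longrightarrow> hole h y"
  shows "\<exists>s. is_section V r s \<and> s c = y"
  using assms
proof (induction r arbitrary: V c y)
  case 0
  then show ?case
    by (intro exI[of _ "\<lambda>_. y"]) (auto simp: is_section_def)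
next
  case (Suc r)
  note fin = Suc.prems(1) and sub = Suc.prems(2)
  obtain a0 d0 where c: "c = a0 # d0" "a0 \<in> V" "d0 \<in> configs (V - {a0}) r"
    using Suc.prems(4) by (rule configs_SucE)
  have IH: "\<exists>s. is_section (V - {a}) r s \<and> s d = z"
    if "a \<in> V" "d \<in> configs (V - {a}) r" "\<And>h. h \<in> V - {a} - set d \<Longrightarrow> hole h z" for a d z
  proof (rule Suc.IH)
    show "r + 2 \<le> card (V - {a})"
      using that(1) fin Suc.prems(3) by simp
  qed (use that fin sub in auto)
  obtain s0 where s0: "is_section (V - {a0}) r s0" "s0 d0 = y"
    using IH[of a0 d0 y] c Suc.prems(5) by auto
  have avoid2: "\<exists>d. d \<in> configs (V - {a, b}) r" for a b
  proof -
    have "card V \<le> card (V - {a, b}) + card {a, b}"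
      using fin by (metis add.commute card_Un_le card_mono finite.emptyI finite.insertI finite_Diff
          finite_UnI Un_Diff_cancel le_sup_iff order_refl order_trans sup_ge2 Un_commute)
    moreover have "card {a, b} \<le> 2"
      by (simp add: card_insert_if)
    ultimately have "r \<le> card (V - {a, b})"
      using Suc.prems(3) by linarith
    then show ?thesis
      using configs_nonempty fin by (metis finite_Diff)
  qed
  \<comment> \<open>With \<open>Suc r\<close> tokens the bound reads r + 3 \<le> card V, so the
    \<open>r\<close> remaining tokens fit off any three positions.\<close>
  have avoid3: "\<exists>d. d \<in> configs (V - {a, b, c}) r" for a b c
  proof -
    have "card (V - {a, b, c}) \<ge> card V - card {a, b, c}"
      by (rule diff_card_le_card_Diff) simp
    moreover have "card {a, b, c} \<le> 3"
      by (simp add: card_insert_if)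
    ultimately have "r \<le> card (V - {a, b, c})"
      using Suc.prems(3) by linarith
    then show ?thesis
      using configs_nonempty fin by (metis finite_Diff)
  qed
  have compare: "slide a b (s d) = t d"
    if "a \<in> V" "b \<in> V" "a \<noteq> b" "is_section (V - {a}) r s" "is_section (V - {b}) r t"
      "d \<in> configs (V - {a, b}) r" "d' \<in> configs (V - {a, b}) r" "slide a b (s d') = t d'"
    for a b s t d d'
  proof (rule configs_connected[of "V - {a, b}" r d' d "\<lambda>d. slide a b (s d) = t d"])
    show "r < card (V - {a, b})"
      using fin that(1-3) Suc.prems(3) by (simp add: card_Diff_subset)
    show "slide a b (s (e[k := j])) = t (e[k := j])"
      if e: "e \<in> configs (V - {a, b}) r" "k < r" "j \<in> V - {a, b} - set e"
        and eq: "slide a b (s e) = t e" for e k j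
    proof -
      have ek: "e ! k \<in> V - {a, b}" "e ! k \<noteq> j"
        using e by (auto simp: configs_def subset_iff dest: nth_mem)
      have e': "e \<in> configs (V - {a}) r" "e \<in> configs (V - {b}) r"
        using e(1) by (auto simp: configs_def)
      have "s (e[k := j]) = slide (e ! k) j (s e)"
        using section_slide[of "V - {a}" r s e k j] \<open>is_section (V - {a}) r s\<close> e e' by auto
      then have "slide a b (s (e[k := j])) = slide (e ! k) j (slide a b (s e))"
        using slide_commute[of "e ! k" j a b "s e"] ek e(3) \<open>a \<in> V\<close> \<open>b \<in> V\<close> \<open>a \<noteq> b\<close> sub by auto
      also have "\<dots> = t (e[k := j])"
        using section_slide[of "V - {b}" r t e k j] \<open>is_section (V - {b}) r t\<close> e e' eq by auto
      finally show ?thesis .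
    qed
  qed (use that fin in auto)
  have "\<exists>s. is_section (V - {a}) r s \<and>
      (\<forall>d \<in> configs (V - {a0, a}) r. slide a0 a (s0 d) = s d)"
    if "a \<in> V" "a \<noteq> a0" for a
  proof -
    obtain d where d: "d \<in> configs (V - {a0, a}) r"
      using avoid2 by blast
    then have d': "d \<in> configs (V - {a0}) r" "d \<in> configs (V - {a}) r" "a \<notin> set d" "a0 \<notin> set d"
      by (auto simp: configs_def)
    have "hole a (s0 d)"
      using section_hole[OF s0(1) d'(1)] d'(3) that by auto
    have "\<exists>s. is_section (V - {a}) r s \<and> s d = slide a0 a (s0 d)"
    proof (rule IH)
      fix h assume h: "h \<in> V - {a} - set d"
      show "hole h (slide a0 a (s0 d))"
      proof (cases "h = a0")
        case True
        then show ?thesis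
          using hole_slide_self[of a0 a "s0 d"] \<open>hole a (s0 d)\<close> that c(2) sub by auto
      next
        case False
        then have "hole h (s0 d)"
          using section_hole[OF s0(1) d'(1)] h by auto
        then show ?thesis
          using hole_slide_other[of a0 a h "s0 d"] that c(2) sub h False by auto
      qed
    qed (use that d' in auto)
    then obtain s where s: "is_section (V - {a}) r s" "s d = slide a0 a (s0 d)"
      by blast
    then show ?thesis
      using compare[of a0 a s0 s _ d] c(2) that s0(1) d by auto
  qed
  then obtain S where "\<forall>a. a \<in> V \<longrightarrow> a \<noteq> a0 \<longrightarrow> is_section (V - {a}) r (S a) \<and>
      (\<forall>d \<in> configs (V - {a0, a}) r. slide a0 a (s0 d) = S a d)"
    by metis
  then have S: "a \<in> V \<Longrightarrow> a \<noteq> a0 \<Longrightarrow> is_section (V - {a}) r (S a)"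
      "a \<in> V \<Longrightarrow> a \<noteq> a0 \<Longrightarrow> d \<in> configs (V - {a0, a}) r \<Longrightarrow> slide a0 a (s0 d) = S a d" for a d
    by auto
  define S' where "S' = S(a0 := s0)"
  have S'_section: "is_section (V - {a}) r (S' a)" if "a \<in> V" for a
    using S(1) s0(1) that by (auto simp: S'_def)
  have from_a0: "slide a0 a (S' a0 d) = S' a d"
    if "a \<in> V" "a \<noteq> a0" "d \<in> configs (V - {a0, a}) r" for a d
    using S(2) that by (auto simp: S'_def)
  \<comment> \<open>By \<open>compare\<close> a single \<open>d'\<close> is enough. It avoids
    \<open>a0\<close> as well, so that over \<open>d'\<close> the first token can go from
    \<open>a0\<close> to \<open>a\<close> and to \<open>b\<close>; then the triangle law replaces
    the walk a0, a, b by a0, b. The degenerate case b = a0 is \<open>slide_back\<close>.\<close>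
  have head: "slide a b (S' a d) = S' b d"
    if ab: "a \<in> V" "b \<in> V" "a \<noteq> b" and d: "d \<in> configs (V - {a, b}) r" for a b d
  proof -
    obtain d' where d': "d' \<in> configs (V - {a0, a, b}) r"
      using avoid3 by blast
    then have d'_ab: "d' \<in> configs (V - {a, b}) r" "d' \<in> configs (V - {a0, a}) r"
        "d' \<in> configs (V - {a0, b}) r" "d' \<in> configs (V - {a0}) r" "a \<notin> set d'" "b \<notin> set d'"
      by (auto simp: configs_def)
    have holes: "h \<noteq> a0 \<Longrightarrow> h \<in> {a, b} \<Longrightarrow> hole h (S' a0 d')" for h
      using section_hole[OF S'_section d'_ab(4)] c(2) d'_ab(5,6) ab by auto
    have "slide a b (S' a d') = S' b d'"
    proof (cases "a = a0 \<or> b = a0")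
      case True
      then show ?thesis
      proof
        assume "a = a0"
        then show ?thesis
          using from_a0[of b d'] d'_ab ab by simp
      next
        assume "b = a0"
        then show ?thesis
          using from_a0[of a d'] d'_ab ab slide_back[of a0 a "S' a0 d'"] holes[of a] sub by auto
      qed
    next
      case False
      then have "slide a b (slide a0 a (S' a0 d')) = slide a0 b (S' a0 d')"
        using slide_slide[of a0 a b "S' a0 d'"] holes ab c(2) sub by auto
      then show ?thesis
        using from_a0[of a d'] from_a0[of b d'] False ab d'_ab by simp
    qed
    then show ?thesis
      using compare[OF ab S'_section[OF ab(1)] S'_section[OF ab(2)] d d'_ab(1)] by simp
  qed
  define s where "s = (\<lambda>c. S' (hd c) (tl c))"
  have "is_section V (Suc r) s"
    unfolding is_section_def
  proof (intro conjI ballI allI impI)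
    fix c' h assume "c' \<in> configs V (Suc r)" "h \<in> V - set c'"
    then show "hole h (s c')"
      using section_hole[OF S'_section] by (elim configs_SucE) (auto simp: s_def)
  next
    fix c' k j assume "c' \<in> configs V (Suc r)" and k: "k < Suc r" and j: "j \<in> V - set c'"
    then obtain a d where d: "c' = a # d" "a \<in> V" "d \<in> configs (V - {a}) r"
      by (elim configs_SucE)
    show "slide (c' ! k) j (s c') = s (c'[k := j])"
    proof (cases k)
      case 0
      have "d \<in> configs (V - {a, j}) r"
        using d j by (auto simp: configs_def)
      then show ?thesis
        using head[of a j d] d j 0 by (auto simp: s_def)
    next
      case (Suc k')
      then show ?thesis
        using section_slide[OF S'_section[OF d(2)] d(3), of k' j] d j k by (auto simp: s_def)
    qed
  qed
  moreover have "s c = y"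
    using s0(2) by (simp add: s_def c(1) S'_def)
  ultimately show ?case
    by blast
qed

end

section \<open>The partition monoid through its equivalence relations\<close>

lemma block_edges_eq: "block_edges a = {(x, y). \<exists>p\<in>a. x \<in> p \<and> y \<in> p}"
  by (auto simp: block_edges_def)

lemma block_edges_quotient:
  assumes "equiv A E"
  shows "block_edges (A // E) = E"
proof -
  have "(x, y) \<in> block_edges (A // E)" if "(x, y) \<in> E" for x y
  proof -
    have "x \<in> A" "x \<in> E `` {x}"
      using assms that by (auto elim: equivE dest: refl_onD simp: equiv_def refl_on_def)
    then show ?thesis
      using that by (auto simp: block_edges_def quotient_def intro!: bexI[of _ x])
  qed
  moreover have "(x, y) \<in> E" if "(x, y) \<in> block_edges (A // E)" for x y
    using that assms by (auto simp: block_edges_def quotient_def equiv_def dest: symD transD)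
  ultimately show ?thesis
    by auto
qed

lemma swap_levels_swap_levels [simp]: "swap_levels (swap_levels v) = v"
  by (cases v) auto

lemma sym_block_edges: "sym (block_edges a)"
  by (auto simp: sym_def block_edges_def)

lemma sym_product_graph: "sym (product_graph a b)"
  using sym_block_edges[of a] sym_block_edges[of b]
  by (fastforce simp: sym_def product_graph_def)

lemma block_edges_star:
  "(x, y) \<in> block_edges (partition_star a) \<longleftrightarrow> (swap_levels x, swap_levels y) \<in> block_edges a"
proof -
  have "x \<in> swap_levels ` B \<longleftrightarrow> swap_levels x \<in> B" for x B
    by (metis image_iff swap_levels_swap_levels)
  then show ?thesis
    by (auto simp: block_edges_def partition_star_def)
qed

lemma partition_star_star [simp]: "partition_star (partition_star a) = a"
  by (simp add: partition_star_def image_image)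

lemma rtrancl_map_prod_inj:
  assumes "inj f"
  shows "(f x, f y) \<in> (map_prod f f ` R)\<^sup>* \<longleftrightarrow> (x, y) \<in> R\<^sup>*"
proof
  assume "(x, y) \<in> R\<^sup>*"
  then show "(f x, f y) \<in> (map_prod f f ` R)\<^sup>*"
    by (induction rule: rtrancl_induct) (auto intro: rtrancl_into_rtrancl)
next
  have "\<exists>y. z = f y \<and> (x, y) \<in> R\<^sup>*" if "(f x, z) \<in> (map_prod f f ` R)\<^sup>*" for z
    using that
  proof (induction rule: rtrancl_induct)
    case (step y z)
    then show ?case
      using assms by (auto dest!: injD intro: rtrancl_into_rtrancl)
  qed auto
  then show "(f x, f y) \<in> (map_prod f f ` R)\<^sup>* \<Longrightarrow> (x, y) \<in> R\<^sup>*"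
    using assms by (metis injD)
qed

text \<open>The edges of \<open>S\<close> touch only \<open>W\<close>. On a path between vertices of
  \<open>W\<close>, each maximal stretch of \<open>R\<close>-edges therefore starts and ends in
  \<open>W\<close> and can be replaced by \<open>T\<close>-edges.\<close>

lemma rtrancl_contract:
  assumes "S \<subseteq> W \<times> W" "T \<subseteq> R\<^sup>*" "R\<^sup>* \<inter> W \<times> W \<subseteq> T\<^sup>*" "x \<in> W" "y \<in> W"
  shows "(x, y) \<in> (T \<union> S)\<^sup>* \<longleftrightarrow> (x, y) \<in> (R \<union> S)\<^sup>*"
proof
  have "T \<union> S \<subseteq> (R \<union> S)\<^sup>*"
    using assms(2) by (meson Un_least Un_upper1 Un_upper2 order_trans r_into_rtrancl rtrancl_mono subrelI)
  then show "(x, y) \<in> (T \<union> S)\<^sup>* \<Longrightarrow> (x, y) \<in> (R \<union> S)\<^sup>*"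
    using rtrancl_subset_rtrancl by blast
next
  have TS: "R\<^sup>* \<inter> W \<times> W \<subseteq> (T \<union> S)\<^sup>*"
    using assms(3) by (meson Un_upper1 order_trans rtrancl_mono)
  \<comment> \<open>Invariant along the path: \<open>w\<close> is the last vertex of
    \<open>W\<close> already reached by contracted edges, and the stretch of \<open>R\<close>-edges
    from \<open>w\<close> to \<open>z\<close> is still pending.\<close>
  have "\<exists>w \<in> W. (x, w) \<in> (T \<union> S)\<^sup>* \<and> (w, z) \<in> R\<^sup>*" if "(x, z) \<in> (R \<union> S)\<^sup>*" for z
    using that
  proof (induction rule: rtrancl_induct)
    case base
    then show ?case
      using assms(4) by blast
  next
    case (step z z')
    then obtain w where w: "w \<in> W" "(x, w) \<in> (T \<union> S)\<^sup>*" "(w, z) \<in> R\<^sup>*"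
      by blast
    show ?case
    proof (cases "(z, z') \<in> R")
      case True
      then show ?thesis
        using w by (meson rtrancl_into_rtrancl)
    next
      case False
      then have "(z, z') \<in> S" "z \<in> W" "z' \<in> W"
        using step.hyps(2) assms(1) by auto
      then have "(x, z) \<in> (T \<union> S)\<^sup>*"
        using w TS by (meson IntI SigmaI rtrancl_trans subsetD)
      then have "(x, z') \<in> (T \<union> S)\<^sup>*"
        using \<open>(z, z') \<in> S\<close> by (meson UnI2 rtrancl_into_rtrancl)
      then show ?thesis
        using \<open>z' \<in> W\<close> by blast
    qed
  qed
  then show "(x, y) \<in> (R \<union> S)\<^sup>* \<Longrightarrow> (x, y) \<in> (T \<union> S)\<^sup>*"
    using assms(5) TS by (meson IntI SigmaI rtrancl_trans subsetD)
qed

locale partition_degree =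
  fixes n :: nat
begin

definition points :: "nat set" where
  "points = {1..n}"

lemma finite_points [simp]: "finite points"
  and card_points [simp]: "card points = n"
  by (simp_all add: points_def)

definition vertices :: "vertex set" where
  "vertices = upper n \<union> lower n"

abbreviation times_partition :: "set_partition \<Rightarrow> set_partition \<Rightarrow> set_partition" (infixl "\<odot>" 70)
  where "a \<odot> b \<equiv> partition_mult n a b"

lemma vertices_simps [simp]:
  "Up i \<in> vertices \<longleftrightarrow> i \<in> points" "Lo i \<in> vertices \<longleftrightarrow> i \<in> points" "Mid i \<notin> vertices"
  by (auto simp: points_def vertices_def upper_def lower_def)

lemma swap_levels_in_vertices [simp]: "swap_levels v \<in> vertices \<longleftrightarrow> v \<in> vertices"
  by (cases v) simp_all

lemma equiv_block_edges: "a \<in> partitions n \<Longrightarrow> equiv vertices (block_edges a)"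
  by (simp add: vertices_def[symmetric] partitions_def block_edges_eq equiv_partition_on)

lemma quotient_block_edges: "a \<in> partitions n \<Longrightarrow> vertices // block_edges a = a"
  by (simp add: vertices_def[symmetric] partitions_def block_edges_eq partition_on_eq_quotient)

lemma partition_eqI:
  "a \<in> partitions n \<Longrightarrow> b \<in> partitions n \<Longrightarrow> block_edges a = block_edges b \<Longrightarrow> a = b"
  by (metis quotient_block_edges)

lemma quotient_in_partitions: "equiv vertices E \<Longrightarrow> vertices // E \<in> partitions n"
  by (simp add: vertices_def[symmetric] partitions_def partition_on_quotient)

lemma block_edges_in_vertices:
  assumes "a \<in> partitions n" "(x, y) \<in> block_edges a"
  shows "x \<in> vertices" "y \<in> vertices"
  using equiv_block_edges[OF assms(1)] assms(2) by (auto simp: equiv_def)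

lemma block_edges_refl: "a \<in> partitions n \<Longrightarrow> x \<in> vertices \<Longrightarrow> (x, x) \<in> block_edges a"
  by (meson equiv_block_edges equiv_def refl_onD)

lemma block_edges_sym: "(x, y) \<in> block_edges a \<Longrightarrow> (y, x) \<in> block_edges a"
  by (meson sym_block_edges symD)

lemma block_edges_trans:
  "a \<in> partitions n \<Longrightarrow> (x, y) \<in> block_edges a \<Longrightarrow> (y, z) \<in> block_edges a \<Longrightarrow> (x, z) \<in> block_edges a"
  by (meson equiv_block_edges equiv_def transD)

lemma equiv_connected:
  "equiv vertices {(x, y). x \<in> vertices \<and> y \<in> vertices \<and> (x, y) \<in> (product_graph a b)\<^sup>*}"
proof (rule equivI)
  show "sym {(x, y). x \<in> vertices \<and> y \<in> vertices \<and> (x, y) \<in> (product_graph a b)\<^sup>*}"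
    using sym_rtrancl[OF sym_product_graph[of a b]] by (auto simp: sym_def)
qed (auto simp: refl_on_def trans_def)

lemma mult_in_partitions [simp]: "a \<odot> b \<in> partitions n"
  using quotient_in_partitions[OF equiv_connected] by (simp add: partition_mult_def vertices_def)

lemma block_edges_mult:
  "(x, y) \<in> block_edges (a \<odot> b) \<longleftrightarrow>
     x \<in> vertices \<and> y \<in> vertices \<and> (x, y) \<in> (product_graph a b)\<^sup>*"
  using block_edges_quotient[OF equiv_connected] by (auto simp: partition_mult_def vertices_def)

lemma product_graph_left:
  "(x, y) \<in> block_edges a \<Longrightarrow> (lo_to_mid x, lo_to_mid y) \<in> (product_graph a b)\<^sup>*"
  by (force simp: product_graph_def)

lemma product_graph_right:
  "(x, y) \<in> block_edges b \<Longrightarrow> (up_to_mid x, up_to_mid y) \<in> (product_graph a b)\<^sup>*"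
  by (force simp: product_graph_def)

text \<open>Bounds the blocks of a product from above.\<close>

lemma mult_fold:
  assumes "(x, y) \<in> block_edges (a \<odot> b)"
    and "\<And>u v. (u, v) \<in> block_edges a \<Longrightarrow> R (g (lo_to_mid u)) (g (lo_to_mid v))"
    and "\<And>u v. (u, v) \<in> block_edges b \<Longrightarrow> R (g (up_to_mid u)) (g (up_to_mid v))"
    and "reflp R" "transp R"
  shows "R (g x) (g y)"
proof -
  have "(x, y) \<in> (product_graph a b)\<^sup>*"
    using assms(1) by (simp add: block_edges_mult)
  then show ?thesis
  proof (induction rule: rtrancl_induct)
    case base
    then show ?case
      using assms(4) by (simp add: reflpD)
  next
    case (step y z)
    from step.hyps(2) have "R (g y) (g z)"
      using assms(2,3) by (auto simp: product_graph_def)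
    then show ?case
      using step.IH assms(5) by (meson transpD)
  qed
qed

lemma mult_fold_equiv:
  assumes "(x, y) \<in> block_edges (a \<odot> b)" "equiv A E" "g x \<in> A"
    and "\<And>u v. (u, v) \<in> block_edges a \<Longrightarrow> (g (lo_to_mid u), g (lo_to_mid v)) \<in> E"
    and "\<And>u v. (u, v) \<in> block_edges b \<Longrightarrow> (g (up_to_mid u), g (up_to_mid v)) \<in> E"
  shows "(g x, g y) \<in> E"
proof -
  \<comment> \<open>\<open>E\<close> is reflexive on \<open>A\<close> only, whereas
    \<open>mult_fold\<close> asks for reflexivity everywhere. Equality is added for the fold and
    removed again by means of \<open>g x \<in> A\<close>.\<close>
  have "g x = g y \<or> (g x, g y) \<in> E"
  proof (rule mult_fold[OF assms(1), where R = "\<lambda>u v. u = v \<or> (u, v) \<in> E"])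
    show "transp (\<lambda>u v. u = v \<or> (u, v) \<in> E)"
      using assms(2) unfolding equiv_def transp_def trans_def by blast
  qed (auto simp: reflp_def assms(4,5))
  then show ?thesis
    using assms(2,3) by (metis equiv_def refl_onD)
qed

lemma block_edges_induct:
  assumes "(x, y) \<in> block_edges a" "a \<in> partitions n" "sym E"
    and "\<And>x y. (Up x, Up y) \<in> block_edges a \<Longrightarrow> (Up x, Up y) \<in> E"
    and "\<And>x y. (Up x, Lo y) \<in> block_edges a \<Longrightarrow> (Up x, Lo y) \<in> E"
    and "\<And>x y. (Lo x, Lo y) \<in> block_edges a \<Longrightarrow> (Lo x, Lo y) \<in> E"
  shows "(x, y) \<in> E"
proof -
  have "(Lo v, Up w) \<in> E" if "(Lo v, Up w) \<in> block_edges a" for v w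
    using assms(5)[OF block_edges_sym[OF that]] assms(3) by (rule symD[rotated])
  then show ?thesis
    using assms(1,4,5,6) block_edges_in_vertices[OF assms(2,1)] by (cases x; cases y) auto
qed

lemma mult_UpUp:
  assumes "a \<in> partitions n" "(Up x, Up y) \<in> block_edges a"
  shows "(Up x, Up y) \<in> block_edges (a \<odot> b)"
  using assms product_graph_left[OF assms(2), of b] block_edges_in_vertices[OF assms]
  by (simp add: block_edges_mult)

lemma mult_LoLo:
  assumes "b \<in> partitions n" "(Lo x, Lo y) \<in> block_edges b"
  shows "(Lo x, Lo y) \<in> block_edges (a \<odot> b)"
  using assms product_graph_right[OF assms(2), of a] block_edges_in_vertices[OF assms]
  by (simp add: block_edges_mult)

lemma mult_UpLo:
  assumes "a \<in> partitions n" "b \<in> partitions n"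
    and "(Up x, Lo z) \<in> block_edges a" "(Up z, Lo y) \<in> block_edges b"
  shows "(Up x, Lo y) \<in> block_edges (a \<odot> b)"
proof -
  have "(Up x, Lo y) \<in> (product_graph a b)\<^sup>*"
    using product_graph_left[OF assms(3), of b] product_graph_right[OF assms(4), of a]
    by (simp add: rtrancl_trans)
  then show ?thesis
    using block_edges_in_vertices[OF assms(1,3)] block_edges_in_vertices[OF assms(2,4)]
    by (simp add: block_edges_mult)
qed

text \<open>If the block of \<open>Up x\<close> in \<open>a\<close> misses the lower level, no edge
  of \<open>b\<close> touches it, and it is already a component of the product graph. The predicate
  \<open>g\<close> is membership in that block.\<close>

lemma mult_UpLo_left:
  assumes "a \<in> partitions n" "(Up x, Lo y) \<in> block_edges (a \<odot> b)"
  obtains z where "(Up x, Lo z) \<in> block_edges a"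
proof -
  have "\<exists>z. (Up x, Lo z) \<in> block_edges a"
  proof (rule ccontr)
    assume no: "\<nexists>z. (Up x, Lo z) \<in> block_edges a"
    define g where "g v \<longleftrightarrow> (Up x, v) \<in> block_edges a" for v
    have Mid: "\<not> g (Mid i)" for i
      using assms(1) block_edges_in_vertices(2) vertices_simps(3) unfolding g_def by blast
    have "g (Up x) \<longrightarrow> g (Lo y)"
    proof (rule mult_fold[OF assms(2), where R = "\<lambda>s t. s \<longrightarrow> t"])
      fix u v assume uv: "(u, v) \<in> block_edges a"
      have "g v" if "g u"
        using block_edges_trans[OF assms(1) _ uv] that by (simp add: g_def)
      then show "g (lo_to_mid u) \<longrightarrow> g (lo_to_mid v)"
        using Mid no by (cases u; cases v) (auto simp: g_def)
    next
      fix u v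
      show "g (up_to_mid u) \<longrightarrow> g (up_to_mid v)"
        using Mid no by (cases u) (simp_all add: g_def)
    qed (auto simp: reflp_def transp_def)
    moreover have "g (Up x)"
      using assms block_edges_in_vertices(1) block_edges_refl[OF assms(1)] unfolding g_def by (metis mult_in_partitions)
    ultimately show False
      using no by (auto simp: g_def)
  qed
  then show thesis
    using that by blast
qed

section \<open>The involution and regularity\<close>

lemma star_in_partitions [simp]:
  assumes "a \<in> partitions n"
  shows "partition_star a \<in> partitions n"
proof -
  have "v \<in> swap_levels ` vertices \<longleftrightarrow> v \<in> vertices" for v
    by (metis image_iff swap_levels_in_vertices swap_levels_swap_levels)
  then have image: "swap_levels ` vertices = vertices"
    by blast
  have "partition_on vertices a"
    using assms by (simp add: partitions_def vertices_def)
  moreover have "inj_on swap_levels vertices"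
    by (rule inj_on_inverseI[of _ swap_levels]) simp
  ultimately have "partition_on vertices (partition_star a - {{}})"
    using partition_on_inj_image[of vertices a swap_levels] unfolding image partition_star_def by blast
  moreover have "{} \<notin> partition_star a"
    using assms by (auto simp: partition_star_def partitions_def partition_on_def)
  ultimately show ?thesis
    by (simp add: partitions_def vertices_def)
qed

text \<open>Swapping levels reflects the product graph in its middle level and exchanges
  \<open>lo_to_mid\<close> with \<open>up_to_mid\<close>. One inclusion for all \<open>a\<close>,
  \<open>b\<close> suffices, since applied to the stars it gives the other.\<close>

lemma star_mult:
  assumes "a \<in> partitions n" "b \<in> partitions n"
  shows "partition_star (a \<odot> b) = partition_star b \<odot> partition_star a"
proof -
  have sub: "(swap_levels x, swap_levels y) \<in> block_edges (partition_star b \<odot> partition_star a)"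
    if "(x, y) \<in> block_edges (a \<odot> b)" for a b x y
  proof -
    have swap: "swap_levels (lo_to_mid v) = up_to_mid (swap_levels v)"
      "swap_levels (up_to_mid v) = lo_to_mid (swap_levels v)" for v
      by (cases v; simp)+
    have "(swap_levels x, swap_levels y) \<in> (product_graph (partition_star b) (partition_star a))\<^sup>*"
    proof (rule mult_fold[OF that, where g = swap_levels
          and R = "\<lambda>u v. (u, v) \<in> (product_graph (partition_star b) (partition_star a))\<^sup>*"])
      fix u v assume "(u, v) \<in> block_edges a"
      then show "(swap_levels (lo_to_mid u), swap_levels (lo_to_mid v))
          \<in> (product_graph (partition_star b) (partition_star a))\<^sup>*"
        by (auto simp: swap block_edges_star intro: product_graph_right)
    next
      fix u v assume "(u, v) \<in> block_edges b"
      then show "(swap_levels (up_to_mid u), swap_levels (up_to_mid v))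
          \<in> (product_graph (partition_star b) (partition_star a))\<^sup>*"
        by (auto simp: swap block_edges_star intro: product_graph_left)
    qed (auto simp: reflp_def transp_def intro: rtrancl_trans)
    then show ?thesis
      using that by (simp add: block_edges_mult)
  qed
  show ?thesis
  proof (rule partition_eqI)
    have "(swap_levels x, swap_levels y) \<in> block_edges (a \<odot> b)
        \<longleftrightarrow> (x, y) \<in> block_edges (partition_star b \<odot> partition_star a)" for x y
      using sub[of "swap_levels x" "swap_levels y" a b]
        sub[of x y "partition_star b" "partition_star a"] by auto
    then show "block_edges (partition_star (a \<odot> b)) = block_edges (partition_star b \<odot> partition_star a)"
      by (auto simp: block_edges_star)
  qed simp_all
qed

text \<open>The product graph of \<open>a\<close> and its star is symmetric about the middle level;
  folding it there gives back \<open>a\<close>, with both outer levels on top and the middle level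
  below. The arguments of \<open>case_vertex\<close> are the images of \<open>Up\<close>,
  \<open>Lo\<close>, \<open>Mid\<close> in this order, here and in the later folds.\<close>

lemma mult_star_fold:
  assumes "a \<in> partitions n" "(x, y) \<in> block_edges (a \<odot> partition_star a)"
  shows "(case_vertex Up Up Lo x, case_vertex Up Up Lo y) \<in> block_edges a"
  using assms(2) equiv_block_edges[OF assms(1)]
proof (rule mult_fold_equiv)
  show "case_vertex Up Up Lo x \<in> vertices"
    using assms(2) by (cases x) (auto simp: block_edges_mult)
next
  fix u v assume uv: "(u, v) \<in> block_edges a"
  then show "(case_vertex Up Up Lo (lo_to_mid u), case_vertex Up Up Lo (lo_to_mid v)) \<in> block_edges a"
    using block_edges_in_vertices[OF assms(1) uv] by (cases u; cases v) auto
next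
  fix u v assume uv: "(u, v) \<in> block_edges (partition_star a)"
  then show "(case_vertex Up Up Lo (up_to_mid u), case_vertex Up Up Lo (up_to_mid v)) \<in> block_edges a"
    using block_edges_in_vertices[OF star_in_partitions[OF assms(1)] uv] by (cases u; cases v) (auto simp: block_edges_star)
qed

lemma mult_star_mult:
  assumes a: "a \<in> partitions n"
  shows "a \<odot> partition_star a \<odot> a = a"
proof -
  note star = star_in_partitions[OF a]
  have "(x, y) \<in> block_edges a" if xy: "(x, y) \<in> block_edges (a \<odot> partition_star a \<odot> a)" for x y
  proof -
    \<comment> \<open>The left factor, folded as before, lives entirely on the upper level of
      \<open>a\<close>; hence the middle level, where the right factor \<open>a\<close> starts, also
      goes to the upper level.\<close>
    have "(case_vertex Up Lo Up x, case_vertex Up Lo Up y) \<in> block_edges a"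
      using xy equiv_block_edges[OF a]
    proof (rule mult_fold_equiv)
      show "case_vertex Up Lo Up x \<in> vertices"
        using xy by (cases x) (auto simp: block_edges_mult)
    next
      fix u v assume uv: "(u, v) \<in> block_edges (a \<odot> partition_star a)"
      then show "(case_vertex Up Lo Up (lo_to_mid u), case_vertex Up Lo Up (lo_to_mid v)) \<in> block_edges a"
        using mult_star_fold[OF a uv] block_edges_in_vertices[OF mult_in_partitions uv] by (cases u; cases v) auto
    next
      fix u v assume uv: "(u, v) \<in> block_edges a"
      then show "(case_vertex Up Lo Up (up_to_mid u), case_vertex Up Lo Up (up_to_mid v)) \<in> block_edges a"
        using block_edges_in_vertices[OF a uv] by (cases u; cases v) auto
    qed
    then show ?thesis
      using xy by (cases x; cases y) (auto simp: block_edges_mult)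
  qed
  moreover have "(x, y) \<in> block_edges (a \<odot> partition_star a \<odot> a)" if "(x, y) \<in> block_edges a" for x y
    using that a sym_block_edges
  proof (rule block_edges_induct)
    fix x y assume *: "(Up x, Lo y) \<in> block_edges a"
    then have "(Up x, Lo x) \<in> block_edges (a \<odot> partition_star a)"
      using mult_UpLo[OF a star *, of x] by (simp add: block_edges_star block_edges_sym)
    then show "(Up x, Lo y) \<in> block_edges (a \<odot> partition_star a \<odot> a)"
      using mult_UpLo[OF _ a _ *] by simp
  qed (simp_all add: a star mult_UpUp mult_LoLo)
  ultimately show ?thesis
    by (intro partition_eqI) (auto simp: a)
qed

section \<open>Associativity by stacking partitions at numbered heights\<close>

fun level :: "nat \<Rightarrow> nat \<Rightarrow> nat \<Rightarrow> vertex \<Rightarrow> nat \<times> nat" where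
  "level i j k (Up x) = (i, x)"
| "level i j k (Mid x) = (j, x)"
| "level i j k (Lo x) = (k, x)"

lemma inj_level: "distinct [i, j, k] \<Longrightarrow> inj (level i j k)"
proof (rule injI)
  fix x y assume "distinct [i, j, k]" "level i j k x = level i j k y"
  then show "x = y"
    by (cases x; cases y) auto
qed

text \<open>The edges of \<open>a\<close> drawn between heights \<open>i\<close> and
  \<open>k\<close>, so that several partitions share one graph. Blocks contain no \<open>Mid\<close>
  vertex, so the middle height is a dummy; \<open>Suc (i + k)\<close> differs from \<open>i\<close>
  and \<open>k\<close>, which keeps \<open>level\<close> injective when these two differ.\<close>

definition place :: "nat \<Rightarrow> nat \<Rightarrow> set_partition \<Rightarrow> ((nat \<times> nat) \<times> nat \<times> nat) set" where
  "place i k a = map_prod (level i (Suc (i + k)) k) (level i (Suc (i + k)) k) ` block_edges a"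

lemma level_cong: "v \<in> vertices \<Longrightarrow> level i j k v = level i j' k v"
  by (cases v) simp_all

lemma place_eq:
  assumes "a \<in> partitions n"
  shows "place i k a = map_prod (level i j k) (level i j k) ` block_edges a"
  unfolding place_def
proof (rule image_cong)
  fix p assume "p \<in> block_edges a"
  then show "map_prod (level i (Suc (i + k)) k) (level i (Suc (i + k)) k) p
      = map_prod (level i j k) (level i j k) p"
    using block_edges_in_vertices[OF assms] by (cases p) (metis level_cong map_prod_simp)
qed simp

lemma level_vertices: "level i j k ` vertices = {i, k} \<times> points"
  by (auto simp: points_def vertices_def upper_def lower_def image_Un image_image)

lemma level_lo_to_mid: "v \<in> vertices \<Longrightarrow> level i j k (lo_to_mid v) = level i m j v"
  by (cases v) simp_all

lemma level_up_to_mid: "v \<in> vertices \<Longrightarrow> level i j k (up_to_mid v) = level j m k v"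
  by (cases v) simp_all

lemma place_mult:
  assumes "a \<in> partitions n" "b \<in> partitions n" "distinct [i, j, k]"
  shows "place i k (a \<odot> b) = (place i j a \<union> place j k b)\<^sup>* \<inter> ({i, k} \<times> points) \<times> ({i, k} \<times> points)"
proof -
  let ?L = "level i j k"
  have a: "map_prod ?L ?L ` map_prod lo_to_mid lo_to_mid ` block_edges a = place i j a"
    unfolding place_def image_image
  proof (rule image_cong)
    fix p assume "p \<in> block_edges a"
    then show "map_prod ?L ?L (map_prod lo_to_mid lo_to_mid p)
        = map_prod (level i (Suc (i + j)) j) (level i (Suc (i + j)) j) p"
      using block_edges_in_vertices[OF assms(1)] by (cases p) (metis level_lo_to_mid map_prod_simp)
  qed simp
  have b: "map_prod ?L ?L ` map_prod up_to_mid up_to_mid ` block_edges b = place j k b"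
    unfolding place_def image_image
  proof (rule image_cong)
    fix p assume "p \<in> block_edges b"
    then show "map_prod ?L ?L (map_prod up_to_mid up_to_mid p)
        = map_prod (level j (Suc (j + k)) k) (level j (Suc (j + k)) k) p"
      using block_edges_in_vertices[OF assms(2)] by (cases p) (metis level_up_to_mid map_prod_simp)
  qed simp
  have "map_prod ?L ?L ` product_graph a b = place i j a \<union> place j k b"
    unfolding product_graph_def image_Un a b ..
  then have "(?L x, ?L y) \<in> (place i j a \<union> place j k b)\<^sup>* \<longleftrightarrow> (x, y) \<in> (product_graph a b)\<^sup>*" for x y
    using rtrancl_map_prod_inj[OF inj_level[OF assms(3)], of x y "product_graph a b"] by simp
  then show ?thesis
    unfolding place_eq[OF mult_in_partitions, of i k _ _ j] level_vertices[of i j k, symmetric]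
    by (auto simp: block_edges_mult simp flip: map_prod_simp intro!: imageI)
qed

lemma place_subset:
  assumes "a \<in> partitions n"
  shows "place i k a \<subseteq> ({i, k} \<times> points) \<times> ({i, k} \<times> points)"
  using block_edges_in_vertices[OF assms]
  unfolding place_def level_vertices[of i "Suc (i + k)" k, symmetric] by auto

lemma place_inject:
  assumes "place i k a = place i k b" "i \<noteq> k" "a \<in> partitions n" "b \<in> partitions n"
  shows "a = b"
proof -
  have "inj (level i (Suc (i + k)) k)"
    using assms(2) by (intro inj_level) auto
  then have "inj (map_prod (level i (Suc (i + k)) k) (level i (Suc (i + k)) k))"
    by (simp add: prod.inj_map)
  then show ?thesis
    using assms unfolding place_def by (simp add: inj_image_eq_iff partition_eqI)
qed

text \<open>A path that uses an edge has both ends in \<open>A\<close>. The outer closure on the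
  right supplies the trivial paths at points of \<open>W\<close> outside \<open>A\<close>.\<close>

lemma rtrancl_restrict:
  assumes "R \<subseteq> A \<times> A" "B \<subseteq> A" "W \<inter> A \<subseteq> B"
  shows "R\<^sup>* \<inter> W \<times> W \<subseteq> (R\<^sup>* \<inter> B \<times> B)\<^sup>*"
proof
  fix p assume "p \<in> R\<^sup>* \<inter> W \<times> W"
  then obtain x y where xy: "p = (x, y)" "(x, y) \<in> R\<^sup>*" "x \<in> W" "y \<in> W"
    by auto
  show "p \<in> (R\<^sup>* \<inter> B \<times> B)\<^sup>*"
  proof (cases "x = y")
    case False
    then have "x \<in> A" "y \<in> A"
      using xy(2) assms(1) by (auto elim: converse_rtranclE, auto elim: rtranclE)
    then show ?thesis
      using xy assms(3) by auto
  qed (use xy in simp)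
qed

text \<open>Both sides are connectedness, restricted to the levels 0 and 3, in the graph with a copy of
  \<open>a\<close>, \<open>b\<close>, \<open>c\<close> between the levels 0 and 1, 1 and 2, 2 and 3: forming one product first only contracts
  the paths through one middle level.\<close>

lemma mult_assoc:
  assumes "a \<in> partitions n" "b \<in> partitions n" "c \<in> partitions n"
  shows "a \<odot> b \<odot> c = a \<odot> (b \<odot> c)"
proof (rule place_inject)
  define L where "L I = I \<times> points" for I :: "nat set"
  let ?G = "(place 0 1 a \<union> place 1 2 b \<union> place 2 3 c)\<^sup>* \<inter> L {0, 3} \<times> L {0, 3}"
  have sub: "place 0 1 a \<subseteq> L {0, 1} \<times> L {0, 1}" "place 1 2 b \<subseteq> L {1, 2} \<times> L {1, 2}"
      "place 2 3 c \<subseteq> L {2, 3} \<times> L {2, 3}"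
    using assms place_subset unfolding L_def by metis+
  have mono: "I \<subseteq> J \<Longrightarrow> L I \<times> L I \<subseteq> L J \<times> L J" for I J
    by (auto simp: L_def)
  have "place 0 3 (a \<odot> b \<odot> c) = (place 0 2 (a \<odot> b) \<union> place 2 3 c)\<^sup>* \<inter> L {0, 3} \<times> L {0, 3}"
    using assms by (subst place_mult[of _ _ _ 2]) (simp_all add: L_def)
  also have "\<dots> = ?G"
  proof -
    have ab: "place 0 2 (a \<odot> b) = (place 0 1 a \<union> place 1 2 b)\<^sup>* \<inter> L {0, 2} \<times> L {0, 2}"
      using assms by (subst place_mult[of _ _ _ 1]) (simp_all add: L_def)
    have "(x, y) \<in> (place 0 2 (a \<odot> b) \<union> place 2 3 c)\<^sup>* \<longleftrightarrow>
        (x, y) \<in> (place 0 1 a \<union> place 1 2 b \<union> place 2 3 c)\<^sup>*"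
      if "x \<in> L {0, 3}" "y \<in> L {0, 3}" for x y
    proof (rule rtrancl_contract)
      show "(place 0 1 a \<union> place 1 2 b)\<^sup>* \<inter> L {0, 2, 3} \<times> L {0, 2, 3} \<subseteq> (place 0 2 (a \<odot> b))\<^sup>*"
        unfolding ab
        by (rule rtrancl_restrict[of _ "L {0, 1, 2}"])
          (use sub mono[of "{0, 1}" "{0, 1, 2}"] mono[of "{1, 2}" "{0, 1, 2}"] in \<open>auto simp: L_def\<close>)
      show "place 2 3 c \<subseteq> L {0, 2, 3} \<times> L {0, 2, 3}"
        using sub(3) mono[of "{2, 3}" "{0, 2, 3}"] by auto
    qed (use that in \<open>auto simp: ab[unfolded One_nat_def] L_def\<close>)
    then show ?thesis
      by auto
  qed
  also have "\<dots> = (place 0 1 a \<union> place 1 3 (b \<odot> c))\<^sup>* \<inter> L {0, 3} \<times> L {0, 3}"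
  proof -
    have bc: "place 1 3 (b \<odot> c) = (place 1 2 b \<union> place 2 3 c)\<^sup>* \<inter> L {1, 3} \<times> L {1, 3}"
      using assms by (subst place_mult[of _ _ _ 2]) (simp_all add: L_def)
    have "(x, y) \<in> (place 1 3 (b \<odot> c) \<union> place 0 1 a)\<^sup>* \<longleftrightarrow>
        (x, y) \<in> (place 1 2 b \<union> place 2 3 c \<union> place 0 1 a)\<^sup>*"
      if "x \<in> L {0, 3}" "y \<in> L {0, 3}" for x y
    proof (rule rtrancl_contract)
      show "(place 1 2 b \<union> place 2 3 c)\<^sup>* \<inter> L {0, 1, 3} \<times> L {0, 1, 3} \<subseteq> (place 1 3 (b \<odot> c))\<^sup>*"
        unfolding bc
        by (rule rtrancl_restrict[of _ "L {1, 2, 3}"])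
          (use sub mono[of "{1, 2}" "{1, 2, 3}"] mono[of "{2, 3}" "{1, 2, 3}"] in \<open>auto simp: L_def\<close>)
      show "place 0 1 a \<subseteq> L {0, 1, 3} \<times> L {0, 1, 3}"
        using sub(1) mono[of "{0, 1}" "{0, 1, 3}"] by auto
    qed (use that in \<open>auto simp: bc[unfolded One_nat_def] L_def\<close>)
    then show ?thesis
      by (auto simp: Un_commute Un_left_commute)
  qed
  also have "\<dots> = place 0 3 (a \<odot> (b \<odot> c))"
    using assms by (subst place_mult[of _ _ _ 1]) (simp_all add: L_def)
  finally show "place 0 3 (a \<odot> b \<odot> c) = place 0 3 (a \<odot> (b \<odot> c))" .
qed simp_all

end

section \<open>The generating projections of the partition monoid\<close>

lemma equiv_symD: "equiv A E \<Longrightarrow> (x, y) \<in> E \<Longrightarrow> (y, x) \<in> E"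
  by (meson equiv_def symD)

lemma equiv_transD: "equiv A E \<Longrightarrow> (x, y) \<in> E \<Longrightarrow> (y, z) \<in> E \<Longrightarrow> (x, z) \<in> E"
  by (meson equiv_def transD)

lemma equiv_reflD: "equiv A E \<Longrightarrow> x \<in> A \<Longrightarrow> (x, x) \<in> E"
  by (meson equiv_def refl_onD)

lemma equiv_inD: "equiv A E \<Longrightarrow> (x, y) \<in> E \<Longrightarrow> x \<in> A \<and> y \<in> A"
  by (auto simp: equiv_def)

lemma equiv_pullback: "equiv A E \<Longrightarrow> equiv {x. f x \<in> A} {(x, y). (f x, f y) \<in> E}"
  unfolding equiv_def refl_on_def sym_def trans_def by blast

fun index :: "vertex \<Rightarrow> nat" where
  "index (Up i) = i"
| "index (Lo i) = i"
| "index (Mid i) = i"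

lemma index_swap_levels [simp]: "index (swap_levels v) = index v"
  by (cases v) simp_all

text \<open>The effect of right multiplication by \<open>isolate B\<close> on a lower kernel, see
  \<open>coker_mult_isolate\<close>. The clause \<open>x = y\<close> keeps the points of
  \<open>B\<close> as singleton classes.\<close>

definition restrict_off :: "nat set \<Rightarrow> (nat \<times> nat) set \<Rightarrow> (nat \<times> nat) set" where
  "restrict_off B l = {(x, y) \<in> l. x = y \<or> x \<notin> B \<and> y \<notin> B}"

lemma restrict_off_iff: "(x, y) \<in> restrict_off B l \<longleftrightarrow> (x, y) \<in> l \<and> (x = y \<or> x \<notin> B \<and> y \<notin> B)"
  by (simp add: restrict_off_def)

lemma equiv_restrict_off: "equiv A l \<Longrightarrow> equiv A (restrict_off B l)"
  unfolding restrict_off_def equiv_def refl_on_def sym_def trans_def by blast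

context partition_degree
begin

definition fuse :: "(nat \<times> nat) set \<Rightarrow> set_partition" where
  "fuse l = vertices // {(v, w). v \<in> vertices \<and> w \<in> vertices \<and> (index v, index w) \<in> l}"

definition isolate :: "nat set \<Rightarrow> set_partition" where
  "isolate B = vertices // {(v, w). v \<in> vertices \<and> w \<in> vertices \<and>
     (v = w \<or> index v = index w \<and> index v \<notin> B)}"

lemma index_in [simp]: "v \<in> vertices \<Longrightarrow> index v \<in> points"
  by (cases v) simp_all

lemma equiv_fuse:
  "equiv points l \<Longrightarrow> equiv vertices {(v, w). v \<in> vertices \<and> w \<in> vertices \<and> (index v, index w) \<in> l}"
  using index_in unfolding equiv_def refl_on_def sym_def trans_def by blast

lemma equiv_isolate:
  "equiv vertices {(v, w). v \<in> vertices \<and> w \<in> vertices \<and> (v = w \<or> index v = index w \<and> index v \<notin> B)}"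
  unfolding equiv_def refl_on_def sym_def trans_def by auto

lemma fuse_in_partitions [simp]: "equiv points l \<Longrightarrow> fuse l \<in> partitions n"
  unfolding fuse_def by (intro quotient_in_partitions equiv_fuse)

lemma isolate_in_partitions [simp]: "isolate B \<in> partitions n"
  unfolding isolate_def by (intro quotient_in_partitions equiv_isolate)

lemma block_edges_fuse:
  "equiv points l \<Longrightarrow>
    (v, w) \<in> block_edges (fuse l) \<longleftrightarrow> v \<in> vertices \<and> w \<in> vertices \<and> (index v, index w) \<in> l"
  by (simp add: fuse_def block_edges_quotient[OF equiv_fuse])

lemma block_edges_isolate:
  "(v, w) \<in> block_edges (isolate B) \<longleftrightarrow>
    v \<in> vertices \<and> w \<in> vertices \<and> (v = w \<or> index v = index w \<and> index v \<notin> B)"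
  by (simp add: isolate_def block_edges_quotient[OF equiv_isolate])

lemma swap_levels_eq_iff [simp]: "swap_levels v = swap_levels w \<longleftrightarrow> v = w"
  by (metis swap_levels_swap_levels)

lemma star_fuse [simp]: "equiv points l \<Longrightarrow> partition_star (fuse l) = fuse l"
  by (rule partition_eqI) (auto simp: block_edges_star block_edges_fuse)

lemma star_isolate [simp]: "partition_star (isolate B) = isolate B"
  by (rule partition_eqI) (auto simp: block_edges_star block_edges_isolate)

lemma mult_LoLo_via:
  assumes "a \<in> partitions n" "b \<in> partitions n" "(Lo z, Lo w) \<in> block_edges a"
    and "(Up z, Lo x) \<in> block_edges b" "(Up w, Lo y) \<in> block_edges b"
  shows "(Lo x, Lo y) \<in> block_edges (a \<odot> b)"
proof -
  have "(Lo x, Mid z) \<in> (product_graph a b)\<^sup>*" "(Mid z, Mid w) \<in> (product_graph a b)\<^sup>*"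
      "(Mid w, Lo y) \<in> (product_graph a b)\<^sup>*"
    using product_graph_left[OF assms(3), of b] product_graph_right[OF assms(5), of a]
      product_graph_right[OF block_edges_sym[OF assms(4)], of a] by simp_all
  then have "(Lo x, Lo y) \<in> (product_graph a b)\<^sup>*"
    by (meson rtrancl_trans)
  then show ?thesis
    using block_edges_in_vertices[OF assms(2,4)] block_edges_in_vertices[OF assms(2,5)]
    by (simp add: block_edges_mult)
qed

text \<open>Only the strands at the points of \<open>B\<close> are cut, so the product has an exact
  description in terms of \<open>a\<close>, which later serves as a rewrite rule.\<close>

lemma mult_isolate:
  assumes a: "a \<in> partitions n"
  shows "(v, w) \<in> block_edges (a \<odot> isolate B) \<longleftrightarrow>
    (v, w) \<in> block_edges a \<and> (v = w \<or> v \<notin> Lo ` B \<and> w \<notin> Lo ` B)" (is "?L \<longleftrightarrow> ?R")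
proof
  assume vw: ?L
  \<comment> \<open>A lower point off \<open>B\<close> is identified with its middle twin, to which
    its strand joins it; a lower point in \<open>B\<close> has no strand and stays put. The relation
    \<open>R\<close> is equality or an edge of \<open>a\<close> placed in the product graph.\<close>
  define g where "g v = (case v of Lo x \<Rightarrow> if x \<in> B then Lo x else Mid x | _ \<Rightarrow> v)" for v
  define R where "R u v \<longleftrightarrow> u = v \<or> (\<exists>p q. (p, q) \<in> block_edges a \<and> u = lo_to_mid p \<and> v = lo_to_mid q)" for u v
  have inj: "p = q" if "p \<in> vertices" "q \<in> vertices" "lo_to_mid p = lo_to_mid q" for p q
    using that by (cases p; cases q) auto
  have gv: "g (lo_to_mid u) = lo_to_mid u" for u
    by (cases u) (auto simp: g_def)
  have "R (g v) (g w)"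
    using vw
  proof (rule mult_fold[where R = R and g = g])
    fix p q assume "(p, q) \<in> block_edges a"
    then show "R (g (lo_to_mid p)) (g (lo_to_mid q))"
      by (auto simp: R_def gv)
  next
    fix p q assume "(p, q) \<in> block_edges (isolate B)"
    then show "R (g (up_to_mid p)) (g (up_to_mid q))"
      by (cases p; cases q) (auto simp: R_def g_def block_edges_isolate)
  next
    show "transp R"
    proof (rule transpI)
      fix x y z assume "R x y" "R y z"
      then show "R x z"
        using block_edges_trans[OF a] block_edges_in_vertices[OF a] inj unfolding R_def by metis
    qed
  qed (auto simp: reflp_def R_def)
  moreover have "v \<in> vertices" "w \<in> vertices"
    using block_edges_in_vertices[OF mult_in_partitions vw] .
  moreover have "g v = g w \<Longrightarrow> v = w" if "v \<in> vertices" "w \<in> vertices"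
    using that by (cases v; cases w) (auto simp: g_def split: if_splits)
  moreover have "g v = lo_to_mid p \<Longrightarrow> v = p \<and> v \<notin> Lo ` B" if "v \<in> vertices" "p \<in> vertices" for v p
    using that by (cases v; cases p) (auto simp: g_def split: if_splits)
  ultimately show ?R
    using block_edges_refl[OF a] block_edges_in_vertices[OF a] unfolding R_def by metis
next
  assume R: ?R
  then have mem: "v \<in> vertices" "w \<in> vertices"
    using block_edges_in_vertices[OF a] by auto
  show ?L
  proof (cases "v = w")
    case True
    then show ?thesis
      using mem by (simp add: block_edges_refl)
  next
    case False
    then have vw: "(v, w) \<in> block_edges a" "v \<notin> Lo ` B" "w \<notin> Lo ` B"
      using R by auto
    have iso: "x \<in> points \<Longrightarrow> x \<notin> B \<Longrightarrow> (Up x, Lo x) \<in> block_edges (isolate B)" for x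
      by (simp add: block_edges_isolate)
    show ?thesis
    proof (cases v; cases w)
      fix x y assume "v = Lo x" "w = Up y"
      then show ?thesis
        using mult_UpLo[OF a isolate_in_partitions block_edges_sym iso] vw mem
        by (auto intro: block_edges_sym)
    qed (use vw mem in \<open>auto intro: mult_UpUp[OF a] mult_UpLo[OF a isolate_in_partitions _ iso]
          mult_LoLo_via[OF a isolate_in_partitions _ iso iso]\<close>)
  qed
qed

text \<open>The product with \<open>fuse l\<close> is the equivalence generated by \<open>a\<close>
  and by \<open>l\<close> on the lower level. This is the minimality half, obtained by folding the
  middle level onto the lower one; \<open>mult_fuse_left\<close> and \<open>mult_fuse_right\<close>
  are the containment half.\<close>

lemma mult_fuse_least:
  assumes a: "a \<in> partitions n" and l: "equiv points l" and E: "equiv vertices E"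
    and "block_edges a \<subseteq> E" "\<And>x y. (x, y) \<in> l \<Longrightarrow> (Lo x, Lo y) \<in> E"
  shows "block_edges (a \<odot> fuse l) \<subseteq> E"
proof
  fix p assume "p \<in> block_edges (a \<odot> fuse l)"
  then obtain v w where p: "p = (v, w)" "(v, w) \<in> block_edges (a \<odot> fuse l)"
    by (metis surj_pair)
  have mem: "v \<in> vertices" "w \<in> vertices"
    using block_edges_in_vertices[OF mult_in_partitions p(2)] .
  have "(case_vertex Up Lo Lo v, case_vertex Up Lo Lo w) \<in> E"
    using p(2) E
  proof (rule mult_fold_equiv)
    show "case_vertex Up Lo Lo v \<in> vertices"
      using mem by (cases v) auto
  next
    fix u v assume uv: "(u, v) \<in> block_edges a"
    then show "(case_vertex Up Lo Lo (lo_to_mid u), case_vertex Up Lo Lo (lo_to_mid v)) \<in> E"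
      using block_edges_in_vertices[OF a uv] assms(4) by (cases u; cases v) auto
  next
    fix u v assume uv: "(u, v) \<in> block_edges (fuse l)"
    then show "(case_vertex Up Lo Lo (up_to_mid u), case_vertex Up Lo Lo (up_to_mid v)) \<in> E"
      using assms(5) by (cases u; cases v) (auto simp: block_edges_fuse[OF l])
  qed
  then show "p \<in> E"
    using mem p(1) by (cases v; cases w) auto
qed

lemma mult_fuse_left:
  assumes a: "a \<in> partitions n" and l: "equiv points l" and "(v, w) \<in> block_edges a"
  shows "(v, w) \<in> block_edges (a \<odot> fuse l)"
  using assms(3) a sym_block_edges
proof (rule block_edges_induct)
  have fuse: "x \<in> points \<Longrightarrow> (Up x, Lo x) \<in> block_edges (fuse l)" for x
    by (simp add: block_edges_fuse[OF l] equiv_reflD[OF l])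
  fix x y
  show "(Up x, Lo y) \<in> block_edges (a \<odot> fuse l)" if "(Up x, Lo y) \<in> block_edges a"
    using mult_UpLo[OF a fuse_in_partitions[OF l] that fuse] block_edges_in_vertices[OF a that] by simp
  show "(Lo x, Lo y) \<in> block_edges (a \<odot> fuse l)" if "(Lo x, Lo y) \<in> block_edges a"
    using mult_LoLo_via[OF a fuse_in_partitions[OF l] that fuse fuse] block_edges_in_vertices[OF a that]
    by simp
qed (simp add: a mult_UpUp)

lemma mult_fuse_right:
  assumes "equiv points l" "(x, y) \<in> l"
  shows "(Lo x, Lo y) \<in> block_edges (a \<odot> fuse l)"
  using assms equiv_inD[OF assms] by (intro mult_LoLo) (auto simp: block_edges_fuse)

text \<open>The hypotheses say that \<open>k\<close> is the join of \<open>l\<close> and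
  \<open>m\<close> among equivalences on \<open>points\<close>; thus fusions multiply like a join
  semilattice.\<close>

lemma fuse_mult_fuse:
  assumes "equiv points l" "equiv points m" "equiv points k" "l \<subseteq> k" "m \<subseteq> k" "k \<subseteq> (l \<union> m)\<^sup>*"
  shows "fuse l \<odot> fuse m = fuse k"
proof (rule partition_eqI)
  let ?E = "block_edges (fuse l \<odot> fuse m)"
  have E: "equiv vertices ?E"
    by (simp add: equiv_block_edges)
  have "?E \<subseteq> block_edges (fuse k)"
    using assms equiv_inD[OF assms(2)]
    by (intro mult_fuse_least) (auto simp: block_edges_fuse intro: equiv_block_edges)
  moreover have "(v, w) \<in> ?E" if vw: "(v, w) \<in> block_edges (fuse k)" for v w
  proof -
    have mem: "v \<in> vertices" "w \<in> vertices"
      using block_edges_in_vertices[OF _ vw] assms(3) by auto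
    have "(index v, index w) \<in> (l \<union> m)\<^sup>*"
      using vw assms(3,6) by (auto simp: block_edges_fuse)
    then have "(Lo (index v), Lo (index w)) \<in> ?E"
    proof (induction rule: rtrancl_induct)
      case base
      then show ?case
        using mem(1) by (simp add: equiv_reflD[OF E])
    next
      case (step y z)
      have "(Lo y, Lo z) \<in> ?E"
      proof (cases "(y, z) \<in> l")
        case True
        then show ?thesis
          using assms(1,2) equiv_inD[OF assms(1) True] by (intro mult_fuse_left) (auto simp: block_edges_fuse)
      next
        case False
        then show ?thesis
          using step.hyps(2) assms(2) by (intro mult_fuse_right) auto
      qed
      then show ?case
        using step.IH by (rule equiv_transD[OF E, rotated])
    qed
    moreover have "(u, Lo (index u)) \<in> ?E" if "u \<in> vertices" for u
      using assms(1,2) that equiv_reflD[OF assms(1) index_in[OF that]] index_in[OF that]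
      by (intro mult_fuse_left) (simp_all add: block_edges_fuse)
    ultimately show ?thesis
      using mem equiv_symD[OF E] equiv_transD[OF E] by metis
  qed
  ultimately show "?E = block_edges (fuse k)"
    by auto
qed (use assms in auto)

lemma isolate_mult_isolate: "isolate B \<odot> isolate C = isolate (B \<union> C)"
proof (rule partition_eqI)
  have "(v, w) \<in> block_edges (isolate B \<odot> isolate C) \<longleftrightarrow> (v, w) \<in> block_edges (isolate (B \<union> C))" for v w
    by (cases v; cases w) (auto simp: mult_isolate block_edges_isolate)
  then show "block_edges (isolate B \<odot> isolate C) = block_edges (isolate (B \<union> C))"
    by auto
qed simp_all

lemma star_fuse_mult_isolate:
  assumes "equiv points l" "\<And>x y. (x, y) \<in> l \<Longrightarrow> x \<in> B \<Longrightarrow> x = y"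
  shows "partition_star (fuse l \<odot> isolate B) = fuse l \<odot> isolate B"
proof (rule partition_eqI)
  have sep: "(x, y) \<in> l \<Longrightarrow> y \<in> B \<Longrightarrow> x = y" for x y
    using assms(2) equiv_symD[OF assms(1)] by metis
  have "(v, w) \<in> block_edges (partition_star (fuse l \<odot> isolate B)) \<longleftrightarrow> (v, w) \<in> block_edges (fuse l \<odot> isolate B)"
    for v w
    unfolding block_edges_star mult_isolate[OF fuse_in_partitions[OF assms(1)]] block_edges_fuse[OF assms(1)]
    by (cases v; cases w) (auto dest: sep assms(2))
  then show "block_edges (partition_star (fuse l \<odot> isolate B)) = block_edges (fuse l \<odot> isolate B)"
    by auto
qed simp_all

text \<open>The star reverses the product and fixes both factors, so commuting amounts to invariance
  of the product under the star. That holds when the points of \<open>B\<close> are alone in their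
  \<open>l\<close>-classes.\<close>

lemma fuse_mult_isolate_commute:
  assumes "equiv points l" "\<And>x y. (x, y) \<in> l \<Longrightarrow> x \<in> B \<Longrightarrow> x = y"
  shows "isolate B \<odot> fuse l = fuse l \<odot> isolate B"
  using star_fuse_mult_isolate[OF assms] assms(1) by (simp add: star_mult)

text \<open>Cutting the points of \<open>B\<close> above and below a fusion removes them from its
  classes. Through the relation for \<open>x_p x_q x_p\<close> this computes in PG(P) what a fusion
  does at a hole. The auxiliary \<open>?E\<close> is \<open>l\<close> on all vertices except the
  upper points of \<open>B\<close>, which stay alone.\<close>

lemma isolate_fuse_isolate:
  assumes l: "equiv points l"
  shows "isolate B \<odot> fuse l \<odot> isolate B = fuse (restrict_off B l) \<odot> isolate B"
proof (rule partition_eqI)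
  note l' = equiv_restrict_off[OF l, of B]
  let ?E = "block_edges (isolate B \<odot> fuse l)"
  have E: "equiv vertices ?E"
    by (simp add: equiv_block_edges)
  have upper: "?E \<subseteq> {(v, w). v \<in> vertices \<and> w \<in> vertices \<and>
      (v = w \<or> (index v, index w) \<in> l \<and> v \<notin> Up ` B \<and> w \<notin> Up ` B)}" (is "_ \<subseteq> ?F")
  proof (rule mult_fuse_least)
    show "equiv vertices ?F"
      using l unfolding equiv_def refl_on_def sym_def trans_def by blast
    show "block_edges (isolate B) \<subseteq> ?F"
      using equiv_reflD[OF l] by (auto simp: block_edges_isolate)
    show "(Lo x, Lo y) \<in> ?F" if "(x, y) \<in> l" for x y
      using that equiv_inD[OF l that] by auto
  qed (simp_all add: l)
  have lower: "(v, w) \<in> ?E" if vw: "v \<in> vertices" "w \<in> vertices" "(index v, index w) \<in> l"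
      "v \<notin> Up ` B" "w \<notin> Up ` B" for v w
  proof -
    have "(u, Lo (index u)) \<in> ?E" if "u \<in> vertices" "u \<notin> Up ` B" for u
      using that index_in[OF that(1)]
      by (intro mult_fuse_left l) (cases u; auto simp: block_edges_isolate)+
    then have "(v, Lo (index v)) \<in> ?E" "(Lo (index w), w) \<in> ?E" "(Lo (index v), Lo (index w)) \<in> ?E"
      using vw equiv_symD[OF E] mult_fuse_right[OF l] by simp_all
    then show ?thesis
      using equiv_transD[OF E] by metis
  qed
  have refl: "v \<in> vertices \<Longrightarrow> (v, v) \<in> ?E" "v \<in> vertices \<Longrightarrow> (index v, index v) \<in> l" for v
    using equiv_reflD[OF E] equiv_reflD[OF l] by auto
  have E_iff: "(v, w) \<in> ?E \<longleftrightarrow> v \<in> vertices \<and> w \<in> vertices \<and>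
      (v = w \<or> (index v, index w) \<in> l \<and> v \<notin> Up ` B \<and> w \<notin> Up ` B)" for v w
    using upper lower refl by auto
  have "(v, w) \<in> block_edges (isolate B \<odot> fuse l \<odot> isolate B) \<longleftrightarrow>
      (v, w) \<in> block_edges (fuse (restrict_off B l) \<odot> isolate B)" for v w
    unfolding mult_isolate[OF mult_in_partitions] mult_isolate[OF fuse_in_partitions[OF l']]
      block_edges_fuse[OF l'] E_iff restrict_off_iff
    using refl(2)[of v] refl(2)[of w] by (cases v; cases w) auto
  then show "block_edges (isolate B \<odot> fuse l \<odot> isolate B) = block_edges (fuse (restrict_off B l) \<odot> isolate B)"
    by auto
qed simp_all

text \<open>A class of \<open>l\<close> remains transversal as long as one of its points survives
  the cut; the dead points are those whose class lies inside \<open>B\<close>. The predicate is a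
  parameter because there are two uses: the nontransversal points of a projection, and the case in
  which no class dies.\<close>

lemma block_edges_fuse_isolate_fuse:
  assumes l: "equiv points l" and lB: "\<And>x. x \<in> points \<Longrightarrow> dead x \<longleftrightarrow> (\<forall>z. (x, z) \<in> l \<longrightarrow> z \<in> B)"
  shows "(v, w) \<in> block_edges (fuse l \<odot> isolate B \<odot> fuse l) \<longleftrightarrow>
    v \<in> vertices \<and> w \<in> vertices \<and> (index v, index w) \<in> l \<and>
    ((v \<in> range Up \<longleftrightarrow> w \<in> range Up) \<or> \<not> dead (index v))"
proof -
  let ?E = "block_edges (fuse l \<odot> isolate B \<odot> fuse l)"
  have E: "equiv vertices ?E"
    by (simp add: equiv_block_edges)
  have dead_cong: "dead x \<longleftrightarrow> dead y" if "(x, y) \<in> l" for x y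
    using lB equiv_inD[OF l that] equiv_symD[OF l] equiv_transD[OF l] that by metis
  have "?E \<subseteq> {(v, w). v \<in> vertices \<and> w \<in> vertices \<and> (index v, index w) \<in> l \<and>
      ((v \<in> range Up \<longleftrightarrow> w \<in> range Up) \<or> \<not> dead (index v))}" (is "_ \<subseteq> ?F")
  proof (rule mult_fuse_least)
    show "equiv vertices ?F"
    proof (rule equivI)
      show "refl_on vertices ?F"
        using equiv_reflD[OF l] by (auto simp: refl_on_def)
      show "sym ?F"
        using dead_cong equiv_symD[OF l] by (auto simp: sym_def)
      show "trans ?F"
        using dead_cong equiv_transD[OF l] unfolding trans_def by blast
    qed auto
    show "block_edges (fuse l \<odot> isolate B) \<subseteq> ?F"
    proof clarify
      fix v w assume vw: "(v, w) \<in> block_edges (fuse l \<odot> isolate B)"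
      then have "v \<in> vertices \<and> w \<in> vertices \<and> (index v, index w) \<in> l"
        by (simp add: mult_isolate block_edges_fuse l)
      moreover have "\<not> dead (index v)" if "v \<in> range Up \<longleftrightarrow> w \<notin> range Up"
      proof -
        have "\<exists>z. z \<notin> B \<and> ((index v, z) \<in> l)"
          using vw that equiv_reflD[OF l]
          by (cases v; cases w) (auto simp: mult_isolate block_edges_fuse l)
        then show ?thesis
          using lB equiv_inD[OF l] by blast
      qed
      ultimately show "v \<in> vertices \<and> w \<in> vertices \<and> (index v, index w) \<in> l \<and>
          ((v \<in> range Up \<longleftrightarrow> w \<in> range Up) \<or> \<not> dead (index v))"
        by blast
    qed
    show "(Lo x, Lo y) \<in> ?F" if "(x, y) \<in> l" for x y
      using that equiv_inD[OF l that] by auto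
  qed (simp_all add: l)
  moreover have "(v, w) \<in> ?E"
    if "v \<in> vertices" "w \<in> vertices" "(index v, index w) \<in> l"
      "(v \<in> range Up \<longleftrightarrow> w \<in> range Up) \<or> \<not> dead (index v)" for v w
  proof -
    have UU: "(Up x, Up y) \<in> ?E" if "(x, y) \<in> l" for x y
      using that equiv_inD[OF l that] by (intro mult_UpUp) (simp_all add: block_edges_fuse l)
    have LL: "(Lo x, Lo y) \<in> ?E" if "(x, y) \<in> l" for x y
      using that by (intro mult_fuse_right l)
    have UL: "(Up x, Lo y) \<in> ?E" if xy: "(x, y) \<in> l" "\<not> dead x" for x y
    proof -
      obtain z where z: "(x, z) \<in> l" "z \<notin> B"
        using lB xy equiv_inD[OF l xy(1)] by blast
      then have "(Up x, Lo z) \<in> ?E"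
        using equiv_inD[OF l z(1)] by (intro mult_fuse_left l) (auto simp: mult_isolate block_edges_fuse l)
      moreover have "(Lo z, Lo y) \<in> ?E"
        using z xy equiv_symD[OF l] equiv_transD[OF l] by (intro LL) metis
      ultimately show ?thesis
        by (rule equiv_transD[OF E])
    qed
    have LU: "(Lo x, Up y) \<in> ?E" if "(x, y) \<in> l" "\<not> dead x" for x y
      using equiv_symD[OF E UL[OF equiv_symD[OF l that(1)]]] dead_cong that by blast
    show ?thesis
      using that UU UL LL LU by (cases v; cases w) auto
  qed
  ultimately show ?thesis
    by auto
qed

section \<open>Projections of the partition monoid\<close>

abbreviation projs :: "set_partition set" where
  "projs \<equiv> projections (partition_monoid n)"

lemma projs_iff: "p \<in> projs \<longleftrightarrow> p \<in> partitions n \<and> p \<odot> p = p \<and> partition_star p = p"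
  by (simp add: projections_def partition_monoid_def)

lemma fuse_in_projs [simp]: "equiv points l \<Longrightarrow> fuse l \<in> projs"
  by (simp add: projs_iff) (rule fuse_mult_fuse; auto)

lemma isolate_in_projs [simp]: "isolate B \<in> projs"
  by (simp add: projs_iff isolate_mult_isolate)

text \<open>This is \<open>mult_star_mult\<close> for \<open>p \<odot> q\<close>, whose star is
  \<open>q \<odot> p\<close>.\<close>

lemma projs_mult_square:
  assumes "p \<in> projs" "q \<in> projs"
  shows "p \<odot> q \<odot> p \<odot> q = p \<odot> q"
proof -
  have p: "p \<in> partitions n" "p \<odot> p = p" "partition_star p = p"
    and q: "q \<in> partitions n" "q \<odot> q = q" "partition_star q = q"
    using assms by (simp_all add: projs_iff)
  have "p \<odot> q \<odot> (q \<odot> p) \<odot> (p \<odot> q) = p \<odot> q"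
    using mult_star_mult[of "p \<odot> q"] p q by (simp add: star_mult)
  then show ?thesis
    using p q by (simp add: mult_assoc) (metis mult_assoc mult_in_partitions)
qed

lemma projs_mult_mult:
  assumes "p \<in> projs" "q \<in> projs"
  shows "p \<odot> q \<odot> p \<in> projs"
proof -
  have p: "p \<in> partitions n" "p \<odot> p = p" "partition_star p = p"
    and q: "q \<in> partitions n" "q \<odot> q = q" "partition_star q = q"
    using assms by (simp_all add: projs_iff)
  have "p \<odot> q \<odot> p \<odot> q = p \<odot> q"
    using assms by (rule projs_mult_square)
  then show ?thesis
    using p q by (simp add: projs_iff star_mult mult_assoc) (metis mult_assoc mult_in_partitions)
qed

text \<open>A projection is the product of itself with its star, so the fold of
  \<open>mult_star_fold\<close> applies to \<open>p\<close> itself.\<close>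

lemma projs_level_symmetric:
  assumes "p \<in> projs" "(v, w) \<in> block_edges p"
  shows "(Up (index v), Up (index w)) \<in> block_edges p" "(Lo (index v), Lo (index w)) \<in> block_edges p"
proof -
  have p: "p \<in> partitions n" "p \<odot> p = p" "partition_star p = p"
    using assms by (simp_all add: projs_iff)
  note mem = block_edges_in_vertices[OF p(1) assms(2)]
  have "(case_vertex Up Up Lo v, case_vertex Up Up Lo w) \<in> block_edges p"
    using p assms(2) by (intro mult_star_fold) simp_all
  then show U: "(Up (index v), Up (index w)) \<in> block_edges p"
    using mem by (cases v; cases w) auto
  show "(Lo (index v), Lo (index w)) \<in> block_edges p"
    using U block_edges_star[of "Lo (index v)" "Lo (index w)" p] p(3) by simp
qed

definition ker :: "set_partition \<Rightarrow> (nat \<times> nat) set" where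
  "ker a = {(x, y). (Up x, Up y) \<in> block_edges a}"

definition coker :: "set_partition \<Rightarrow> (nat \<times> nat) set" where
  "coker a = {(x, y). (Lo x, Lo y) \<in> block_edges a}"

definition nontransversal :: "set_partition \<Rightarrow> nat set" where
  "nontransversal a = {x. \<nexists>y. (Up x, Lo y) \<in> block_edges a}"

lemma equiv_ker: "a \<in> partitions n \<Longrightarrow> equiv points (ker a)"
  using equiv_pullback[OF equiv_block_edges, of a Up] by (simp add: ker_def)

lemma equiv_coker: "a \<in> partitions n \<Longrightarrow> equiv points (coker a)"
  using equiv_pullback[OF equiv_block_edges, of a Lo] by (simp add: coker_def)

text \<open>By level symmetry a projection has the same kernel above and below, and a transversal
  joins a class to its own copy. It is therefore determined by its kernel and by the points whose
  class is not on a transversal; these are the data in the product.\<close>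

lemma projs_decompose:
  assumes "p \<in> projs"
  shows "p = fuse (ker p) \<odot> isolate (nontransversal p) \<odot> fuse (ker p)"
proof (rule partition_eqI)
  have p: "p \<in> partitions n" "p \<odot> p = p" "partition_star p = p"
    using assms by (simp_all add: projs_iff)
  note trans = block_edges_trans[OF p(1)] and sym = block_edges_sym
  note up = projs_level_symmetric[OF assms]
  have Lo_Up: "(Lo x, Lo y) \<in> block_edges p \<longleftrightarrow> (Up x, Up y) \<in> block_edges p" for x y
    using up[of "Lo x" "Lo y"] up[of "Up x" "Up y"] by auto
  have ker_dead: "(x, y) \<in> ker p \<Longrightarrow> x \<in> nontransversal p \<longleftrightarrow> y \<in> nontransversal p" for x y
    using trans sym unfolding nontransversal_def ker_def mem_Collect_eq prod.case by metis
  have dead: "x \<in> nontransversal p \<longleftrightarrow> (\<forall>z. (x, z) \<in> ker p \<longrightarrow> z \<in> nontransversal p)" if "x \<in> points" for x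
    using ker_dead equiv_reflD[OF equiv_ker[OF p(1)] that] by blast
  have UL: "(Up x, Lo y) \<in> block_edges p \<longleftrightarrow> (x, y) \<in> ker p \<and> x \<notin> nontransversal p" for x y
  proof
    assume "(Up x, Lo y) \<in> block_edges p"
    then show "(x, y) \<in> ker p \<and> x \<notin> nontransversal p"
      using up[of "Up x" "Lo y"] by (auto simp: ker_def nontransversal_def)
  next
    assume xy: "(x, y) \<in> ker p \<and> x \<notin> nontransversal p"
    then obtain z where z: "(Up x, Lo z) \<in> block_edges p"
      by (auto simp: nontransversal_def)
    have "(Lo x, Lo z) \<in> block_edges p" "(Lo x, Lo y) \<in> block_edges p"
      using up(2)[OF z] xy Lo_Up by (auto simp: ker_def)
    then show "(Up x, Lo y) \<in> block_edges p"
      using z trans sym by metis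
  qed
  have UU: "(Up x, Up y) \<in> block_edges p \<longleftrightarrow> (x, y) \<in> ker p"
    and LL: "(Lo x, Lo y) \<in> block_edges p \<longleftrightarrow> (x, y) \<in> ker p" for x y
    using Lo_Up by (simp_all add: ker_def)
  have product: "(v, w) \<in> block_edges (fuse (ker p) \<odot> isolate (nontransversal p) \<odot> fuse (ker p)) \<longleftrightarrow>
      v \<in> vertices \<and> w \<in> vertices \<and> (index v, index w) \<in> ker p \<and>
      ((v \<in> range Up \<longleftrightarrow> w \<in> range Up) \<or> index v \<notin> nontransversal p)" for v w
    using block_edges_fuse_isolate_fuse[OF equiv_ker[OF p(1)],
        of "\<lambda>x. x \<in> nontransversal p" "nontransversal p"] dead by blast
  have ker_sym: "(x, y) \<in> ker p \<longleftrightarrow> (y, x) \<in> ker p" for x y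
    using sym by (auto simp: ker_def)
  have ker_in: "(x, y) \<in> ker p \<Longrightarrow> x \<in> points \<and> y \<in> points" for x y
    using equiv_inD[OF equiv_ker[OF p(1)]] by blast
  have LU: "(Lo x, Up y) \<in> block_edges p \<longleftrightarrow> (x, y) \<in> ker p \<and> x \<notin> nontransversal p" for x y
    using UL[of y x] sym[of "Lo x" "Up y" p] sym[of "Up y" "Lo x" p] ker_sym[of x y] ker_dead[of x y] by blast
  have "(v, w) \<in> block_edges p \<longleftrightarrow>
      (v, w) \<in> block_edges (fuse (ker p) \<odot> isolate (nontransversal p) \<odot> fuse (ker p))" for v w
    unfolding product
    using UL LU UU LL block_edges_in_vertices[OF p(1), of v w] ker_in
    by (cases v; cases w) auto
  then show "block_edges p = block_edges (fuse (ker p) \<odot> isolate (nontransversal p) \<odot> fuse (ker p))"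
    by auto
qed (use assms in \<open>auto simp: projs_iff\<close>)

end

section \<open>The right action of generators on a presented semigroup\<close>

lemma free_words_iff: "u \<in> free_words A \<longleftrightarrow> u \<noteq> [] \<and> set u \<subseteq> A"
  by (auto simp: free_words_def)

locale presentation =
  fixes A :: "'a set" and R :: "('a list \<times> 'a list) set"
begin

definition cls :: "'a list \<Rightarrow> 'a list set" where
  "cls u = generated_congruence A R `` {u}"

text \<open>Defined on all sets of words, so that no membership conditions have to be carried along.\<close>

definition act :: "'a \<Rightarrow> 'a list set \<Rightarrow> 'a list set" where
  "act p X = (\<Union>u\<in>X. cls (u @ [p]))"

lemma congruence_in_free_words:
  "(u, v) \<in> generated_congruence A R \<Longrightarrow> u \<in> free_words A \<and> v \<in> free_words A"
  by (induction rule: generated_congruence.induct) (auto simp: free_words_iff)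

lemma equiv_congruence: "equiv (free_words A) (generated_congruence A R)"
  by (rule equivI) (auto simp: refl_on_def sym_def trans_def dest: congruence_in_free_words
      intro: generated_congruence.intros)

lemma in_cls_iff: "v \<in> cls u \<longleftrightarrow> (u, v) \<in> generated_congruence A R"
  by (simp add: cls_def)

lemma in_cls_self: "u \<in> free_words A \<Longrightarrow> u \<in> cls u"
  by (simp add: in_cls_iff generated_congruence.refl)

lemma cls_eqI: "(u, v) \<in> generated_congruence A R \<Longrightarrow> cls u = cls v"
  unfolding cls_def using equiv_congruence by (rule equiv_class_eq)

lemma cls_empty: "u \<notin> free_words A \<Longrightarrow> cls u = {}"
  using congruence_in_free_words by (auto simp: in_cls_iff)

lemma cls_append_cong:
  assumes "v \<in> cls u" "w \<in> lists A"
  shows "cls (v @ w) = cls (u @ w)"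
proof (cases "w = []")
  case True
  then show ?thesis
    using assms(1) by (simp add: in_cls_iff cls_eqI)
next
  case False
  then have "(w, w) \<in> generated_congruence A R"
    using assms(2) by (intro generated_congruence.refl) (auto simp: free_words_iff)
  then have "(u @ w, v @ w) \<in> generated_congruence A R"
    using assms(1) by (simp add: in_cls_iff generated_congruence.append)
  then show ?thesis
    by (simp add: cls_eqI)
qed

text \<open>Acting letter by letter equals appending the whole word, which makes the action
  invariant under the congruence. For lists in \<open>X\<close> that do not extend to words, both
  sides contribute the empty set.\<close>

lemma fold_act:
  assumes "w \<in> free_words A"
  shows "fold act w X = (\<Union>u\<in>X. cls (u @ w))"
  using assms
proof (induction w rule: rev_induct)
  case Nil
  then show ?case
    by (simp add: free_words_iff)
next
  case (snoc p w)
  show ?case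
  proof (cases "w = []")
    case True
    then show ?thesis
      by (simp add: act_def)
  next
    case False
    have "(\<Union>v\<in>cls (u @ w). cls (v @ [p])) = cls (u @ w @ [p])" for u
    proof (cases "u @ w \<in> free_words A")
      case True
      then have "cls (v @ [p]) = cls (u @ w @ [p])" if "v \<in> cls (u @ w)" for v
        using cls_append_cong[OF that, of "[p]"] snoc.prems by (simp add: free_words_iff)
      then show ?thesis
        using in_cls_self[OF True] by auto
    next
      case uw: False
      then have "u @ w @ [p] \<notin> free_words A"
        using False by (auto simp: free_words_iff)
      then show ?thesis
        using uw by (simp add: cls_empty)
    qed
    then show ?thesis
      using snoc False by (simp add: act_def free_words_iff)
  qed
qed

lemma fold_act_cong:
  assumes "(w, w') \<in> generated_congruence A R"
  shows "fold act w X = fold act w' X"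
proof -
  have mem: "w \<in> free_words A" "w' \<in> free_words A"
    using congruence_in_free_words[OF assms] by auto
  have "cls (u @ w) = cls (u @ w')" for u
  proof (cases "u \<in> free_words A")
    case True
    then show ?thesis
      using assms by (intro cls_eqI generated_congruence.append generated_congruence.refl)
  next
    case False
    show ?thesis
    \<comment> \<open>The empty list is not a word, but \<open>[] @ w\<close> is; this case matters
      because generators are later written as \<open>act p {[]}\<close>.\<close>
    proof (cases "u = []")
      case True
      then show ?thesis
        using assms by (simp add: cls_eqI)
    next
      case u: False
      then have "u @ w \<notin> free_words A" "u @ w' \<notin> free_words A"
        using False by (auto simp: free_words_iff)
      then show ?thesis
        by (simp add: cls_empty)
    qed
  qed
  then show ?thesis
    using mem by (simp add: fold_act)
qed

lemma fold_act_relation: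
  assumes "(w, w') \<in> R" "w \<in> free_words A" "w' \<in> free_words A"
  shows "fold act w X = fold act w' X"
  using assms by (intro fold_act_cong generated_congruence.rel)

abbreviation quot :: "'a list set semigrp" where
  "quot \<equiv> presented_semigrp A R"

lemma carrier_quot: "carrier quot = cls ` free_words A"
  by (auto simp: presented_semigrp_def quotient_def cls_def)

lemma carrierE:
  assumes "X \<in> carrier quot"
  obtains u where "u \<in> free_words A" "X = cls u"
  using assms by (auto simp: carrier_quot)

lemma cls_in_carrier: "u \<in> free_words A \<Longrightarrow> cls u \<in> carrier quot"
  by (simp add: carrier_quot)

lemma mult_cls:
  assumes "u \<in> free_words A" "v \<in> free_words A"
  shows "cls u \<cdot>\<^bsub>quot\<^esub> cls v = cls (u @ v)"
proof -
  have "cls (u' @ v') = cls (u @ v)" if "u' \<in> cls u" "v' \<in> cls v" for u' v'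
    using that by (metis cls_eqI generated_congruence.append in_cls_iff)
  then have "(\<Union>u'\<in>cls u. \<Union>v'\<in>cls v. cls (u' @ v')) = cls (u @ v)"
    using in_cls_self[OF assms(1)] in_cls_self[OF assms(2)] by blast
  then show ?thesis
    by (simp add: presented_semigrp_def cls_def)
qed

lemma mult_quot_closed: "X \<in> carrier quot \<Longrightarrow> Y \<in> carrier quot \<Longrightarrow> X \<cdot>\<^bsub>quot\<^esub> Y \<in> carrier quot"
  by (auto simp: carrier_quot mult_cls free_words_iff)

lemma mult_quot_assoc:
  assumes "X \<in> carrier quot" "Y \<in> carrier quot" "Z \<in> carrier quot"
  shows "X \<cdot>\<^bsub>quot\<^esub> Y \<cdot>\<^bsub>quot\<^esub> Z = X \<cdot>\<^bsub>quot\<^esub> (Y \<cdot>\<^bsub>quot\<^esub> Z)"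
proof -
  obtain u v w where "X = cls u" "u \<in> free_words A" "Y = cls v" "v \<in> free_words A"
      "Z = cls w" "w \<in> free_words A"
    using assms by (auto simp: carrier_quot)
  moreover from this have "u @ v \<in> free_words A" "v @ w \<in> free_words A"
    by (auto simp: free_words_iff)
  ultimately show ?thesis
    by (simp add: mult_cls)
qed

lemma mult_eq_fold_act:
  assumes "X \<in> carrier quot" "w \<in> free_words A"
  shows "X \<cdot>\<^bsub>quot\<^esub> cls w = fold act w X"
proof -
  obtain u where u: "u \<in> free_words A" "X = cls u"
    using assms(1) by (rule carrierE)
  have "fold act w X = cls (u @ w)"
    using fold_act[OF assms(2), of X] cls_append_cong[of _ u w] in_cls_self[OF u(1)] u(2) assms(2)
    by (auto simp: free_words_iff)
  then show ?thesis
    using u assms(2) by (simp add: mult_cls)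
qed

lemma act_eq_mult: "X \<in> carrier quot \<Longrightarrow> p \<in> A \<Longrightarrow> act p X = X \<cdot>\<^bsub>quot\<^esub> cls [p]"
  by (simp add: mult_eq_fold_act free_words_iff)

lemma act_closed: "X \<in> carrier quot \<Longrightarrow> p \<in> A \<Longrightarrow> act p X \<in> carrier quot"
  by (simp add: act_eq_mult mult_quot_closed cls_in_carrier free_words_iff)

lemma mult_act:
  "X \<in> carrier quot \<Longrightarrow> Y \<in> carrier quot \<Longrightarrow> p \<in> A \<Longrightarrow> X \<cdot>\<^bsub>quot\<^esub> act p Y = act p (X \<cdot>\<^bsub>quot\<^esub> Y)"
  by (simp add: act_eq_mult mult_quot_assoc mult_quot_closed cls_in_carrier free_words_iff)

end

section \<open>The action of the projections of the partition monoid\<close>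

context partition_degree
begin

abbreviation PA :: "set_partition proj_alg" where
  "PA \<equiv> projection_algebra (partition_monoid n)"

abbreviation M :: "set_partition list set semigrp" where
  "M \<equiv> PG PA"

lemma PA_simps [simp]: "carrier PA = projs" "conj_op PA p q = p \<odot> q \<odot> p"
  by (simp_all add: projection_algebra_def partition_monoid_def)

sublocale presentation projs "PG_relations PA" .

lemma M_eq: "M = quot"
  by (simp add: PG_def)

lemma act_act [simp]:
  assumes "p \<in> projs"
  shows "act p (act p X) = act p X"
  using fold_act_relation[of "[p, p]" "[p]" X] assms
  by (simp add: PG_relations_def free_words_iff)

lemma act_act_act_act:
  assumes "p \<in> projs" "q \<in> projs"
  shows "act q (act p (act q (act p X))) = act q (act p X)"
  using fold_act_relation[of "[p, q, p, q]" "[p, q]" X] assms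
  by (simp add: PG_relations_def free_words_iff)

lemma act_act_act:
  assumes "p \<in> projs" "q \<in> projs"
  shows "act p (act q (act p X)) = act (p \<odot> q \<odot> p) X"
  using fold_act_relation[of "[p, q, p]" "[p \<odot> q \<odot> p]" X] assms projs_mult_mult[OF assms]
  by (simp add: PG_relations_def free_words_iff)

text \<open>Put s = pq, which also equals qp, pqp and qsq. Then x_p x_q = (x_p x_q x_p) x_q = x_s
  x_q, and x_s = x_q x_s x_q absorbs the final x_q. Thus products of commuting projections may be
  computed in the partition monoid.\<close>

lemma act_mult:
  assumes "p \<in> projs" "q \<in> projs" "p \<odot> q \<in> projs"
  shows "act q (act p X) = act (p \<odot> q) X"
proof -
  let ?s = "p \<odot> q"
  have p: "p \<in> partitions n" "p \<odot> p = p" "partition_star p = p"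
    and q: "q \<in> partitions n" "q \<odot> q = q" "partition_star q = q"
    using assms by (simp_all add: projs_iff)
  have qp: "q \<odot> p = ?s"
    using assms(3) star_mult[OF p(1) q(1)] p q by (simp add: projs_iff)
  have "p \<odot> q \<odot> p = p \<odot> (p \<odot> q)"
    using p q by (simp add: mult_assoc qp)
  then have pqp: "p \<odot> q \<odot> p = ?s"
    using p q mult_assoc[of p p q] by simp
  have "q \<odot> ?s = ?s"
    using p q mult_assoc[of q q p] by (simp flip: qp)
  then have qsq: "q \<odot> ?s \<odot> q = ?s"
    using p q by (simp add: mult_assoc)
  have "act q (act p X) = act q (act ?s X)"
    using act_act_act_act[OF assms(1,2), of X] act_act_act[OF assms(1,2), of X] by (simp add: pqp)
  also have "\<dots> = act ?s X"
    using act_act_act[OF assms(2,3), of X] assms(2) by (simp add: qsq) (metis act_act)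
  finally show ?thesis .
qed

abbreviation act_fuse :: "(nat \<times> nat) set \<Rightarrow> set_partition list set \<Rightarrow> set_partition list set" where
  "act_fuse l \<equiv> act (fuse l)"

abbreviation act_isolate :: "nat set \<Rightarrow> set_partition list set \<Rightarrow> set_partition list set" where
  "act_isolate B \<equiv> act (isolate B)"

lemma act_fuse_fuse:
  assumes "equiv points l" "equiv points m" "equiv points k" "l \<subseteq> k" "m \<subseteq> k" "k \<subseteq> (l \<union> m)\<^sup>*"
  shows "act_fuse m (act_fuse l X) = act_fuse k X"
  using assms fuse_mult_fuse[OF assms] by (subst act_mult) simp_all

lemma act_isolate_isolate: "act_isolate C (act_isolate B X) = act_isolate (B \<union> C) X"
  by (subst act_mult) (simp_all add: isolate_mult_isolate)

lemma fuse_mult_isolate_in_projs: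
  assumes "equiv points l" "\<And>x y. (x, y) \<in> l \<Longrightarrow> x \<in> B \<Longrightarrow> x = y"
  shows "fuse l \<odot> isolate B \<in> projs"
proof -
  have "fuse l \<odot> isolate B \<odot> (fuse l \<odot> isolate B) = fuse l \<odot> (isolate B \<odot> fuse l) \<odot> isolate B"
    using assms by (simp add: mult_assoc)
  also have "\<dots> = fuse l \<odot> fuse l \<odot> (isolate B \<odot> isolate B)"
    using assms by (simp add: fuse_mult_isolate_commute mult_assoc)
  also have "\<dots> = fuse l \<odot> isolate B"
    using assms fuse_in_projs[OF assms(1)] by (simp add: projs_iff isolate_mult_isolate)
  finally show ?thesis
    using assms by (simp add: projs_iff star_fuse_mult_isolate)
qed

lemma act_fuse_isolate_commute:
  assumes "equiv points l" "\<And>x y. (x, y) \<in> l \<Longrightarrow> x \<in> B \<Longrightarrow> x = y"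
  shows "act_isolate B (act_fuse l X) = act_fuse l (act_isolate B X)"
  using assms fuse_mult_isolate_in_projs[OF assms] fuse_mult_isolate_commute[OF assms]
  by (simp add: act_mult)

lemma act_isolate_fuse_isolate:
  assumes l: "equiv points l"
  shows "act_isolate B (act_fuse l (act_isolate B X)) = act_fuse (restrict_off B l) (act_isolate B X)"
proof -
  note l' = equiv_restrict_off[OF l, of B]
  have sep: "x = y" if "(x, y) \<in> restrict_off B l" "x \<in> B" for x y
    using that by (simp add: restrict_off_iff)
  have "act_isolate B (act_fuse l (act_isolate B X)) = act (fuse (restrict_off B l) \<odot> isolate B) X"
    using act_act_act[of "isolate B" "fuse l" X] l by (simp add: isolate_fuse_isolate)
  also have "\<dots> = act_isolate B (act_fuse (restrict_off B l) X)"
    using l' fuse_mult_isolate_in_projs[OF l' sep] by (simp add: act_mult)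
  also have "\<dots> = act_fuse (restrict_off B l) (act_isolate B X)"
    using act_fuse_isolate_commute[OF l' sep] .
  finally show ?thesis .
qed

lemma fuse_isolate_fuse:
  assumes l: "equiv points l" and "\<And>x. x \<in> points \<Longrightarrow> \<exists>z. (x, z) \<in> l \<and> z \<notin> B"
  shows "fuse l \<odot> isolate B \<odot> fuse l = fuse l"
proof (rule partition_eqI)
  have "(v, w) \<in> block_edges (fuse l \<odot> isolate B \<odot> fuse l) \<longleftrightarrow> (v, w) \<in> block_edges (fuse l)" for v w
    using block_edges_fuse_isolate_fuse[OF l, of "\<lambda>_. False" B v w] assms(2)
    by (auto simp: block_edges_fuse[OF l])
  then show "block_edges (fuse l \<odot> isolate B \<odot> fuse l) = block_edges (fuse l)"
    by auto
qed (simp_all add: l)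

lemma act_fuse_isolate_fuse:
  assumes "equiv points l" "\<And>x. x \<in> points \<Longrightarrow> \<exists>z. (x, z) \<in> l \<and> z \<notin> B"
  shows "act_fuse l (act_isolate B (act_fuse l X)) = act_fuse l X"
  using act_act_act[of "fuse l" "isolate B" X] assms by (simp add: fuse_isolate_fuse)

lemma act_decompose:
  assumes "p \<in> projs"
  shows "act p X = act_fuse (ker p) (act_isolate (nontransversal p) (act_fuse (ker p) X))"
proof -
  have "fuse (ker p) \<in> projs"
    using assms equiv_ker[of p] by (simp add: projs_iff[of p])
  from act_act_act[OF this isolate_in_projs, of "nontransversal p" X] show ?thesis
    using projs_decompose[OF assms] by simp
qed

section \<open>Sliding moves from fusions with one large class\<close>

definition clump :: "nat set \<Rightarrow> (nat \<times> nat) set" where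
  "clump S = Id_on points \<union> S \<times> S"

lemma clump_iff: "(x, y) \<in> clump S \<longleftrightarrow> x = y \<and> x \<in> points \<or> x \<in> S \<and> y \<in> S"
  by (auto simp: clump_def)

lemma equiv_clump: "S \<subseteq> points \<Longrightarrow> equiv points (clump S)"
  by (rule equivI) (auto simp: clump_def refl_on_def sym_def trans_def)

text \<open>\<open>clump {}\<close> is equality, and its fusion is the identity partition. As
  \<open>X\<close> is an arbitrary set of words, this generator acts trivially only after another
  one has acted, which is the role of \<open>act_isolate B\<close>.\<close>

lemma act_fuse_Id_isolate: "act_fuse (clump {}) (act_isolate B X) = act_isolate B X"
proof -
  have eq: "equiv points (clump {})"
    by (simp add: equiv_clump)
  have "fuse (clump {}) = isolate {}"
    by (rule partition_eqI) (auto simp: block_edges_fuse eq block_edges_isolate clump_iff)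
  then show ?thesis
    by (simp add: act_isolate_isolate)
qed

text \<open>The entries of a configuration are the lower ends of transversals, and sliding from \<open>i\<close> to \<open>j\<close> moves
  the end \<open>i\<close> to the unoccupied point \<open>j\<close>.\<close>

definition slide :: "nat \<Rightarrow> nat \<Rightarrow> set_partition list set \<Rightarrow> set_partition list set" where
  "slide i j X = act_isolate {i} (act_fuse (clump {i, j}) X)"

definition hole :: "nat \<Rightarrow> set_partition list set \<Rightarrow> bool" where
  "hole h X \<longleftrightarrow> act_isolate {h} X = X"

lemma act_isolate_swap: "act_isolate B (act_isolate C X) = act_isolate C (act_isolate B X)"
  by (simp add: act_isolate_isolate Un_commute)

lemma act_isolate_clump_commute:
  "S \<subseteq> points \<Longrightarrow> B \<inter> S = {} \<Longrightarrow>
    act_isolate B (act_fuse (clump S) X) = act_fuse (clump S) (act_isolate B X)"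
  by (rule act_fuse_isolate_commute) (auto simp: equiv_clump clump_iff)

lemma restrict_off_clump: "S \<subseteq> points \<Longrightarrow> restrict_off {j} (clump S) = clump (S - {j})"
  by (auto simp: restrict_off_def clump_def)

lemma act_isolate_clump_isolate:
  "S \<subseteq> points \<Longrightarrow>
    act_isolate {j} (act_fuse (clump S) (act_isolate {j} X)) = act_fuse (clump (S - {j})) (act_isolate {j} X)"
  by (simp add: act_isolate_fuse_isolate equiv_clump restrict_off_clump)

lemma clump_singleton: "i \<in> points \<Longrightarrow> clump {i} = clump {}"
  by (auto simp: clump_def)

lemma act_fuse_clump_clump:
  assumes "S \<subseteq> points" "T \<subseteq> points" "z \<in> S \<inter> T"
  shows "act_fuse (clump T) (act_fuse (clump S) X) = act_fuse (clump (S \<union> T)) X"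
proof (rule act_fuse_fuse)
  have "(x, y) \<in> (clump S \<union> clump T)\<^sup>*" if "(x, y) \<in> clump (S \<union> T)" for x y
  proof (cases "x = y")
    case False
    then have "(x, z) \<in> clump S \<union> clump T" "(z, y) \<in> clump S \<union> clump T"
      using that assms(3) by (auto simp: clump_iff)
    then show ?thesis
      by (meson converse_rtrancl_into_rtrancl r_into_rtrancl)
  qed simp
  then show "clump (S \<union> T) \<subseteq> (clump S \<union> clump T)\<^sup>*"
    by auto
qed (use assms in \<open>auto simp: equiv_clump clump_iff\<close>)

lemma act_fuse_clump_swap:
  assumes "S \<subseteq> points" "T \<subseteq> points" "S \<inter> T = {}"
  shows "act_fuse (clump T) (act_fuse (clump S) X) = act_fuse (clump S) (act_fuse (clump T) X)"
proof -
  have *: "equiv points (clump S \<union> clump T)"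
    using assms by (intro equivI) (auto simp: clump_def refl_on_def sym_def trans_def)
  have "act_fuse (clump T) (act_fuse (clump S) X) = act_fuse (clump S \<union> clump T) X"
    using assms by (intro act_fuse_fuse * equiv_clump) auto
  moreover have "act_fuse (clump S) (act_fuse (clump T) X) = act_fuse (clump S \<union> clump T) X"
    using assms by (intro act_fuse_fuse * equiv_clump) auto
  ultimately show ?thesis
    by simp
qed

text \<open>Each law is a computation with the relations of PG(P). Going back: fusing {i, j},
  isolating i and fusing again is one fusion, and isolating j undoes it because j was a hole.
  Triangle: the fusions of {i, j} and {j, k} make one of {i, j, k}, from which the hole j drops out.
  Moves with disjoint supports commute factor by factor.\<close>

sublocale sliding hole slide points
proof
  fix i j y assume ij: "i \<in> points" "j \<in> points" "i \<noteq> j" "hole j y"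
  show "hole i (slide i j y)"
    by (simp add: hole_def slide_def)
  have jy: "act_isolate {j} y = y"
    using ij by (simp add: hole_def)
  have "slide j i (slide i j y) = act_isolate {j} (act_fuse (clump {i, j}) (act_isolate {i} (act_fuse (clump {i, j}) y)))"
    by (simp add: slide_def insert_commute)
  also have "\<dots> = act_isolate {j} (act_fuse (clump {i, j}) (act_isolate {j} y))"
    using ij by (subst act_fuse_isolate_fuse) (auto simp: equiv_clump clump_iff jy intro: exI[of _ j])
  also have "\<dots> = act_fuse (clump {i}) (act_isolate {j} y)"
    using ij by (subst act_isolate_clump_isolate) (auto simp: insert_Diff_if)
  also have "\<dots> = y"
    using ij act_fuse_Id_isolate[of "{j}" y] by (simp add: clump_singleton jy)
  finally show "slide j i (slide i j y) = y" .
next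
  fix i j h y assume "i \<in> points" "j \<in> points" "h \<in> points" "distinct [i, j, h]" "hole h y"
  then show "hole h (slide i j y)"
    unfolding hole_def slide_def
    by (subst act_isolate_swap, subst act_isolate_clump_commute) auto
next
  fix i j k y assume ijk: "i \<in> points" "j \<in> points" "k \<in> points" "distinct [i, j, k]" "hole j y" "hole k y"
  have jy: "act_isolate {j} y = y" and ky: "act_isolate {k} y = y"
    using ijk by (simp_all add: hole_def)
  have "slide j k (slide i j y) = act_isolate {j} (act_isolate {i} (act_fuse (clump {j, k}) (act_fuse (clump {i, j}) y)))"
    using ijk unfolding slide_def by (subst (2) act_isolate_clump_commute) auto
  also have "act_fuse (clump {j, k}) (act_fuse (clump {i, j}) y) = act_fuse (clump {i, j, k}) (act_isolate {j} y)"
    using ijk by (subst act_fuse_clump_clump[of _ _ j]) (auto simp: jy insert_commute)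
  also have "act_isolate {j} (act_isolate {i} \<dots>) = act_isolate {i} (act_fuse (clump {i, k}) (act_isolate {j} y))"
    using ijk by (subst act_isolate_swap, subst act_isolate_clump_isolate) (auto simp: insert_Diff_if)
  finally show "slide j k (slide i j y) = slide i k y"
    by (simp add: slide_def jy)
next
  fix i j k l y assume "i \<in> points" "j \<in> points" "k \<in> points" "l \<in> points" "distinct [i, j, k, l]"
  then show "slide k l (slide i j y) = slide i j (slide k l y)"
    unfolding slide_def
    by (simp add: act_isolate_clump_commute[symmetric] act_fuse_clump_swap[of "{i, j}"] act_isolate_swap[of "{k}"])
qed

end

section \<open>Evaluation in the partition monoid\<close>

context partition_degree
begin

lemma mult_isolate_empty: "a \<in> partitions n \<Longrightarrow> a \<odot> isolate {} = a"
  by (rule partition_eqI) (auto simp: mult_isolate)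

lemma isolate_empty_mult:
  assumes "a \<in> partitions n"
  shows "isolate {} \<odot> a = a"
proof -
  have "partition_star (isolate {} \<odot> a) = partition_star a"
    using assms by (simp add: star_mult mult_isolate_empty)
  then show ?thesis
    by (metis partition_star_star)
qed

definition word_prod :: "set_partition list \<Rightarrow> set_partition" where
  "word_prod w = foldl (\<odot>) (isolate {}) w"

lemma word_prod_in_partitions [simp]: "word_prod w \<in> partitions n"
  by (cases w rule: rev_cases) (simp_all add: word_prod_def)

lemma word_prod_append:
  "set v \<subseteq> partitions n \<Longrightarrow> word_prod (u @ v) = word_prod u \<odot> word_prod v"
proof (induction v rule: rev_induct)
  case Nil
  then show ?case
    using mult_isolate_empty[OF word_prod_in_partitions, of u] by (simp add: word_prod_def)
next
  case (snoc p v)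
  then have "word_prod (u @ v @ [p]) = word_prod u \<odot> word_prod v \<odot> p"
    by (simp add: word_prod_def)
  also have "\<dots> = word_prod u \<odot> (word_prod v \<odot> p)"
    using snoc.prems by (simp add: mult_assoc)
  finally show ?case
    by (simp add: word_prod_def)
qed

lemma projs_in_partitions: "p \<in> projs \<Longrightarrow> p \<in> partitions n"
  by (simp add: projs_iff)

lemma projs_idem: "p \<in> projs \<Longrightarrow> p \<odot> p = p"
  by (simp add: projs_iff)

lemma word_prod_singleton: "p \<in> partitions n \<Longrightarrow> word_prod [p] = p"
  by (simp add: word_prod_def isolate_empty_mult)

lemma word_prod_cong:
  "(u, v) \<in> generated_congruence projs (PG_relations PA) \<Longrightarrow> word_prod u = word_prod v"
proof (induction rule: generated_congruence.induct)
  case (rel u v)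
  from rel(1) show ?case
    unfolding PG_relations_def PA_simps
    by (auto simp: word_prod_def isolate_empty_mult projs_mult_square projs_idem projs_in_partitions)
next
  case (append u v u' v')
  have "set u' \<subseteq> partitions n" "set v' \<subseteq> partitions n"
    using congruence_in_free_words[OF append(2)] projs_in_partitions by (auto simp: free_words_iff)
  then show ?case
    using append by (simp add: word_prod_append)
qed simp_all

text \<open>The homomorphism from PG(P) to the partition monoid with x_p mapped to p. On classes the
  chosen representative does not matter by \<open>word_prod_cong\<close>.\<close>

definition eval_class :: "set_partition list set \<Rightarrow> set_partition" where
  "eval_class X = word_prod (SOME u. u \<in> X)"

lemma eval_cls:
  assumes "u \<in> free_words projs"
  shows "eval_class (cls u) = word_prod u"
proof -
  have "(SOME v. v \<in> cls u) \<in> cls u"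
    using in_cls_self[OF assms] by (metis someI)
  then show ?thesis
    unfolding eval_class_def by (metis in_cls_iff word_prod_cong)
qed

lemma eval_in_partitions [simp]: "eval_class X \<in> partitions n"
  by (simp add: eval_class_def)

lemma eval_mult:
  assumes "X \<in> carrier quot" "Y \<in> carrier quot"
  shows "eval_class (X \<cdot>\<^bsub>quot\<^esub> Y) = eval_class X \<odot> eval_class Y"
proof -
  obtain u v where u: "u \<in> free_words projs" "X = cls u" and v: "v \<in> free_words projs" "Y = cls v"
    using assms by (auto simp: carrier_quot)
  then have "u @ v \<in> free_words projs" "set v \<subseteq> partitions n"
    using projs_in_partitions by (auto simp: free_words_iff)
  then show ?thesis
    using u v by (simp add: mult_cls eval_cls word_prod_append)
qed

lemma eval_gen: "p \<in> projs \<Longrightarrow> eval_class (cls [p]) = p"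
  by (simp add: eval_cls free_words_iff word_prod_singleton projs_in_partitions)

lemma gen_in_carrier [simp]: "p \<in> projs \<Longrightarrow> cls [p] \<in> carrier quot"
  by (simp add: cls_in_carrier free_words_iff)

lemma eval_act: "X \<in> carrier quot \<Longrightarrow> p \<in> projs \<Longrightarrow> eval_class (act p X) = eval_class X \<odot> p"
  by (simp add: act_eq_mult eval_mult eval_gen)

lemma cls_gen: "cls [p] = act p {[]}"
  by (simp add: act_def)

lemma mult_UpLo_right:
  assumes "a \<in> partitions n" "b \<in> partitions n" "(Up x, Lo y) \<in> block_edges (a \<odot> b)"
  obtains z where "(Up z, Lo y) \<in> block_edges b"
proof -
  have "(Up y, Lo x) \<in> block_edges (partition_star (a \<odot> b))"
    using block_edges_sym[OF assms(3)] by (simp add: block_edges_star)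
  then obtain z where "(Up y, Lo z) \<in> block_edges (partition_star b)"
    using assms by (auto simp: star_mult elim: mult_UpLo_left[rotated])
  then have "(Lo y, Up z) \<in> block_edges b"
    by (simp add: block_edges_star)
  then show thesis
    using that block_edges_sym by blast
qed

text \<open>A sharper form of minimality: a walk to \<open>Lo y\<close> can be rearranged to leave
  \<open>v\<close> by one edge of \<open>a\<close> to the lower level and then use only the lower
  kernel of \<open>a\<close> and \<open>m\<close>.\<close>

lemma mult_fuse_Lo:
  assumes a: "a \<in> partitions n" and m: "equiv points m"
    and "(v, Lo y) \<in> block_edges (a \<odot> fuse m)" "v \<in> range Up \<union> range Lo"
  obtains z where "(v, Lo z) \<in> block_edges a" "(z, y) \<in> (coker a \<union> m)\<^sup>*"
proof -
  define J where "J = (coker a \<union> m)\<^sup>*"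
  have J: "sym J" "trans J"
    using equiv_coker[OF a] m unfolding J_def equiv_def
    by (auto intro: sym_rtrancl sym_Un trans_rtrancl)
  \<comment> \<open>\<open>h u\<close> collects the points reachable from \<open>u\<close> by such
    walks. Transported to the product graph, with middle and lower level treated alike, it is
    constant along all edges; so \<open>v\<close> has the same set as \<open>Lo y\<close>, and this
    set contains \<open>y\<close>.\<close>
  define h where "h u = {y. \<exists>z. (u, Lo z) \<in> block_edges a \<and> (z, y) \<in> J}" for u
  define g where "g = case_vertex (\<lambda>x. h (Up x)) (\<lambda>x. h (Lo x)) (\<lambda>x. h (Lo x))"
  have h_edge: "h u = h w" if "(u, w) \<in> block_edges a" for u w
    unfolding h_def using block_edges_trans[OF a] that block_edges_sym by blast
  have h_Lo: "y \<in> h (Lo x) \<longleftrightarrow> (x, y) \<in> J" if "x \<in> points" for x y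
  proof
    assume "y \<in> h (Lo x)"
    then obtain z where "(x, z) \<in> coker a" "(z, y) \<in> J"
      by (auto simp: h_def coker_def)
    then show "(x, y) \<in> J"
      unfolding J_def by (meson UnI1 converse_rtrancl_into_rtrancl)
  next
    assume "(x, y) \<in> J"
    then show "y \<in> h (Lo x)"
      using block_edges_refl[OF a, of "Lo x"] that by (auto simp: h_def)
  qed
  have h_m: "h (Lo x) = h (Lo z)" if "(x, z) \<in> m" for x z
  proof -
    have "(x, z) \<in> J"
      using that by (auto simp: J_def)
    then have "(x, y) \<in> J \<longleftrightarrow> (z, y) \<in> J" for y
      using J by (meson symD transD)
    then show ?thesis
      using h_Lo equiv_inD[OF m that] by auto
  qed
  have "g v = g (Lo y)"
    using assms(3)
  proof (rule mult_fold[where g = g and R = "(=)"])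
    fix u w assume uw: "(u, w) \<in> block_edges a"
    then show "g (lo_to_mid u) = g (lo_to_mid w)"
      using block_edges_in_vertices[OF a uw] h_edge[OF uw] by (cases u; cases w) (auto simp: g_def)
  next
    fix u w assume "(u, w) \<in> block_edges (fuse m)"
    then show "g (up_to_mid u) = g (up_to_mid w)"
      using h_m by (cases u; cases w) (auto simp: g_def block_edges_fuse[OF m])
  qed (auto simp: reflp_def transp_def)
  moreover have "y \<in> points"
    using block_edges_in_vertices(2)[OF mult_in_partitions assms(3)] by simp
  then have "y \<in> h (Lo y)"
    using h_Lo[of y y] by (simp add: J_def)
  ultimately have "y \<in> h v"
    using assms(4) by (auto simp: g_def)
  then show thesis
    using that by (auto simp: h_def J_def)
qed

text \<open>Sets such as \<open>nontransversal p\<close> also contain numbers outside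
  \<open>points\<close>; this trims them.\<close>

lemma isolate_Int_points: "isolate B = isolate (B \<inter> points)"
proof (rule partition_eqI)
  have "(v, w) \<in> block_edges (isolate B) \<longleftrightarrow> (v, w) \<in> block_edges (isolate (B \<inter> points))" for v w
    using index_in[of v] unfolding block_edges_isolate by blast
  then show "block_edges (isolate B) = block_edges (isolate (B \<inter> points))"
    by auto
qed simp_all

lemma coker_proj: "q \<in> projs \<Longrightarrow> coker q = ker q"
  using projs_level_symmetric[of q] by (fastforce simp: coker_def ker_def)

lemma coker_mult_isolate: "a \<in> partitions n \<Longrightarrow> coker (a \<odot> isolate B) = restrict_off B (coker a)"
  by (auto simp: coker_def restrict_off_def mult_isolate)

end

section \<open>Configurations of transversals\<close>

text \<open>\<open>c0\<close> lists one upper point from each transversal of the projection \<open>q\<close>.\<close>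

locale transversals = partition_degree +
  fixes q :: set_partition and c0 :: "nat list" and r :: nat
  assumes q: "q \<in> projs"
    and c0: "c0 \<in> configs points r"
    and r: "r + 2 \<le> n"
    and c0_transversal: "\<And>k. k < r \<Longrightarrow> (Up (c0 ! k), Lo (c0 ! k)) \<in> block_edges q"
    and c0_separated: "\<And>i j. i < r \<Longrightarrow> j < r \<Longrightarrow> (Up (c0 ! i), Up (c0 ! j)) \<in> block_edges q \<Longrightarrow> i = j"
    and c0_cover: "\<And>x y. (Up x, Lo y) \<in> block_edges q \<Longrightarrow> \<exists>k<r. (Up x, Up (c0 ! k)) \<in> block_edges q"
begin

text \<open>The partition with identity strands at the points of \<open>c0\<close> and singletons
  elsewhere: the projection of rank \<open>r\<close> that spreads the transversals of
  \<open>q\<close> onto separate lower ends.\<close>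

definition P0 :: set_partition where
  "P0 = isolate (points - set c0)"

lemma P0_in_projs [simp]: "P0 \<in> projs" and P0_in_partitions [simp]: "P0 \<in> partitions n"
  by (simp_all add: P0_def)

lemma q_in_partitions [simp]: "q \<in> partitions n"
  using q by (simp add: projs_iff)

lemma length_c0: "length c0 = r" and c0_points: "k < r \<Longrightarrow> c0 ! k \<in> points"
  using c0 nth_mem by (auto simp: configs_def)

lemma in_set_c0: "x \<in> set c0 \<longleftrightarrow> (\<exists>k<r. x = c0 ! k)"
  by (auto simp: in_set_conv_nth length_c0)

lemma q_up: "(v, w) \<in> block_edges q \<Longrightarrow> (Up (index v), Up (index w)) \<in> block_edges q"
  and q_lo: "(v, w) \<in> block_edges q \<Longrightarrow> (Lo (index v), Lo (index w)) \<in> block_edges q"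
  using projs_level_symmetric[OF q] by auto

lemma c0_separated_index:
  "(v, w) \<in> block_edges q \<Longrightarrow> index v \<in> set c0 \<Longrightarrow> index w \<in> set c0 \<Longrightarrow> index v = index w"
  using q_up c0_separated in_set_c0 by metis

text \<open>Every transversal of \<open>q\<close> passes through a point of \<open>c0\<close>, so
  inserting \<open>P0\<close> between two copies of \<open>q\<close> loses none.\<close>

lemma q_P0_q: "q \<odot> P0 \<odot> q = q"
proof (rule partition_eqI)
  have "(x, y) \<in> block_edges q" if xy: "(x, y) \<in> block_edges (q \<odot> P0 \<odot> q)" for x y
  proof -
    have "(case_vertex Up Lo Lo x, case_vertex Up Lo Lo y) \<in> block_edges q"
      using xy equiv_block_edges[OF q_in_partitions]
    proof (rule mult_fold_equiv)
      show "case_vertex Up Lo Lo x \<in> vertices"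
        using block_edges_in_vertices[OF mult_in_partitions xy] by (cases x) auto
    next
      fix u v assume "(u, v) \<in> block_edges (q \<odot> P0)"
      then have uv: "(u, v) \<in> block_edges q"
        by (simp add: P0_def mult_isolate)
      then show "(case_vertex Up Lo Lo (lo_to_mid u), case_vertex Up Lo Lo (lo_to_mid v)) \<in> block_edges q"
        using block_edges_in_vertices[OF q_in_partitions uv] by (cases u; cases v) auto
    next
      fix u v assume uv: "(u, v) \<in> block_edges q"
      then show "(case_vertex Up Lo Lo (up_to_mid u), case_vertex Up Lo Lo (up_to_mid v)) \<in> block_edges q"
        using block_edges_in_vertices[OF q_in_partitions uv] q_lo[OF uv] by (cases u; cases v) auto
    qed
    then show ?thesis
      using block_edges_in_vertices[OF mult_in_partitions xy] by (cases x; cases y) auto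
  qed
  moreover have "(x, y) \<in> block_edges (q \<odot> P0 \<odot> q)" if "(x, y) \<in> block_edges q" for x y
    using that q_in_partitions sym_block_edges
  proof (rule block_edges_induct)
    fix x y assume xy: "(Up x, Lo y) \<in> block_edges q"
    obtain k where k: "k < r" "(Up x, Up (c0 ! k)) \<in> block_edges q"
      using c0_cover[OF xy] by blast
    have "(Up x, Lo (c0 ! k)) \<in> block_edges q"
      using block_edges_trans[OF q_in_partitions k(2) c0_transversal[OF k(1)]] .
    then have "(Up x, Lo (c0 ! k)) \<in> block_edges (q \<odot> P0)"
      using k(1) length_c0 by (auto simp: P0_def mult_isolate)
    moreover have "(Up (c0 ! k), Lo y) \<in> block_edges q"
      using block_edges_trans[OF q_in_partitions block_edges_sym[OF k(2)] xy] .
    ultimately show "(Up x, Lo y) \<in> block_edges (q \<odot> P0 \<odot> q)"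
      using mult_UpLo[OF mult_in_partitions q_in_partitions] by blast
  qed (simp_all add: mult_UpUp mult_LoLo)
  ultimately show "block_edges (q \<odot> P0 \<odot> q) = block_edges q"
    by auto
qed simp_all

lemma P0_q_P0: "P0 \<odot> q \<odot> P0 = P0"
proof (rule partition_eqI)
  \<comment> \<open>The fold of the product graph of \<open>P0\<close> and \<open>q\<close>: the
    middle level and the upper ends of the strands go to the lower level, while the remaining upper
    points are isolated and stay. There \<open>q\<close> can only join points of \<open>c0\<close>
    to points of other classes, since \<open>c0\<close> is separated.\<close>
  define g where "g v = (case v of Up x \<Rightarrow> if x \<in> set c0 then Lo x else Up x | Lo x \<Rightarrow> Lo x | Mid x \<Rightarrow> Lo x)" for v
  define R where "R u v \<longleftrightarrow> u = v \<or> u \<in> range Lo \<and> v \<in> range Lo \<and> (u, v) \<in> block_edges q" for u v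
  have R: "R (g x) (g y)" if "(x, y) \<in> block_edges (P0 \<odot> q)" for x y
    using that
  proof (rule mult_fold[where g = g and R = R])
    fix u v assume "(u, v) \<in> block_edges P0"
    then show "R (g (lo_to_mid u)) (g (lo_to_mid v))"
      by (cases u; cases v) (auto simp: R_def g_def P0_def block_edges_isolate)
  next
    fix u v assume uv: "(u, v) \<in> block_edges q"
    then show "R (g (up_to_mid u)) (g (up_to_mid v))"
      using q_lo[OF uv] block_edges_in_vertices[OF q_in_partitions uv]
      by (cases u; cases v) (auto simp: R_def g_def)
  next
    show "transp R"
      using block_edges_trans[OF q_in_partitions] unfolding transp_def R_def by blast
  qed (auto simp: reflp_def R_def)
  have "(x, y) \<in> block_edges P0" if xy: "(x, y) \<in> block_edges (P0 \<odot> q \<odot> P0)" for x y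
  proof -
    have xy': "(x, y) \<in> block_edges (P0 \<odot> q)" "x = y \<or> x \<notin> Lo ` (points - set c0) \<and> y \<notin> Lo ` (points - set c0)"
      using xy by (auto simp: P0_def mult_isolate)
    note mem = block_edges_in_vertices[OF mult_in_partitions xy]
    show ?thesis
    proof (cases "x = y")
      case True
      then show ?thesis
        using mem by (simp add: block_edges_refl)
    next
      case False
      have "index x = index y \<and> index x \<in> set c0"
        using R[OF xy'(1)] xy'(2) mem False c0_separated_index[of "Lo (index x)" "Lo (index y)"]
        by (cases x; cases y) (auto simp: R_def g_def split: if_splits)
      then show ?thesis
        using mem by (auto simp: P0_def block_edges_isolate)
    qed
  qed
  moreover have "(x, y) \<in> block_edges (P0 \<odot> q \<odot> P0)" if xy: "(x, y) \<in> block_edges P0" for x y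
    using xy P0_in_partitions sym_block_edges
  proof (rule block_edges_induct)
    fix x y assume "(Up x, Lo y) \<in> block_edges P0"
    then have x: "x = y" "x \<in> points" "x \<in> set c0"
      by (auto simp: P0_def block_edges_isolate)
    then obtain k where "k < r" "x = c0 ! k"
      by (auto simp: in_set_c0)
    then have "(Up x, Lo x) \<in> block_edges q"
      using c0_transversal by simp
    moreover have "(Up x, Lo x) \<in> block_edges P0"
      using x by (simp add: P0_def block_edges_isolate)
    ultimately have "(Up x, Lo x) \<in> block_edges (P0 \<odot> q)"
      using mult_UpLo[OF P0_in_partitions q_in_partitions] by blast
    then show "(Up x, Lo y) \<in> block_edges (P0 \<odot> q \<odot> P0)"
      using x by (auto simp: P0_def mult_isolate)
  qed (simp_all add: mult_UpUp mult_LoLo)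
  ultimately show "block_edges (P0 \<odot> q \<odot> P0) = block_edges P0"
    by auto
qed simp_all

definition xq :: "set_partition list set" where
  "xq = cls [q]"

lemma xq_closed [simp]: "xq \<in> carrier quot"
  by (simp add: xq_def q)

lemma act_q_act_P0_xq: "act q (act P0 xq) = xq"
  using act_act_act[OF q P0_in_projs] by (simp add: xq_def cls_gen q_P0_q)

definition sigma :: "nat list \<Rightarrow> set_partition list set" where
  "sigma = (SOME s. is_section points r s \<and> s c0 = act P0 xq)"

lemma sigma: "is_section points r sigma" "sigma c0 = act P0 xq"
proof -
  have "\<exists>s. is_section points r s \<and> s c0 = act P0 xq"
  proof (rule section_exists)
    show "hole h (act P0 xq)" if "h \<in> points - set c0" for h
      using that by (auto simp: hole_def P0_def act_isolate_isolate insert_absorb)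
  qed (use r c0 in auto)
  from someI_ex[OF this] show "is_section points r sigma" "sigma c0 = act P0 xq"
    by (simp_all add: sigma_def)
qed

lemma sigma_update:
  "c \<in> configs points r \<Longrightarrow> k < r \<Longrightarrow> j \<in> points - set c \<Longrightarrow> sigma (c[k := j]) = slide (c ! k) j (sigma c)"
  using section_slide[OF sigma(1)] by simp

lemma sigma_induct:
  assumes "c \<in> configs points r" "Q c0"
    and "\<And>c k j. c \<in> configs points r \<Longrightarrow> k < r \<Longrightarrow> j \<in> points - set c \<Longrightarrow> Q c \<Longrightarrow> Q (c[k := j])"
  shows "Q c"
  using configs_connected[OF finite_points _ c0 assms(1), of Q] assms(2,3) r by simp

lemma config_nth: "c \<in> configs points r \<Longrightarrow> k < r \<Longrightarrow> c ! k \<in> points"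
  using nth_mem by (auto simp: configs_def)

lemma slide_closed: "i \<in> points \<Longrightarrow> j \<in> points \<Longrightarrow> X \<in> carrier quot \<Longrightarrow> slide i j X \<in> carrier quot"
  by (simp add: slide_def act_closed equiv_clump)

lemma mult_slide:
  "i \<in> points \<Longrightarrow> j \<in> points \<Longrightarrow> X \<in> carrier quot \<Longrightarrow> Y \<in> carrier quot \<Longrightarrow>
    X \<cdot>\<^bsub>quot\<^esub> slide i j Y = slide i j (X \<cdot>\<^bsub>quot\<^esub> Y)"
  by (simp add: slide_def mult_act act_closed equiv_clump)

lemma sigma_closed: "c \<in> configs points r \<Longrightarrow> sigma c \<in> carrier quot"
proof (rule sigma_induct[of c "\<lambda>c. sigma c \<in> carrier quot"])
  show "sigma c0 \<in> carrier quot"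
    by (simp add: sigma act_closed)
  show "sigma (c[k := j]) \<in> carrier quot"
    if "c \<in> configs points r" "k < r" "j \<in> points - set c" "sigma c \<in> carrier quot" for c k j
    using that config_nth by (auto simp: sigma_update intro!: slide_closed)
qed

lemma sigma_isolate:
  assumes c: "c \<in> configs points r" and "B \<subseteq> points - set c"
  shows "act_isolate B (sigma c) = sigma c"
proof -
  have hole: "act_isolate {h} (sigma c) = sigma c" if "h \<in> points - set c" for h
    using section_hole[OF sigma(1) c] that by (simp add: hole_def)
  have "finite B"
    using finite_subset[OF assms(2)] by simp
  then show ?thesis
    using assms(2)
  proof (induction B rule: finite_induct)
    \<comment> \<open>Even \<open>isolate {}\<close>, the identity partition, needs an argument:
      \<open>sigma c\<close> is fixed by some \<open>isolate {h}\<close>, which absorbs it. A free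
      point \<open>h\<close> exists because \<open>r < n\<close>.\<close>
    case empty
    have "card (set c) = r"
      using c by (auto simp: configs_def distinct_card)
    then have "\<not> points \<subseteq> set c"
      using r card_mono[OF finite_set, of points c] by auto
    then obtain h where "h \<in> points - set c"
      by blast
    then have h: "act_isolate {h} (sigma c) = sigma c"
      by (rule hole)
    show ?case
      using act_isolate_isolate[of "{}" "{h}" "sigma c"] unfolding h by (simp add: h)
  next
    case (insert h B)
    then have h: "act_isolate {h} (sigma c) = sigma c" and B: "act_isolate B (sigma c) = sigma c"
      using hole by auto
    have "act_isolate {h} (act_isolate B (sigma c)) = act_isolate (insert h B) (sigma c)"
      by (simp add: act_isolate_isolate)
    then show ?case
      unfolding B h by simp
  qed
qed

text \<open>\<open>fuse l\<close> absorbs the fusion \<open>?t\<close> of the two points. A move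
  between them followed by \<open>?t\<close> is \<open>?t\<close>, \<open>isolate\<close>,
  \<open>?t\<close>, which collapses to \<open>?t\<close>; so the move becomes invisible.\<close>

lemma act_fuse_sigma_update:
  assumes l: "equiv points l" and c: "c \<in> configs points r" and k: "k < r"
    and j: "j \<in> points - set c" and kj: "(c ! k, j) \<in> l"
  shows "act_fuse l (sigma (c[k := j])) = act_fuse l (sigma c)"
proof -
  let ?t = "clump {c ! k, j}"
  have ck: "c ! k \<in> points" "c ! k \<noteq> j"
    using c k j config_nth nth_mem by (auto simp: configs_def)
  have t: "equiv points ?t"
    using ck j by (simp add: equiv_clump)
  have "?t \<subseteq> l"
    using equiv_reflD[OF l] equiv_symD[OF l kj] kj ck j by (auto simp: clump_def)
  then have absorb: "act_fuse l X = act_fuse l (act_fuse ?t X)" for X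
    using act_fuse_fuse[OF t l l, of X] by auto
  have "act_fuse l (sigma (c[k := j])) = act_fuse l (act_fuse ?t (act_isolate {c ! k} (act_fuse ?t (sigma c))))"
    using sigma_update[OF c k j] absorb by (simp add: slide_def)
  also have "act_fuse ?t (act_isolate {c ! k} (act_fuse ?t (sigma c))) = act_fuse ?t (sigma c)"
  proof (rule act_fuse_isolate_fuse[OF t])
    fix x assume "x \<in> points"
    then show "\<exists>z. (x, z) \<in> ?t \<and> z \<notin> {c ! k}"
      using ck by (cases "x = c ! k") (auto simp: clump_iff)
  qed
  finally show ?thesis
    by (simp flip: absorb)
qed

text \<open>The ends are moved from \<open>c\<close> to \<open>c'\<close> one at a time from the
  left, through \<open>take m c' @ drop m c\<close>. The next target cannot be occupied: an end
  \<open>c ! i\<close> sitting there would be \<open>l\<close>-related to \<open>c ! m\<close>,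
  contrary to \<open>sep\<close>.\<close>

lemma act_fuse_sigma_cong:
  assumes l: "equiv points l" and c: "c \<in> configs points r" and c': "c' \<in> configs points r"
    and rel: "\<And>k. k < r \<Longrightarrow> (c ! k, c' ! k) \<in> l"
    and sep: "\<And>i j. i < r \<Longrightarrow> j < r \<Longrightarrow> (c ! i, c ! j) \<in> l \<Longrightarrow> i = j"
  shows "act_fuse l (sigma c) = act_fuse l (sigma c')"
proof -
  have len: "length c = r" "length c' = r"
    using c c' by (auto simp: configs_def)
  have "take m c' @ drop m c \<in> configs points r \<and>
      act_fuse l (sigma (take m c' @ drop m c)) = act_fuse l (sigma c)" if "m \<le> r" for m
    using that
  proof (induction m)
    case 0
    then show ?case
      using c by simp
  next
    case (Suc m)
    let ?d = "take m c' @ drop m c"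
    have IH: "?d \<in> configs points r" "act_fuse l (sigma ?d) = act_fuse l (sigma c)"
      using Suc by auto
    have m: "m < r"
      using Suc.prems by simp
    have upd: "take (Suc m) c' @ drop (Suc m) c = ?d[m := c' ! m]"
      using m len by (intro nth_equalityI) (auto simp: nth_append nth_list_update less_Suc_eq)
    have dm: "?d ! m = c ! m"
      using m len by (simp add: nth_append)
    show ?case
    proof (cases "c' ! m = c ! m")
      case True
      then have "?d[m := c' ! m] = ?d"
        using dm by (metis list_update_id)
      then show ?thesis
        using IH upd by simp
    next
      case False
      have "c' ! m \<noteq> ?d ! i" if i: "i < r" for i
      proof
        assume eq: "c' ! m = ?d ! i"
        show False
        proof (cases "i < m")
          case True
          then have "c' ! m = c' ! i"
            using eq len m by (simp add: nth_append)
          then show False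
            using True m c' i len by (auto simp: configs_def nth_eq_iff_index_eq)
        next
          case i_m: False
          then have "c' ! m = c ! i"
            using eq len m i by (simp add: nth_append)
          then show False
            using sep[OF m i] rel[OF m] False by auto
        qed
      qed
      moreover have "length ?d = r"
        using IH(1) unfolding configs_def by blast
      ultimately have "c' ! m \<notin> set ?d"
        unfolding in_set_conv_nth by metis
      then have fresh: "c' ! m \<in> points - set ?d"
        using config_nth[OF c' m] by blast
      then show ?thesis
        using configs_update[OF IH(1) m fresh] act_fuse_sigma_update[OF l IH(1) m fresh] rel[OF m] dm IH(2) upd
        by simp
    qed
  qed
  from this[of r] show ?thesis
    using len by simp
qed

text \<open>One \<open>a\<close> can have several \<open>c\<close>, one for each choice of a lower
  point on each of the \<open>r\<close> transversals. The last clause excludes elements in which two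
  of these transversals have merged.\<close>

definition represents :: "set_partition \<Rightarrow> nat list \<Rightarrow> bool" where
  "represents a c \<longleftrightarrow> c \<in> configs points r \<and>
     (\<forall>k<r. (Up (c0 ! k), Lo (c ! k)) \<in> block_edges a) \<and>
     (\<forall>i<r. \<forall>j<r. (Up (c0 ! i), Up (c0 ! j)) \<in> block_edges a \<longrightarrow> i = j)"

text \<open>The rewriting target: an element with \<open>r\<close> separated transversals is determined by where these
  transversals end and by the lower kernel.\<close>

definition normal :: "set_partition list set \<Rightarrow> bool" where
  "normal Y \<longleftrightarrow> Y \<in> carrier quot \<and>
     (\<forall>c. represents (eval_class Y) c \<longrightarrow> Y = act_fuse (coker (eval_class Y)) (sigma c))"

text \<open>In \<open>q \<odot> P0\<close> the only lower points on transversals are those of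
  \<open>c0\<close>, so \<open>c0\<close> is the only configuration to consider, and the lower
  kernel is equality.\<close>

lemma normal_sigma_c0: "normal (act P0 xq)"
  unfolding normal_def
proof (intro conjI allI impI)
  show "act P0 xq \<in> carrier quot"
    by (simp add: act_closed)
  have eval: "eval_class (act P0 xq) = q \<odot> P0"
    using q by (simp add: eval_act xq_def eval_gen)
  fix c assume "represents (eval_class (act P0 xq)) c"
  then have c: "c \<in> configs points r" "\<And>k. k < r \<Longrightarrow> (Up (c0 ! k), Lo (c ! k)) \<in> block_edges (q \<odot> P0)"
    unfolding represents_def eval by auto
  have "c ! k = c0 ! k" if k: "k < r" for k
  proof -
    have ck: "(Up (c0 ! k), Lo (c ! k)) \<in> block_edges q" "c ! k \<in> set c0"
      using c(2)[OF k] config_nth[OF c(1) k] by (auto simp: P0_def mult_isolate)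
    moreover have "c0 ! k \<in> set c0"
      using k length_c0 by simp
    ultimately show ?thesis
      using c0_separated_index[OF ck(1)] by simp
  qed
  then have "c = c0"
    using c(1) length_c0 by (intro nth_equalityI) (auto simp: configs_def)
  have "coker (q \<odot> P0) = clump {}"
  proof -
    have "(x, y) \<in> coker (q \<odot> P0) \<longleftrightarrow> (x, y) \<in> clump {}" for x y
    proof
      assume "(x, y) \<in> coker (q \<odot> P0)"
      then have xy: "(Lo x, Lo y) \<in> block_edges (q \<odot> P0)"
        by (simp add: coker_def)
      then have mem: "x \<in> points" "y \<in> points"
        using block_edges_in_vertices[OF mult_in_partitions xy] by auto
      have "(Lo x, Lo y) \<in> block_edges q" "x = y \<or> x \<in> set c0 \<and> y \<in> set c0"
        using xy mem by (auto simp: P0_def mult_isolate)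
      then have "x = y"
        using c0_separated_index[of "Lo x" "Lo y"] by auto
      then show "(x, y) \<in> clump {}"
        using mem by (simp add: clump_iff)
    next
      assume "(x, y) \<in> clump {}"
      then show "(x, y) \<in> coker (q \<odot> P0)"
        by (auto simp: clump_iff coker_def block_edges_refl)
    qed
    then show ?thesis
      by auto
  qed
  then show "act P0 xq = act_fuse (coker (eval_class (act P0 xq))) (sigma c)"
    using act_fuse_Id_isolate[of "points - set c0" xq]
    unfolding eval \<open>c = c0\<close> sigma(2) by (simp add: P0_def)
qed

text \<open>An end of \<open>c\<close> cannot lie in \<open>B\<close>, as it survives the
  multiplication by \<open>isolate B\<close>. Hence this generator fixes \<open>sigma c\<close> and
  may be inserted before the fusion, where \<open>act_isolate_fuse_isolate\<close> applies.\<close>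

lemma normal_act_isolate:
  assumes "normal Y"
  shows "normal (act_isolate B Y)"
proof -
  have Y: "Y \<in> carrier quot"
    using assms by (simp add: normal_def)
  let ?a = "eval_class Y" and ?B = "B \<inter> points"
  have eval: "eval_class (act_isolate B Y) = ?a \<odot> isolate ?B"
    using Y by (simp add: eval_act flip: isolate_Int_points)
  have "act_isolate B Y = act_fuse (coker (?a \<odot> isolate ?B)) (sigma c)"
    if c: "represents (?a \<odot> isolate ?B) c" for c
  proof -
    have "represents ?a c"
      using c by (simp add: represents_def mult_isolate)
    then have Y_eq: "Y = act_fuse (coker ?a) (sigma c)"
      using assms by (simp add: normal_def)
    have "c ! k \<notin> ?B" if "k < r" for k
      using c that by (auto simp: represents_def mult_isolate)
    moreover have "c \<in> configs points r"
      using c by (simp add: represents_def)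
    ultimately have fixed: "act_isolate ?B (sigma c) = sigma c"
      by (intro sigma_isolate) (auto simp: configs_def in_set_conv_nth)
    have "act_isolate B Y = act_isolate ?B (act_fuse (coker ?a) (act_isolate ?B (sigma c)))"
      unfolding fixed by (subst isolate_Int_points) (simp flip: Y_eq)
    also have "\<dots> = act_fuse (restrict_off ?B (coker ?a)) (sigma c)"
      using act_isolate_fuse_isolate[OF equiv_coker[OF eval_in_partitions]] unfolding fixed by (metis fixed)
    finally show ?thesis
      by (simp add: coker_mult_isolate)
  qed
  then show ?thesis
    unfolding normal_def eval using Y by (simp add: act_closed)
qed

text \<open>A configuration \<open>c'\<close> for the product may use points that the transversals
  of \<open>?a\<close> do not reach. Each entry is traced back to a lower point \<open>f k\<close>
  of the corresponding transversal of \<open>?a\<close>. These points represent \<open>?a\<close>,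
  and under the enlarged lower kernel they can be slid to \<open>c'\<close>.\<close>

lemma normal_act_fuse:
  assumes "normal Y" and m: "equiv points m"
  shows "normal (act_fuse m Y)"
proof -
  have Y: "Y \<in> carrier quot"
    using assms by (simp add: normal_def)
  let ?a = "eval_class Y"
  let ?a' = "?a \<odot> fuse m"
  have eval: "eval_class (act_fuse m Y) = ?a'"
    using Y m by (simp add: eval_act)
  have coker: "coker ?a \<subseteq> coker ?a'" "m \<subseteq> coker ?a'" "coker ?a' \<subseteq> (coker ?a \<union> m)\<^sup>*"
  proof -
    show "coker ?a \<subseteq> coker ?a'" "m \<subseteq> coker ?a'"
      using mult_fuse_left[OF eval_in_partitions m] mult_fuse_right[OF m] by (auto simp: coker_def)
    show "coker ?a' \<subseteq> (coker ?a \<union> m)\<^sup>*"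
    proof clarify
      fix x y assume "(x, y) \<in> coker ?a'"
      then have "(Lo x, Lo y) \<in> block_edges ?a'"
        by (simp add: coker_def)
      then obtain z where "(Lo x, Lo z) \<in> block_edges ?a" "(z, y) \<in> (coker ?a \<union> m)\<^sup>*"
        using mult_fuse_Lo[OF eval_in_partitions m] by blast
      then show "(x, y) \<in> (coker ?a \<union> m)\<^sup>*"
        by (auto simp: coker_def intro: converse_rtrancl_into_rtrancl)
    qed
  qed
  have ek: "equiv points (coker ?a')"
    by (simp add: equiv_coker)
  have "(coker ?a \<union> m)\<^sup>* \<inter> points \<times> UNIV \<subseteq> coker ?a'"
  proof clarify
    fix x y assume "(x, y) \<in> (coker ?a \<union> m)\<^sup>*" "x \<in> points"
    then show "(x, y) \<in> coker ?a'"
    proof (induction rule: rtrancl_induct)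
      case base
      then show ?case
        using equiv_reflD[OF ek] by blast
    next
      case (step y z)
      then show ?case
        using coker(1,2) equiv_transD[OF ek] by blast
    qed
  qed
  then have closure: "x \<in> points \<Longrightarrow> (x, y) \<in> (coker ?a \<union> m)\<^sup>* \<Longrightarrow> (x, y) \<in> coker ?a'" for x y
    by blast
  have "act_fuse m Y = act_fuse (coker ?a') (sigma c')" if c': "represents ?a' c'" for c'
  proof -
    have "\<exists>z. (Up (c0 ! k), Lo z) \<in> block_edges ?a \<and> (z, c' ! k) \<in> (coker ?a \<union> m)\<^sup>*" if "k < r" for k
    proof -
      have "(Up (c0 ! k), Lo (c' ! k)) \<in> block_edges ?a'"
        using c' that by (simp add: represents_def)
      then show ?thesis
        using mult_fuse_Lo[OF eval_in_partitions m] by blast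
    qed
    then obtain f where f: "\<And>k. k < r \<Longrightarrow> (Up (c0 ! k), Lo (f k)) \<in> block_edges ?a"
        "\<And>k. k < r \<Longrightarrow> (f k, c' ! k) \<in> (coker ?a \<union> m)\<^sup>*"
      by metis
    have f_points: "f k \<in> points" if "k < r" for k
      using block_edges_in_vertices(2)[OF eval_in_partitions f(1)[OF that]] by simp
    have f_rel: "(f k, c' ! k) \<in> coker ?a'" if "k < r" for k
      using closure f_points f(2) that by blast
    have sep': "i = j" if "i < r" "j < r" "(Up (c0 ! i), Up (c0 ! j)) \<in> block_edges ?a'" for i j
      using c' that by (simp add: represents_def)
    have f_sep: "i = j" if ij: "i < r" "j < r" "(f i, f j) \<in> coker ?a'" for i j
    proof -
      have "(Up (c0 ! i), Lo (f i)) \<in> block_edges ?a'" "(Lo (f j), Up (c0 ! j)) \<in> block_edges ?a'"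
        using mult_fuse_left[OF eval_in_partitions m f(1)] ij block_edges_sym by blast+
      moreover have "(Lo (f i), Lo (f j)) \<in> block_edges ?a'"
        using ij(3) by (simp add: coker_def)
      ultimately have "(Up (c0 ! i), Up (c0 ! j)) \<in> block_edges ?a'"
        using block_edges_trans[OF mult_in_partitions] by blast
      then show ?thesis
        using sep' ij by blast
    qed
    let ?c = "map f [0..<r]"
    have "inj_on f {..<r}"
      using f_sep f_points equiv_reflD[OF ek] by (intro inj_onI) (metis lessThan_iff)
    then have c: "?c \<in> configs points r"
      using f_points by (auto simp: configs_def distinct_map atLeast0LessThan)
    have "represents ?a ?c"
      unfolding represents_def
    proof (intro conjI allI impI)
      show "i = j" if "i < r" "j < r" "(Up (c0 ! i), Up (c0 ! j)) \<in> block_edges ?a" for i j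
        using sep'[OF that(1,2)] mult_UpUp[OF eval_in_partitions that(3)] by blast
    qed (use c f(1) in auto)
    then have "Y = act_fuse (coker ?a) (sigma ?c)"
      using assms(1) by (simp add: normal_def)
    then have "act_fuse m Y = act_fuse m (act_fuse (coker ?a) (sigma ?c))"
      by (rule arg_cong)
    also have "\<dots> = act_fuse (coker ?a') (sigma ?c)"
      by (rule act_fuse_fuse[OF equiv_coker[OF eval_in_partitions] m ek coker])
    also have "\<dots> = act_fuse (coker ?a') (sigma c')"
    proof (rule act_fuse_sigma_cong[OF ek c])
      show "c' \<in> configs points r"
        using c' by (simp add: represents_def)
    qed (use f_rel f_sep in auto)
    finally show ?thesis .
  qed
  then show ?thesis
    unfolding normal_def eval using Y m by (simp add: act_closed)
qed

lemma normal_act: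
  assumes "normal Y" "p \<in> projs"
  shows "normal (act p Y)"
  unfolding act_decompose[OF assms(2)]
  using assms equiv_ker[OF projs_in_partitions[OF assms(2)]]
  by (intro normal_act_fuse normal_act_isolate)

lemma normal_fold_act: "normal Y \<Longrightarrow> set w \<subseteq> projs \<Longrightarrow> normal (fold act w Y)"
  by (induction w arbitrary: Y) (simp_all add: normal_act)

text \<open>Writing \<open>xq\<close> as \<open>act q (act P0 xq)\<close> lets normality spread from
  the base configuration along the letters of a word.\<close>

lemma xq_mult_normal:
  assumes "X \<in> carrier quot"
  shows "normal (xq \<cdot>\<^bsub>quot\<^esub> X)"
proof -
  obtain w where w: "w \<in> free_words projs" "X = cls w"
    using assms by (rule carrierE)
  then have "xq \<cdot>\<^bsub>quot\<^esub> X = fold act w (act q (act P0 xq))"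
    by (simp add: mult_eq_fold_act act_q_act_P0_xq)
  then show ?thesis
    using w(1) normal_sigma_c0 q by (simp add: free_words_iff normal_act normal_fold_act)
qed

section \<open>The maximal subgroup at \<open>x\<^sub>q\<close>\<close>

text \<open>Positions in lists are counted from 0, whereas permutations act on \<open>{1..r}\<close>.\<close>

definition reindex :: "(nat \<Rightarrow> nat) \<Rightarrow> 'v list \<Rightarrow> 'v list" where
  "reindex \<pi> d = map (\<lambda>k. d ! (\<pi> (Suc k) - 1)) [0..<r]"

lemma length_reindex [simp]: "length (reindex \<pi> d) = r"
  by (simp add: reindex_def)

lemma nth_reindex [simp]: "k < r \<Longrightarrow> reindex \<pi> d ! k = d ! (\<pi> (Suc k) - 1)"
  by (simp add: reindex_def)

lemma permutes_Suc:
  assumes "\<pi> permutes {1..r}" "k < r"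
  shows "\<pi> (Suc k) - 1 < r" "Suc (\<pi> (Suc k) - 1) = \<pi> (Suc k)"
  using permutes_in_image[OF assms(1), of "Suc k"] assms(2) by auto

lemma set_reindex:
  assumes "\<pi> permutes {1..r}" "length d = r"
  shows "set (reindex \<pi> d) = set d"
proof
  show "set (reindex \<pi> d) \<subseteq> set d"
    using permutes_Suc[OF assms(1)] assms(2) by (auto simp: reindex_def)
  show "set d \<subseteq> set (reindex \<pi> d)"
  proof
    fix x assume "x \<in> set d"
    then obtain m where m: "m < r" "x = d ! m"
      using assms(2) by (auto simp: in_set_conv_nth)
    define k where "k = inv' \<pi> (Suc m) - 1"
    have k: "k < r" "Suc k = inv' \<pi> (Suc m)"
      using permutes_Suc[OF permutes_inv[OF assms(1)] m(1)] by (simp_all add: k_def)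
    then have "reindex \<pi> d ! k = x"
      using m permutes_inverses(1)[OF assms(1)] by simp
    then show "x \<in> set (reindex \<pi> d)"
      using k(1) by (metis length_reindex nth_mem)
  qed
qed

lemma reindex_in_configs:
  assumes "\<pi> permutes {1..r}" "d \<in> configs V r"
  shows "reindex \<pi> d \<in> configs V r"
proof -
  have d: "distinct d" "set d \<subseteq> V" "length d = r"
    using assms(2) by (auto simp: configs_def)
  then have "card (set (reindex \<pi> d)) = length (reindex \<pi> d)"
    using assms(1) by (simp add: set_reindex distinct_card)
  then show ?thesis
    using d assms(1) by (simp add: configs_def set_reindex card_distinct)
qed

text \<open>Reindexing reverses composition; this is why \<open>perm_elem\<close> turns products
  around.\<close>

lemma reindex_reindex:
  assumes "\<pi> permutes {1..r}" "\<rho> permutes {1..r}"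
  shows "reindex \<pi> (reindex \<rho> d) = reindex (\<rho> \<circ> \<pi>) d"
  using permutes_Suc[OF assms(1)] by (intro nth_equalityI) simp_all

lemma reindex_update:
  assumes "\<pi> permutes {1..r}" "k < r" "length d = r"
  shows "reindex \<pi> (d[k := j]) = (reindex \<pi> d)[inv' \<pi> (Suc k) - 1 := j]"
proof (rule nth_equalityI)
  fix i assume "i < length (reindex \<pi> (d[k := j]))"
  then have i: "i < r"
    by simp
  have "\<pi> (Suc i) - 1 = k \<longleftrightarrow> i = inv' \<pi> (Suc k) - 1"
    using permutes_Suc[OF assms(1) i] permutes_Suc[OF permutes_inv[OF assms(1)] assms(2)]
      permutes_inv_eq[OF assms(1), of "Suc k" "Suc i"] by (metis diff_Suc_1 old.nat.inject)
  then show "reindex \<pi> (d[k := j]) ! i = (reindex \<pi> d)[inv' \<pi> (Suc k) - 1 := j] ! i"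
    using i permutes_Suc[OF assms(1) i] permutes_Suc(1)[OF permutes_inv[OF assms(1)] assms(2)] assms(2,3)
    by (auto simp: nth_list_update)
qed simp

section \<open>Elements realising the permutations\<close>

definition perm_elem :: "(nat \<Rightarrow> nat) \<Rightarrow> set_partition list set" where
  "perm_elem \<pi> = act_fuse (ker q) (sigma (reindex \<pi> c0))"

lemma equiv_ker_q: "equiv points (ker q)"
  by (simp add: equiv_ker)

lemma reindex_c0: "\<pi> permutes {1..r} \<Longrightarrow> reindex \<pi> c0 \<in> configs points r"
  using c0 by (rule reindex_in_configs[rotated])

lemma perm_elem_closed: "\<pi> permutes {1..r} \<Longrightarrow> perm_elem \<pi> \<in> carrier quot"
  by (simp add: perm_elem_def act_closed equiv_ker_q sigma_closed reindex_c0)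

lemma fuse_ker_q: "fuse (ker q) \<odot> q = q"
proof -
  let ?T = "fuse (ker q)" and ?P = "isolate (nontransversal q)"
  have T: "?T \<in> partitions n" "?T \<odot> ?T = ?T"
    using fuse_in_projs[OF equiv_ker_q] by (simp_all add: projs_iff)
  have "?T \<odot> (?T \<odot> ?P \<odot> ?T) = ?T \<odot> ?T \<odot> ?P \<odot> ?T"
    using T(1) by (simp add: mult_assoc)
  then show ?thesis
    unfolding T(2) by (simp flip: projs_decompose[OF q])
qed

lemma act_q_act_fuse_ker: "act q (act_fuse (ker q) X) = act q X"
  using act_mult[of "fuse (ker q)" q X] q equiv_ker_q by (simp add: fuse_ker_q)

text \<open>Left multiplication commutes with all slides, so both sides follow the moves of
  \<open>d\<close> and need comparison only at \<open>c0\<close>. There \<open>P0 q P0 = P0\<close>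
  applies, and \<open>P0\<close> fixes \<open>sigma ?c\<close> because reindexing keeps the set of
  occupied points.\<close>

lemma perm_elem_mult_sigma:
  assumes \<pi>: "\<pi> permutes {1..r}" and d: "d \<in> configs points r"
  shows "perm_elem \<pi> \<cdot>\<^bsub>quot\<^esub> sigma d = sigma (reindex \<pi> d)"
proof (rule sigma_induct[OF d, of "\<lambda>d. perm_elem \<pi> \<cdot>\<^bsub>quot\<^esub> sigma d = sigma (reindex \<pi> d)"])
  note closed = perm_elem_closed[OF \<pi>]
  let ?c = "reindex \<pi> c0"
  have fixed: "act P0 (sigma ?c) = sigma ?c"
    unfolding P0_def using sigma_isolate[OF reindex_c0[OF \<pi>]] set_reindex[OF \<pi> length_c0] by simp
  have "perm_elem \<pi> \<cdot>\<^bsub>quot\<^esub> sigma c0 = act P0 (act q (perm_elem \<pi>))"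
    using closed q by (simp add: sigma(2) mult_act) (simp add: xq_def act_eq_mult)
  also have "\<dots> = act P0 (act q (act P0 (sigma ?c)))"
    by (simp add: perm_elem_def act_q_act_fuse_ker fixed)
  also have "\<dots> = act P0 (sigma ?c)"
    using act_act_act[OF P0_in_projs q] by (simp add: P0_q_P0)
  finally show "perm_elem \<pi> \<cdot>\<^bsub>quot\<^esub> sigma c0 = sigma ?c"
    by (simp add: fixed)
  fix c k j assume c: "c \<in> configs points r" "k < r" "j \<in> points - set c"
    and IH: "perm_elem \<pi> \<cdot>\<^bsub>quot\<^esub> sigma c = sigma (reindex \<pi> c)"
  have len: "length c = r"
    using c by (simp add: configs_def)
  let ?k = "inv' \<pi> (Suc k) - 1"
  have k: "?k < r" "\<pi> (Suc ?k) = Suc k"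
    using permutes_Suc[OF permutes_inv[OF \<pi>] c(2)] permutes_inverses(1)[OF \<pi>, of "Suc k"] by simp_all
  have "perm_elem \<pi> \<cdot>\<^bsub>quot\<^esub> sigma (c[k := j]) = slide (c ! k) j (sigma (reindex \<pi> c))"
    using c config_nth[OF c(1,2)] closed
    by (simp add: sigma_update mult_slide sigma_closed IH)
  also have "c ! k = reindex \<pi> c ! ?k"
    using k by simp
  also have "slide (reindex \<pi> c ! ?k) j (sigma (reindex \<pi> c)) = sigma ((reindex \<pi> c)[?k := j])"
    using c(3) k(1) set_reindex[OF \<pi> len] reindex_in_configs[OF \<pi> c(1)] by (simp add: sigma_update)
  finally show "perm_elem \<pi> \<cdot>\<^bsub>quot\<^esub> sigma (c[k := j]) = sigma (reindex \<pi> (c[k := j]))"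
    using reindex_update[OF \<pi> c(2) len] by simp
qed

lemma perm_elem_mult:
  assumes "\<pi> permutes {1..r}" "\<rho> permutes {1..r}"
  shows "perm_elem \<pi> \<cdot>\<^bsub>quot\<^esub> perm_elem \<rho> = perm_elem (\<rho> \<circ> \<pi>)"
proof -
  have "perm_elem \<pi> \<cdot>\<^bsub>quot\<^esub> perm_elem \<rho> = act_fuse (ker q) (perm_elem \<pi> \<cdot>\<^bsub>quot\<^esub> sigma (reindex \<rho> c0))"
    using assms by (subst perm_elem_def[of \<rho>])
      (simp add: mult_act perm_elem_closed sigma_closed reindex_c0 equiv_ker_q)
  also have "perm_elem \<pi> \<cdot>\<^bsub>quot\<^esub> sigma (reindex \<rho> c0) = sigma (reindex (\<rho> \<circ> \<pi>) c0)"
    using assms by (simp add: perm_elem_mult_sigma reindex_c0 reindex_reindex)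
  finally show ?thesis
    by (simp add: perm_elem_def)
qed

lemma eval_xq: "eval_class xq = q"
  by (simp add: xq_def eval_gen q)

lemma xq_xq: "xq \<cdot>\<^bsub>quot\<^esub> xq = xq"
proof -
  have "xq \<cdot>\<^bsub>quot\<^esub> cls [q] = act q xq"
    by (simp add: act_eq_mult q)
  also have "\<dots> = xq"
    by (simp add: xq_def cls_gen q)
  finally show ?thesis
    by (simp add: xq_def)
qed

text \<open>Read off from the normal form of \<open>xq\<close>, with \<open>c0\<close> as
  representing configuration.\<close>

lemma perm_elem_id: "perm_elem id = xq"
proof -
  have "reindex id c0 = c0"
    using length_c0 by (intro nth_equalityI) simp_all
  moreover have "represents q c0"
    using c0 c0_transversal c0_separated by (auto simp: represents_def)
  ultimately show ?thesis
    using xq_mult_normal[OF xq_closed] by (simp add: xq_xq normal_def eval_xq coker_proj q perm_elem_def)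
qed

lemma eval_sigma:
  assumes "c \<in> configs points r" "k < r"
  shows "(Up (c0 ! k), Lo (c ! k)) \<in> block_edges (eval_class (sigma c))"
proof -
  have "\<forall>k<r. (Up (c0 ! k), Lo (c ! k)) \<in> block_edges (eval_class (sigma c))"
  proof (rule sigma_induct[OF assms(1), of "\<lambda>c. \<forall>k<r. (Up (c0 ! k), Lo (c ! k)) \<in> block_edges (eval_class (sigma c))"])
    have "eval_class (sigma c0) = q \<odot> P0"
      using q by (simp add: sigma eval_act eval_xq)
    then show "\<forall>k<r. (Up (c0 ! k), Lo (c0 ! k)) \<in> block_edges (eval_class (sigma c0))"
      using c0_transversal length_c0 by (auto simp: P0_def mult_isolate)
  next
    fix c k j
    assume c: "c \<in> configs points r" "k < r" "j \<in> points - set c"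
      and IH: "\<forall>m<r. (Up (c0 ! m), Lo (c ! m)) \<in> block_edges (eval_class (sigma c))"
    let ?t = "clump {c ! k, j}"
    let ?b = "eval_class (sigma c) \<odot> fuse ?t"
    have len: "length c = r" "distinct c"
      using c by (auto simp: configs_def)
    have ck: "c ! k \<in> points" "c ! k \<noteq> j"
      using c config_nth nth_mem len by auto
    have t: "equiv points ?t"
      using ck c by (simp add: equiv_clump)
    have eval: "eval_class (sigma (c[k := j])) = ?b \<odot> isolate {c ! k}"
      using c t by (simp add: sigma_update slide_def eval_act act_closed sigma_closed)
    have b: "(Up (c0 ! m), Lo (c ! m)) \<in> block_edges ?b" if "m < r" for m
      using mult_fuse_left[OF eval_in_partitions t] IH that by blast
    have "(Lo (c ! k), Lo j) \<in> block_edges ?b"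
      by (rule mult_fuse_right[OF t]) (simp add: clump_iff)
    then have b_k: "(Up (c0 ! k), Lo j) \<in> block_edges ?b"
      using b[OF c(2)] block_edges_trans[OF mult_in_partitions] by blast
    show "\<forall>m<r. (Up (c0 ! m), Lo (c[k := j] ! m)) \<in> block_edges (eval_class (sigma (c[k := j])))"
    proof (intro allI impI)
      fix m assume m: "m < r"
      show "(Up (c0 ! m), Lo (c[k := j] ! m)) \<in> block_edges (eval_class (sigma (c[k := j])))"
      proof (cases "m = k")
        case True
        then show ?thesis
          unfolding eval using b_k ck len m by (auto simp: mult_isolate)
      next
        case False
        then have "c ! m \<noteq> c ! k"
          using len m c(2) by (simp add: nth_eq_iff_index_eq)
        then show ?thesis
          unfolding eval using b[OF m] False by (auto simp: mult_isolate)
      qed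
    qed
  qed
  then show ?thesis
    using assms(2) by blast
qed

lemma eval_perm_elem:
  assumes "\<pi> permutes {1..r}" "k < r"
  shows "(Up (c0 ! k), Lo (c0 ! (\<pi> (Suc k) - 1))) \<in> block_edges (eval_class (perm_elem \<pi>))"
  using eval_sigma[OF reindex_c0[OF assms(1)] assms(2)] assms
    mult_fuse_left[OF eval_in_partitions equiv_ker_q]
  by (simp add: perm_elem_def eval_act equiv_ker_q sigma_closed reindex_c0)

lemma perm_elem_inverse:
  assumes "\<pi> permutes {1..r}"
  shows "perm_elem \<pi> \<cdot>\<^bsub>quot\<^esub> perm_elem (inv' \<pi>) = xq" "perm_elem (inv' \<pi>) \<cdot>\<^bsub>quot\<^esub> perm_elem \<pi> = xq"
  using assms permutes_inv[OF assms] by (simp_all add: perm_elem_mult permutes_inv_o perm_elem_id)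

lemma perm_elem_inject:
  assumes \<pi>: "\<pi> permutes {1..r}" and \<rho>: "\<rho> permutes {1..r}" and eq: "perm_elem \<pi> = perm_elem \<rho>"
  shows "\<pi> = \<rho>"
proof
  fix m
  show "\<pi> m = \<rho> m"
  proof (cases "m \<in> {1..r}")
    case False
    then show ?thesis
      using \<pi> \<rho> by (metis permutes_not_in)
  next
    case True
    then obtain k where k: "k < r" "m = Suc k"
      by (cases m) auto
    let ?a = "eval_class (perm_elem \<pi>)"
    let ?i = "\<pi> m - 1" and ?j = "\<rho> m - 1"
    have ij: "?i < r" "Suc ?i = \<pi> m" "?j < r" "Suc ?j = \<rho> m"
      using permutes_Suc[OF \<pi> k(1)] permutes_Suc[OF \<rho> k(1)] k(2) by auto
    have "(Up (c0 ! k), Lo (c0 ! ?i)) \<in> block_edges ?a" "(Up (c0 ! k), Lo (c0 ! ?j)) \<in> block_edges ?a"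
      using eval_perm_elem[OF \<pi> k(1)] eval_perm_elem[OF \<rho> k(1)] eq k(2) by simp_all
    then have "(Lo (c0 ! ?i), Lo (c0 ! ?j)) \<in> block_edges ?a"
      using block_edges_trans[OF eval_in_partitions block_edges_sym] by blast
    \<comment> \<open>Left multiplication preserves lower connections, so multiplying by the inverse
      carries this one into \<open>q\<close>, where the points of \<open>c0\<close> are
      separated.\<close>
    then have "(Lo (c0 ! ?i), Lo (c0 ! ?j)) \<in> block_edges (eval_class (perm_elem (inv' \<pi>)) \<odot> ?a)"
      by (intro mult_LoLo) simp_all
    also have "eval_class (perm_elem (inv' \<pi>)) \<odot> ?a = q"
      using perm_elem_inverse(2)[OF \<pi>] perm_elem_closed[OF \<pi>] perm_elem_closed[OF permutes_inv[OF \<pi>]]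
      by (simp add: eval_xq flip: eval_mult)
    finally have "?i = ?j"
      using q_up[of "Lo (c0 ! ?i)" "Lo (c0 ! ?j)"] c0_separated ij by simp
    then show ?thesis
      using ij by metis
  qed
qed

text \<open>The two one-sided inverses do different work. \<open>Z\<close> shows that
  \<open>Y\<close> keeps the \<open>r\<close> transversals alive and separate; \<open>Z'\<close>,
  together with \<open>Y xq = Y\<close>, forces the lower kernel of \<open>Y\<close> to be that of
  \<open>q\<close>. The normal form then leaves only the permutation.\<close>

lemma unit_is_perm_elem:
  assumes Y: "Y \<in> carrier quot" and Z: "Z \<in> carrier quot" and Z': "Z' \<in> carrier quot"
    and "xq \<cdot>\<^bsub>quot\<^esub> Y = Y" "Y \<cdot>\<^bsub>quot\<^esub> xq = Y" "Y \<cdot>\<^bsub>quot\<^esub> Z = xq" "Z' \<cdot>\<^bsub>quot\<^esub> Y = xq"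
  shows "\<exists>\<pi>. \<pi> permutes {1..r} \<and> Y = perm_elem \<pi>"
proof -
  define a where "a = eval_class Y"
  have a [simp]: "a \<in> partitions n"
    by (simp add: a_def)
  have aq: "a \<odot> q = a" and ab: "a \<odot> eval_class Z = q" and ba: "eval_class Z' \<odot> a = q"
    using eval_mult[OF Y xq_closed, symmetric] eval_mult[OF Y Z, symmetric] eval_mult[OF Z' Y, symmetric]
    unfolding assms(5-7) eval_xq a_def .
  have sep: "i = j" if "i < r" "j < r" "(Up (c0 ! i), Up (c0 ! j)) \<in> block_edges a" for i j
    using mult_UpUp[OF a that(3), of "eval_class Z"] c0_separated[OF that(1,2)] by (simp add: ab)
  have "\<exists>j<r. (Up (c0 ! k), Lo (c0 ! j)) \<in> block_edges a" if k: "k < r" for k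
  proof -
    have "(Up (c0 ! k), Lo (c0 ! k)) \<in> block_edges (a \<odot> eval_class Z)"
      using c0_transversal[OF k] by (simp add: ab)
    then obtain z where z: "(Up (c0 ! k), Lo z) \<in> block_edges a"
      using mult_UpLo_left[OF a] by blast
    then have "(Up (c0 ! k), Lo z) \<in> block_edges (a \<odot> q)"
      by (simp add: aq)
    \<comment> \<open>As \<open>a = a q\<close>, the end \<open>z\<close> lies on a transversal of
      \<open>q\<close>. Its lower part contains a point of \<open>c0\<close> and is contained in one
      lower class of \<open>a\<close>, so the end can be chosen in \<open>c0\<close>.\<close>
    then obtain w where w: "(Up w, Lo z) \<in> block_edges q"
      using mult_UpLo_right[OF a q_in_partitions] by blast
    then obtain j where j: "j < r" "(Up w, Up (c0 ! j)) \<in> block_edges q"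
      using c0_cover by blast
    have "(Up w, Lo (c0 ! j)) \<in> block_edges q"
      using block_edges_trans[OF q_in_partitions j(2) c0_transversal[OF j(1)]] .
    then have "(Lo z, Lo (c0 ! j)) \<in> block_edges q"
      using block_edges_trans[OF q_in_partitions block_edges_sym[OF w]] by blast
    then have "(Lo z, Lo (c0 ! j)) \<in> block_edges a"
      using mult_LoLo[OF q_in_partitions, of z "c0 ! j" a] by (simp add: aq)
    then show ?thesis
      using block_edges_trans[OF a z] j(1) by blast
  qed
  then obtain f where f: "\<And>k. k < r \<Longrightarrow> f k < r" "\<And>k. k < r \<Longrightarrow> (Up (c0 ! k), Lo (c0 ! f k)) \<in> block_edges a"
    by metis
  have f_inj: "i = j" if "i < r" "j < r" "f i = f j" for i j
    using block_edges_trans[OF a f(2)[OF that(1)], of "Up (c0 ! j)"] block_edges_sym[OF f(2)[OF that(2)]]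
      sep[OF that(1,2)] that(3) by simp
  define \<pi> where "\<pi> m = (if m \<in> {1..r} then Suc (f (m - 1)) else m)" for m
  have "\<pi> permutes {1..r}"
  proof (rule bij_imp_permutes)
    have "inj_on \<pi> {1..r}"
    proof (rule inj_onI)
      fix x y assume xy: "x \<in> {1..r}" "y \<in> {1..r}" "\<pi> x = \<pi> y"
      then have "x - 1 < r" "y - 1 < r" "f (x - 1) = f (y - 1)"
        by (auto simp: \<pi>_def)
      then have "x - 1 = y - 1"
        by (rule f_inj)
      then show "x = y"
        using xy by auto
    qed
    moreover have "\<pi> ` {1..r} \<subseteq> {1..r}"
    proof (rule image_subsetI)
      fix m assume m: "m \<in> {1..r}"
      then have "f (m - 1) < r"
        by (intro f(1)) auto
      then show "\<pi> m \<in> {1..r}"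
        using m by (simp add: \<pi>_def)
    qed
    ultimately show "bij_betw \<pi> {1..r} {1..r}"
      by (simp add: bij_betw_def endo_inj_surj)
  qed (auto simp: \<pi>_def)
  have "represents a (reindex \<pi> c0)"
    unfolding represents_def
    using reindex_c0[OF \<open>\<pi> permutes {1..r}\<close>] f(2) sep by (auto simp: \<pi>_def)
  moreover have "coker a = ker q"
  proof -
    have "coker a \<subseteq> coker (eval_class Z' \<odot> a)" "coker q \<subseteq> coker (a \<odot> q)"
      using mult_LoLo[OF a] mult_LoLo[OF q_in_partitions] by (auto simp: coker_def)
    then show ?thesis
      by (simp add: aq ba coker_proj q)
  qed
  ultimately have "Y = perm_elem \<pi>"
    using xq_mult_normal[OF Y] by (simp add: assms(4) normal_def perm_elem_def flip: a_def)
  then show ?thesis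
    using \<open>\<pi> permutes {1..r}\<close> by blast
qed

end

section \<open>Green's relation H in a presented semigroup\<close>

context presentation
begin

lemma left_ideal_mult_subset:
  assumes "s \<in> carrier quot" "Y \<in> carrier quot"
  shows "left_ideal quot (s \<cdot>\<^bsub>quot\<^esub> Y) \<subseteq> left_ideal quot Y"
proof
  fix z assume "z \<in> left_ideal quot (s \<cdot>\<^bsub>quot\<^esub> Y)"
  then consider "z = s \<cdot>\<^bsub>quot\<^esub> Y" | t where "t \<in> carrier quot" "z = t \<cdot>\<^bsub>quot\<^esub> (s \<cdot>\<^bsub>quot\<^esub> Y)"
    by (auto simp: left_ideal_def)
  then show "z \<in> left_ideal quot Y"
  proof cases
    case 1
    then show ?thesis
      using assms(1) by (auto simp: left_ideal_def)
  next
    case 2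
    then have "z = t \<cdot>\<^bsub>quot\<^esub> s \<cdot>\<^bsub>quot\<^esub> Y"
      using assms by (simp add: mult_quot_assoc)
    then show ?thesis
      using mult_quot_closed[OF 2(1) assms(1)] unfolding left_ideal_def by blast
  qed
qed

lemma right_ideal_mult_subset:
  assumes "s \<in> carrier quot" "Y \<in> carrier quot"
  shows "right_ideal quot (Y \<cdot>\<^bsub>quot\<^esub> s) \<subseteq> right_ideal quot Y"
proof
  fix z assume "z \<in> right_ideal quot (Y \<cdot>\<^bsub>quot\<^esub> s)"
  then consider "z = Y \<cdot>\<^bsub>quot\<^esub> s" | t where "t \<in> carrier quot" "z = Y \<cdot>\<^bsub>quot\<^esub> s \<cdot>\<^bsub>quot\<^esub> t"
    by (auto simp: right_ideal_def)
  then show "z \<in> right_ideal quot Y"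
  proof cases
    case 1
    then show ?thesis
      using assms(1) by (auto simp: right_ideal_def)
  next
    case 2
    then have "z = Y \<cdot>\<^bsub>quot\<^esub> (s \<cdot>\<^bsub>quot\<^esub> t)"
      using assms by (simp add: mult_quot_assoc)
    then show ?thesis
      using mult_quot_closed[OF assms(1) 2(1)] unfolding right_ideal_def by blast
  qed
qed

lemma H_class_quotI:
  assumes "X \<in> carrier quot" "Y \<in> carrier quot" "E \<in> carrier quot"
    and "X \<cdot>\<^bsub>quot\<^esub> E = X" "E \<cdot>\<^bsub>quot\<^esub> X = X" "X \<cdot>\<^bsub>quot\<^esub> Y = E" "Y \<cdot>\<^bsub>quot\<^esub> X = E"
  shows "X \<in> H_class quot E"
  using left_ideal_mult_subset[OF assms(1,3)] left_ideal_mult_subset[OF assms(2,1)]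
    right_ideal_mult_subset[OF assms(1,3)] right_ideal_mult_subset[OF assms(2,1)] assms
  by (simp add: H_class_def subset_antisym)

lemma H_class_quotD:
  assumes X: "X \<in> H_class quot E" and E: "E \<in> carrier quot" "E \<cdot>\<^bsub>quot\<^esub> E = E"
  shows "X \<in> carrier quot" "X \<cdot>\<^bsub>quot\<^esub> E = X" "E \<cdot>\<^bsub>quot\<^esub> X = X"
    and "\<exists>s \<in> carrier quot. s \<cdot>\<^bsub>quot\<^esub> X = E" "\<exists>s \<in> carrier quot. X \<cdot>\<^bsub>quot\<^esub> s = E"
proof -
  show "X \<in> carrier quot"
    using X by (simp add: H_class_def)
  have ideals: "left_ideal quot X = left_ideal quot E" "right_ideal quot X = right_ideal quot E"
    using X by (simp_all add: H_class_def)
  have "X \<in> left_ideal quot E" "X \<in> right_ideal quot E"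
    unfolding ideals[symmetric] by (simp_all add: left_ideal_def right_ideal_def)
  then consider "X = E" | s where "s \<in> carrier quot" "X = s \<cdot>\<^bsub>quot\<^esub> E"
    by (auto simp: left_ideal_def)
  then show XE: "X \<cdot>\<^bsub>quot\<^esub> E = X"
    by cases (simp_all add: E mult_quot_assoc)
  from \<open>X \<in> right_ideal quot E\<close> consider "X = E" | s where "s \<in> carrier quot" "X = E \<cdot>\<^bsub>quot\<^esub> s"
    by (auto simp: right_ideal_def)
  then show EX: "E \<cdot>\<^bsub>quot\<^esub> X = X"
    by cases (simp_all add: E flip: mult_quot_assoc)
  have "E \<in> left_ideal quot X" "E \<in> right_ideal quot X"
    unfolding ideals by (simp_all add: left_ideal_def right_ideal_def)
  then have "E = X \<or> (\<exists>s \<in> carrier quot. E = s \<cdot>\<^bsub>quot\<^esub> X)" "E = X \<or> (\<exists>s \<in> carrier quot. E = X \<cdot>\<^bsub>quot\<^esub> s)"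
    by (auto simp: left_ideal_def right_ideal_def)
  then show "\<exists>s \<in> carrier quot. s \<cdot>\<^bsub>quot\<^esub> X = E" "\<exists>s \<in> carrier quot. X \<cdot>\<^bsub>quot\<^esub> s = E"
    using E by metis+
qed

end

section \<open>Transfer from the projection to the idempotent\<close>

context transversals
begin

text \<open>From \<open>q p q = q\<close> follow \<epsilon> \<open>xq\<close> = \<open>xq\<close>
  and \<open>xq\<close> \<epsilon> = \<epsilon>. Right multiplications by \<epsilon> and by
  \<open>xq\<close> are then mutually inverse between the two H-classes, which moves the description
  of units at \<open>xq\<close> to \<epsilon>.\<close>

lemma maximal_subgroup_iso_sym_group:
  assumes p: "p \<in> projs" and qpq: "q \<odot> p \<odot> q = q"
  defines "\<epsilon> \<equiv> xq \<cdot>\<^bsub>quot\<^esub> cls [p]"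
  shows "group (maximal_subgroup quot \<epsilon>) \<and> maximal_subgroup quot \<epsilon> \<cong> sym_group r"
proof -
  let ?G = "maximal_subgroup quot \<epsilon>"
  have \<epsilon> [simp]: "\<epsilon> \<in> carrier quot"
    using p by (simp add: \<epsilon>_def mult_quot_closed)
  have \<epsilon>_xq: "\<epsilon> \<cdot>\<^bsub>quot\<^esub> xq = xq"
  proof -
    have "\<epsilon> \<cdot>\<^bsub>quot\<^esub> xq = act q (act p xq)"
      using p q by (simp add: \<epsilon>_def act_eq_mult mult_quot_closed) (simp add: xq_def)
    also have "\<dots> = xq"
      using act_act_act[OF q p] by (simp add: xq_def cls_gen qpq)
    finally show ?thesis .
  qed
  have xq_\<epsilon>: "xq \<cdot>\<^bsub>quot\<^esub> \<epsilon> = \<epsilon>"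
    using p mult_quot_assoc[of xq xq "cls [p]"] by (simp add: \<epsilon>_def xq_xq)
  have \<epsilon>_\<epsilon>: "\<epsilon> \<cdot>\<^bsub>quot\<^esub> \<epsilon> = \<epsilon>"
    using mult_quot_assoc[of \<epsilon> xq \<epsilon>] by (simp add: \<epsilon>_xq xq_\<epsilon>)
  \<comment> \<open>\<open>perm_elem\<close> reverses products, hence the inverse.\<close>
  define F where "F \<pi> = perm_elem (inv' \<pi>) \<cdot>\<^bsub>quot\<^esub> \<epsilon>" for \<pi>
  have xq_perm: "xq \<cdot>\<^bsub>quot\<^esub> perm_elem \<pi> = perm_elem \<pi>" "perm_elem \<pi> \<cdot>\<^bsub>quot\<^esub> xq = perm_elem \<pi>"
    if "\<pi> permutes {1..r}" for \<pi>
    using perm_elem_mult[OF permutes_id that] perm_elem_mult[OF that permutes_id]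
    by (simp_all add: perm_elem_id)
  have F_closed: "F \<pi> \<in> carrier quot" if "\<pi> permutes {1..r}" for \<pi>
    using that by (simp add: F_def mult_quot_closed perm_elem_closed permutes_inv)
  have \<epsilon>_perm: "\<epsilon> \<cdot>\<^bsub>quot\<^esub> perm_elem \<pi> = perm_elem \<pi>" if "\<pi> permutes {1..r}" for \<pi>
    using mult_quot_assoc[of \<epsilon> xq "perm_elem \<pi>"] that by (simp add: \<epsilon>_xq xq_perm perm_elem_closed)
  have F_mult: "F \<pi> \<cdot>\<^bsub>quot\<^esub> F \<rho> = F (\<pi> \<circ> \<rho>)" if \<pi>: "\<pi> permutes {1..r}" and \<rho>: "\<rho> permutes {1..r}" for \<pi> \<rho>
  proof -
    let ?a = "perm_elem (inv' \<pi>)" and ?b = "perm_elem (inv' \<rho>)"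
    have mem: "?a \<in> carrier quot" "?b \<in> carrier quot"
      using \<pi> \<rho> by (simp_all add: perm_elem_closed permutes_inv)
    have "F \<pi> \<cdot>\<^bsub>quot\<^esub> F \<rho> = ?a \<cdot>\<^bsub>quot\<^esub> (\<epsilon> \<cdot>\<^bsub>quot\<^esub> ?b) \<cdot>\<^bsub>quot\<^esub> \<epsilon>"
      using mem by (simp add: F_def mult_quot_assoc mult_quot_closed)
    also have "\<dots> = ?a \<cdot>\<^bsub>quot\<^esub> ?b \<cdot>\<^bsub>quot\<^esub> \<epsilon>"
      using \<rho> by (simp add: \<epsilon>_perm permutes_inv)
    also have "?a \<cdot>\<^bsub>quot\<^esub> ?b = perm_elem (inv' (\<pi> \<circ> \<rho>))"
      using \<pi> \<rho> by (simp add: perm_elem_mult permutes_inv o_inv_distrib permutes_bij)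
    finally show ?thesis
      by (simp add: F_def)
  qed
  have F_id: "F id = \<epsilon>"
    by (simp add: F_def perm_elem_id xq_\<epsilon> inv_id)
  have F_xq: "F \<pi> \<cdot>\<^bsub>quot\<^esub> xq = perm_elem (inv' \<pi>)" if "\<pi> permutes {1..r}" for \<pi>
    using that by (simp add: F_def mult_quot_assoc perm_elem_closed permutes_inv \<epsilon>_xq xq_perm)
  have F_H: "F \<pi> \<in> H_class quot \<epsilon>" if \<pi>: "\<pi> permutes {1..r}" for \<pi>
  proof -
    let ?X = "F \<pi>" and ?Y = "F (inv' \<pi>)"
    have inv: "inv' \<pi> permutes {1..r}"
      using \<pi> by (rule permutes_inv)
    have XY: "?X \<cdot>\<^bsub>quot\<^esub> ?Y = \<epsilon>" "?Y \<cdot>\<^bsub>quot\<^esub> ?X = \<epsilon>"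
      using \<pi> inv by (simp_all add: F_mult permutes_inv_o F_id)
    have X\<epsilon>: "?X \<cdot>\<^bsub>quot\<^esub> \<epsilon> = ?X" "\<epsilon> \<cdot>\<^bsub>quot\<^esub> ?X = ?X"
      using F_mult[OF \<pi> permutes_id] F_mult[OF permutes_id \<pi>] by (simp_all add: F_id)
    note mem = F_closed[OF \<pi>] F_closed[OF inv]
    show ?thesis
      using mem XY X\<epsilon> by (intro H_class_quotI[of _ ?Y]) simp_all
  qed
  have H_F: "\<exists>\<pi>. \<pi> permutes {1..r} \<and> X = F \<pi>" if X: "X \<in> H_class quot \<epsilon>" for X
  proof -
    note X' = H_class_quotD[OF X \<epsilon> \<epsilon>_\<epsilon>]
    have X_mem [simp]: "X \<in> carrier quot" and X\<epsilon>: "X \<cdot>\<^bsub>quot\<^esub> \<epsilon> = X" "\<epsilon> \<cdot>\<^bsub>quot\<^esub> X = X"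
      using X' by simp_all
    obtain s t where st: "s \<in> carrier quot" "s \<cdot>\<^bsub>quot\<^esub> X = \<epsilon>" "t \<in> carrier quot" "X \<cdot>\<^bsub>quot\<^esub> t = \<epsilon>"
      using X'(4,5) by blast
    let ?Y = "X \<cdot>\<^bsub>quot\<^esub> xq"
    have Y_\<epsilon>: "?Y \<cdot>\<^bsub>quot\<^esub> \<epsilon> = X"
      by (simp add: mult_quot_assoc xq_\<epsilon> X\<epsilon>)
    have "\<exists>\<pi>. \<pi> permutes {1..r} \<and> ?Y = perm_elem \<pi>"
    proof (rule unit_is_perm_elem)
      show "?Y \<cdot>\<^bsub>quot\<^esub> xq = ?Y"
        by (simp add: mult_quot_assoc xq_xq)
      have "xq \<cdot>\<^bsub>quot\<^esub> X = X"
        using mult_quot_assoc[of xq \<epsilon> X] by (simp add: xq_\<epsilon> X\<epsilon>)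
      then show "xq \<cdot>\<^bsub>quot\<^esub> ?Y = ?Y"
        using mult_quot_assoc[of xq X xq] by simp
      show "s \<cdot>\<^bsub>quot\<^esub> ?Y = xq"
        using st mult_quot_assoc[of s X xq] by (simp add: \<epsilon>_xq)
      \<comment> \<open>The right inverse of X is pulled back along the transfer: \<open>?Y\<close>
        \<epsilon> = X and X t = \<epsilon>, and finally \<epsilon> \<open>xq\<close> =
        \<open>xq\<close>.\<close>
      show "?Y \<cdot>\<^bsub>quot\<^esub> (\<epsilon> \<cdot>\<^bsub>quot\<^esub> t \<cdot>\<^bsub>quot\<^esub> xq) = xq"
        using st mult_quot_assoc[of ?Y "\<epsilon> \<cdot>\<^bsub>quot\<^esub> t" xq] mult_quot_assoc[of ?Y \<epsilon> t]
        by (simp add: mult_quot_closed Y_\<epsilon> \<epsilon>_xq)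
    qed (use st in \<open>simp_all add: mult_quot_closed\<close>)
    then obtain \<pi> where \<pi>: "\<pi> permutes {1..r}" "?Y = perm_elem \<pi>"
      by blast
    then have "X = F (inv' \<pi>)"
      using Y_\<epsilon> by (simp add: F_def permutes_inv_inv)
    then show ?thesis
      using permutes_inv[OF \<pi>(1)] by blast
  qed
  have iso: "F \<in> iso (sym_group r) ?G"
  proof -
    have "inj_on F {\<pi>. \<pi> permutes {1..r}}"
    proof (rule inj_onI)
      fix \<pi> \<rho> assume "\<pi> \<in> {\<pi>. \<pi> permutes {1..r}}" "\<rho> \<in> {\<pi>. \<pi> permutes {1..r}}" and eq: "F \<pi> = F \<rho>"
      then have perm: "\<pi> permutes {1..r}" "\<rho> permutes {1..r}"
        by auto
      then have "perm_elem (inv' \<pi>) = perm_elem (inv' \<rho>)"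
        using F_xq eq by metis
      then have "inv' \<pi> = inv' \<rho>"
        using perm permutes_inv perm_elem_inject by blast
      then show "\<pi> = \<rho>"
        using perm permutes_inv_inv by metis
    qed
    moreover have "F ` {\<pi>. \<pi> permutes {1..r}} = H_class quot \<epsilon>"
      using F_H H_F by blast
    ultimately show ?thesis
      using F_mult by (auto simp: iso_def hom_def sym_group_def maximal_subgroup_def bij_betw_def)
  qed
  interpret sym: group "sym_group r"
    by (rule sym_group_is_group)
  \<comment> \<open>Transport along an isomorphism names the image of the unit as the new unit;
    \<open>F_id\<close> identifies it with \<epsilon>.\<close>
  have "group (?G\<lparr>one := F \<one>\<^bsub>sym_group r\<^esub>\<rparr>)"
    by (rule sym.iso_imp_img_group[OF iso])
  moreover have "?G\<lparr>one := F \<one>\<^bsub>sym_group r\<^esub>\<rparr> = ?G"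
    by (simp add: sym_group_def maximal_subgroup_def F_id)
  ultimately have "group ?G"
    by simp
  then show ?thesis
    using sym.iso_sym[OF is_isoI[OF iso]] by simp
qed

end

section \<open>The transversals of \<open>e\<close> and of its left projection\<close>

context partition_degree
begin

text \<open>The transversals of the product come from those of \<open>e\<close>: from an upper point
  go down to a lower point of its block and return through the reflected copy. So \<open>c0\<close>
  takes one upper point \<open>f B\<close> from each transversal block \<open>B\<close> of
  \<open>e\<close>, and \<open>mult_star_fold\<close> shows that they stay separate.\<close>

lemma transversals_mult_star:
  assumes e: "e \<in> partitions n" and rank: "partition_rank n e = r" and "r + 2 \<le> n"
  shows "\<exists>c0. transversals n (e \<odot> partition_star e) c0 r"
proof -
  let ?q = "e \<odot> partition_star e"
  define \<T> where "\<T> = {B \<in> e. B \<inter> upper n \<noteq> {} \<and> B \<inter> lower n \<noteq> {}}"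
  have part: "partition_on vertices e"
    using e by (simp add: partitions_def vertices_def)
  have "finite vertices"
    by (simp add: vertices_def upper_def lower_def)
  then have "finite e"
    using part by (rule finite_elements)
  then obtain ts where ts: "set ts = \<T>" "distinct ts"
    using finite_distinct_list[of \<T>] by (auto simp: \<T>_def)
  have len: "length ts = r"
    using ts rank distinct_card[OF ts(2)] by (simp add: partition_rank_def \<T>_def)
  have block: "y \<in> B" if "B \<in> e" "x \<in> B" "(x, y) \<in> block_edges e" for B x y
    using that partition_onD2[OF part] by (auto simp: block_edges_def disjoint_def)
  have "\<exists>x. Up x \<in> B" "\<exists>y. Lo y \<in> B" if "B \<in> \<T>" for B
    using that by (auto simp: \<T>_def upper_def lower_def)
  then obtain f where f: "\<And>B. B \<in> \<T> \<Longrightarrow> Up (f B) \<in> B"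
    by metis
  have Lo: "\<exists>y. Lo y \<in> B" if "B \<in> \<T>" for B
    using that by (auto simp: \<T>_def upper_def lower_def)
  have same: "(x, y) \<in> block_edges e" if "B \<in> \<T>" "x \<in> B" "y \<in> B" for B x y
    using that by (auto simp: block_edges_def \<T>_def)
  have f_inj: "B = C" if "B \<in> \<T>" "C \<in> \<T>" "(Up (f B), Up (f C)) \<in> block_edges e" for B C
  proof -
    have "B \<in> e" "C \<in> e"
      using that(1,2) by (auto simp: \<T>_def)
    moreover have "Up (f C) \<in> B \<inter> C"
      using block[OF \<open>B \<in> e\<close> f[OF that(1)] that(3)] f[OF that(2)] by blast
    ultimately show ?thesis
      using partition_onD2[OF part] by (auto simp: disjoint_def)
  qed
  have f_points: "f B \<in> points" if "B \<in> \<T>" for B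
    using block_edges_in_vertices(1)[OF e same[OF that f[OF that] f[OF that]]] by simp
  have ts_nth: "ts ! k \<in> \<T>" if "k < r" for k
    using that ts(1) len nth_mem by blast
  have "transversals n ?q (map f ts) r"
  proof
    have "?q \<odot> ?q = e \<odot> partition_star e \<odot> e \<odot> partition_star e"
      using e by (simp add: mult_assoc)
    then show "?q \<in> projs"
      using e by (simp add: projs_iff star_mult mult_star_mult)
    have "inj_on f \<T>"
      using f_inj f_points block_edges_refl[OF e] by (intro inj_onI) (metis vertices_simps(1))
    then show "map f ts \<in> configs points r"
      using ts len f_points by (auto simp: configs_def distinct_map)
    show "(Up (map f ts ! k), Lo (map f ts ! k)) \<in> block_edges ?q" if k: "k < r" for k
    proof -
      obtain y where "Lo y \<in> ts ! k"
        using Lo[OF ts_nth[OF k]] by blast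
      then have "(Up (f (ts ! k)), Lo y) \<in> block_edges e"
        using same[OF ts_nth[OF k] f[OF ts_nth[OF k]]] by blast
      then show ?thesis
        using k len e block_edges_sym
        by (intro mult_UpLo[where z = y]) (auto simp: block_edges_star)
    qed
    show "i = j" if ij: "i < r" "j < r" "(Up (map f ts ! i), Up (map f ts ! j)) \<in> block_edges ?q" for i j
    proof -
      have "(Up (f (ts ! i)), Up (f (ts ! j))) \<in> block_edges e"
        using mult_star_fold[OF e ij(3)] ij(1,2) len by simp
      then have "ts ! i = ts ! j"
        using f_inj ts_nth ij by blast
      then show ?thesis
        using ts(2) ij len by (simp add: nth_eq_iff_index_eq)
    qed
    show "\<exists>k<r. (Up x, Up (map f ts ! k)) \<in> block_edges ?q" if xy: "(Up x, Lo y) \<in> block_edges ?q" for x y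
    proof -
      obtain z where z: "(Up x, Lo z) \<in> block_edges e"
        using mult_UpLo_left[OF e xy] by blast
      then obtain B where B: "B \<in> e" "Up x \<in> B" "Lo z \<in> B"
        by (auto simp: block_edges_def)
      then have "B \<in> \<T>"
        using block_edges_in_vertices[OF e z] by (auto simp: \<T>_def points_def upper_def lower_def)
      then obtain k where k: "k < r" "B = ts ! k"
        using ts(1) len by (metis in_set_conv_nth)
      have "(Up x, Up (f B)) \<in> block_edges ?q"
        using same[OF \<open>B \<in> \<T>\<close> B(2) f[OF \<open>B \<in> \<T>\<close>]] by (rule mult_UpUp[OF e])
      then show ?thesis
        using k len by auto
    qed
  qed (use assms in simp)
  then show ?thesis
    by blast
qed

end

theorem theorem1p1:
  fixes n r :: nat and e :: set_partition
  assumes "r + 2 \<le> n"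
    and "is_idempotent (partition_monoid n) e"
    and "partition_rank n e = r"
  shows "let S = partition_monoid n;
             G = maximal_subgroup (PG (projection_algebra S)) (PG_idem S e)
         in group G \<and> G \<cong> sym_group r"
proof -
  interpret partition_degree n .
  let ?q = "e \<odot> partition_star e" and ?p = "partition_star e \<odot> e"
  have e: "e \<in> partitions n" and ee: "e \<odot> e = e"
    using assms(2) by (simp_all add: is_idempotent_def partition_monoid_def)
  note star = star_in_partitions[OF e]
  have star_idem: "partition_star e \<odot> partition_star e = partition_star e"
    using star_mult[OF e e] by (simp add: ee)
  obtain c0 where "transversals n ?q c0 r"
    using transversals_mult_star[OF e assms(3,1)] by blast
  then interpret transversals n ?q c0 r .
  have "?p \<odot> ?p = partition_star e \<odot> (e \<odot> partition_star e \<odot> e)"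
    using e star by (simp add: mult_assoc)
  then have p: "?p \<in> projs"
    using e star by (simp add: projs_iff star_mult mult_star_mult)
  \<comment> \<open>Regrouped this way, the product contains the squares of \<open>e\<close> and of
    its star; idempotency removes both, and regularity does the rest.\<close>
  have "?q \<odot> ?p \<odot> ?q = e \<odot> (partition_star e \<odot> partition_star e) \<odot> (e \<odot> e) \<odot> partition_star e"
    using e star by (simp add: mult_assoc)
  also have "\<dots> = ?q"
    using e by (simp add: star_idem ee mult_star_mult)
  finally have "group (maximal_subgroup quot (xq \<cdot>\<^bsub>quot\<^esub> cls [?p])) \<and>
      maximal_subgroup quot (xq \<cdot>\<^bsub>quot\<^esub> cls [?p]) \<cong> sym_group r"
    using maximal_subgroup_iso_sym_group[OF p] by simp
  moreover have "PG_idem (partition_monoid n) e = xq \<cdot>\<^bsub>quot\<^esub> cls [?p]"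
  proof -
    have "sg_mult (partition_monoid n) = partition_mult n" "star (partition_monoid n) = partition_star"
      by (simp_all add: partition_monoid_def)
    moreover have "PG_gen PA x = cls [x]" for x
      by (simp add: PG_gen_def cls_def)
    ultimately show ?thesis
      by (simp add: PG_idem_def Let_def xq_def M_eq)
  qed
  ultimately show ?thesis
    by (simp add: M_eq)
qed

end
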